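(* Let $p\ge3$, $n\ge1$, $N=p+n$, and let $X\in\mathbb{R}^p$, $Z\in\mathbb{R}^n$ have joint density $\eta^{N/2}f(\eta\{\|x-\theta\|^2+\|z\|^2\})$ with $\eta=1/\sigma^2$, where $\theta\in\mathbb{R}^p$, $\sigma>0$ are unknown and $f\ge0$ on $[0,\infty)$ with $\int_0^\infty t^{N/2-1}f(t)\,dt<\infty$; let $S=Z'Z$. For real $a,e$ let $\delta$ be the generalized Bayes estimator of $\theta$ with respect to the prior density $\pi(\theta,\eta)=\|\theta\|^{-2(p/2+a+1)}\eta^{-a-1+e}$ under the loss $\eta\|d-\theta\|^2$, i.e. $\delta=E(\eta\theta\mid X,S)/E(\eta\mid X,S)$, which (when finite) equals $$\delta=\frac{\int_{\mathbb{R}^p}\theta\,(\|X-\theta\|^2+S)^{-(n+p)/2+a-e-1}\|\theta\|^{-2(p/2+a+1)}\,d\theta}{\int_{\mathbb{R}^p}(\|X-\theta\|^2+S)^{-(n+p)/2+a-e-1}\|\theta\|^{-2(p/2+a+1)}\,d\theta}.$$ Assume the moment condition $\int_0^\infty\eta^{(n+p)/2-a+e}f(\eta)\,d\eta<\infty$. Let $c(p,n)=2(p-2)/(n+2)$. (i) If $-p/2-n/2-1<e\le-n/4-3/2$ and $-p/2-1<a\le\frac{c(p,n)(n/2+e)-p/2-1}{1+c(p,n)}$, then $\delta$ is minimax. (ii) If $e>-n/4-3/2$, $n\ge2$, and $-p/2-1<a\le a_*$, where $a_*$ is the larger solution of $g(a)=0$ with $$g(a)=(2p+2n+4e+4)a^2+a\{2p^2+2pn+12p+7n+4(p+3)e+10\}+4p^2+\tfrac{7}{2}pn+6(p+2)e+7n+13p+10,$$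 then $\delta$ is minimax.
   Context: Minimaxity is for estimating $\theta$ under the loss $(\delta-\theta)'(\delta-\theta)/\sigma^2$, with risk $E[(\delta-\theta)'(\delta-\theta)/\sigma^2]$; $X$ is minimax with constant risk, so $\delta$ is minimax iff its risk is at most that of $X$ for all $\theta,\sigma^2$. *)

theory Defs
  imports "HOL-Analysis.Analysis"
begin

definition sph_density ::
  "(real \<Rightarrow> real) \<Rightarrow> real^'p \<Rightarrow> real \<Rightarrow> (real^'p) \<times> (real^'n) \<Rightarrow> real" where
  "sph_density f \<theta> \<sigma> w =
     (let \<eta> = 1 / \<sigma>\<^sup>2; N = real CARD('p) + real CARD('n)
      in \<eta> powr (N / 2) * f (\<eta> * ((norm (fst w - \<theta>))\<^sup>2 + (norm (snd w))\<^sup>2)))"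

definition risk ::
  "(real \<Rightarrow> real) \<Rightarrow> (real^'p \<Rightarrow> real^'n \<Rightarrow> real^'p) \<Rightarrow> real^'p \<Rightarrow> real \<Rightarrow> ennreal" where
  "risk f \<delta> \<theta> \<sigma> =
     (\<integral>\<^sup>+ w. ennreal ((norm (\<delta> (fst w) (snd w) - \<theta>))\<^sup>2 / \<sigma>\<^sup>2 * sph_density f \<theta> \<sigma> w) \<partial>lborel)"

text \<open>Minimaxity, via the standing criterion: risk at most that of X for all theta, sigma.\<close>
definition minimax ::
  "(real \<Rightarrow> real) \<Rightarrow> (real^'p \<Rightarrow> real^'n \<Rightarrow> real^'p) \<Rightarrow> bool" where
  "minimax f \<delta> \<longleftrightarrow>
     (\<forall>(\<theta>::real^'p) (\<sigma>::real). \<sigma> > 0 \<longrightarrow>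
        risk f \<delta> \<theta> \<sigma> \<le> risk f (\<lambda>(x::real^'p) (z::real^'n). x) \<theta> \<sigma>)"

definition gb_weight :: "real \<Rightarrow> real \<Rightarrow> real \<Rightarrow> real^'p \<Rightarrow> real \<Rightarrow> real^'p \<Rightarrow> real" where
  "gb_weight n a e x s \<theta> =
     (let p = real CARD('p)
      in ((norm (x - \<theta>))\<^sup>2 + s) powr (- (n + p) / 2 + a - e - 1)
         * norm \<theta> powr (- 2 * (p / 2 + a + 1)))"

definition gb_est :: "real \<Rightarrow> real \<Rightarrow> real \<Rightarrow> real^'p \<Rightarrow> real \<Rightarrow> real^'p" where
  "gb_est n a e x s =
     inverse (\<integral>\<theta>. gb_weight n a e x s \<theta> \<partial>lborel)
       *\<^sub>R (\<integral>\<theta>. gb_weight n a e x s \<theta> *\<^sub>R \<theta> \<partial>lborel)"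

definition cpn :: "real \<Rightarrow> real \<Rightarrow> real" where
  "cpn p n = 2 * (p - 2) / (n + 2)"

definition gpoly :: "real \<Rightarrow> real \<Rightarrow> real \<Rightarrow> real \<Rightarrow> real" where
  "gpoly p n e a =
     (2*p + 2*n + 4*e + 4) * a\<^sup>2
     + a * (2*p\<^sup>2 + 2*p*n + 12*p + 7*n + 4*(p + 3)*e + 10)
     + 4*p\<^sup>2 + 7/2*p*n + 6*(p + 2)*e + 7*n + 13*p + 10"

end

theory Submission
  imports Defs
begin

text \<open>Put \<open>P = p/2 - 1\<close>, \<open>M = n/2 + e + 2\<close>, \<open>\<beta> = a + 2\<close>, \<open>n' = (n + 2)/4\<close>
  and \<open>w = |x|\<^sup>2/S\<close>.  Writing the posterior weight as a mixture over a scale parameter \<open>u > 0\<close> and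
  completing the square in \<open>\<theta>\<close> gives \<open>\<delta> = (1 - r(w)) x\<close>, where \<open>r\<close> is the mean
  of \<open>u/(1 + u)\<close> under a weight of hypergeometric type.  Integration by parts shows that
  \<open>r\<close> solves a Riccati equation.

  Stein's identity for spherically symmetric densities, in which \<open>f\<close> is replaced by
  \<open>F(q) = 1/2 \<integral>\<^sub>q f\<close> at each integration by parts, expresses the risk difference as the
  \<open>F\<close>-integral of \<open>-4 r ((1 + \<phi>) D + P - n' \<phi>)\<close> with \<open>\<phi> = w r\<close> and \<open>D = w \<phi>'/\<phi>\<close>.
  It remains to see that the bracket is nonnegative.  The Riccati equation makes upper bounds for
  \<open>\<phi>\<close> and lower bounds for \<open>D\<close> provable by barrier arguments: for \<open>\<beta> \<le> 0\<close> one gets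
  \<open>\<phi> \<le> (P + \<beta>)/(M - \<beta>)\<close> and \<open>D \<ge> 0\<close>; for \<open>\<beta> > 0\<close> one gets
  \<open>\<phi> \<le> (P + \<beta>)/(M - \<beta>(M + P + 1))\<close> and \<open>D \<ge> - \<beta>(P + 1 + \<beta>)/(1 - \<beta>)\<close>, and
  the bracket is nonnegative at these extreme values exactly when \<open>g(a) \<le> 0\<close>.\<close>

section \<open>Bounds from the Riccati equation\<close>

text \<open>The loss contains a cross term \<open>- 2 r (x - \<theta>) \<bullet> x\<close> and a
  quadratic term \<open>r\<^sup>2 |x|\<^sup>2\<close>. The latter equals
  \<open>(w r\<^sup>2) |z|\<^sup>2\<close>, so it is integrated by parts in \<open>z\<close>, the
  former in \<open>x\<close>; since \<open>4 n' = n + 2\<close>, the two divergences merge into one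
  bracket. Both fields are singular where x or z vanishes, and \<open>F\<close> may be infinite at
  0. Hence Stein's identity is proved along almost every coordinate line, on which at most one bad
  point is met. The split on \<beta> is a matter of sign. For \<beta> \<le> 0 the bound for \<phi>
  gives \<open>M \<phi> - P \<le> \<beta> (1 + \<phi>) \<le> 0\<close>, which keeps \<open>D\<close>
  from becoming negative. For \<beta> > 0 that sign is lost and some negative value of
  \<open>D\<close> has to be tolerated. How much is the delicate point: at the critical value the
  derivative of \<open>D\<close> must still be positive, and this is shown by playing the equation
  \<open>D = - X\<close> against the bound for \<phi>.\<close>

lemma barrier_positive:
  fixes h h' :: "real \<Rightarrow> real"
  assumes deriv: "\<And>w. w > 0 \<Longrightarrow> (h has_real_derivative h' w) (at w)"
    and start: "\<epsilon> > 0" "\<And>w. 0 < w \<Longrightarrow> w < \<epsilon> \<Longrightarrow> h w > 0"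
    and up: "\<And>w. w > 0 \<Longrightarrow> h w = 0 \<Longrightarrow> h' w > 0"
    and "w > 0"
  shows "h w > 0"
proof (rule ccontr)
  assume "\<not> h w > 0"
  define S where "S = {v. 0 < v \<and> h v \<le> 0}"
  define v where "v = Inf S"
  have "w \<in> S" using \<open>\<not> h w > 0\<close> \<open>w > 0\<close> by (simp add: S_def)
  have bdd: "bdd_below S" by (rule bdd_belowI[of _ 0]) (auto simp: S_def)
  have "\<epsilon> \<le> v" unfolding v_def
  proof (rule cInf_greatest)
    show "\<epsilon> \<le> y" if "y \<in> S" for y using that start(2)[of y] by (force simp: S_def)
  qed (use \<open>w \<in> S\<close> in auto)
  then have "v > 0" using start by simp
  have pos: "h y > 0" if "0 < y" "y < v" for y
    using that cInf_lower[OF _ bdd, of y] by (force simp: S_def v_def)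
  have cont: "isCont h v" using deriv[OF \<open>v > 0\<close>] by (rule DERIV_isCont)
  \<comment> \<open>If \<open>h v\<close> were positive, continuity would keep \<open>h\<close>
    positive up to \<open>v + d\<close> and push the infimum there.\<close>
  have "h v \<le> 0"
  proof (rule ccontr)
    assume "\<not> h v \<le> 0"
    then have "\<forall>\<^sub>F y in at v. h y > 0"
      using cont by (intro order_tendstoD(1)[of h "h v"]) (auto simp: isCont_def)
    then obtain d where d: "d > 0" "\<And>y. y \<noteq> v \<Longrightarrow> dist y v < d \<Longrightarrow> h y > 0"
      by (auto simp: eventually_at)
    have "v + d \<le> v" unfolding v_def
    proof (rule cInf_greatest)
      show "Inf S + d \<le> y" if "y \<in> S" for y
      proof (rule ccontr)
        assume "\<not> Inf S + d \<le> y"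
        moreover have "v \<le> y" using cInf_lower[OF that bdd] by (simp add: v_def)
        ultimately have "dist y v < d" by (simp add: dist_real_def v_def)
        then have "h y > 0" using d \<open>\<not> h v \<le> 0\<close> by (cases "y = v") auto
        then show False using that by (simp add: S_def)
      qed
    qed (use \<open>w \<in> S\<close> in auto)
    then show False using d by simp
  qed
  moreover have "h v \<ge> 0"
  proof (rule tendsto_lowerbound)
    show "(h \<longlongrightarrow> h v) (at_left v)"
      using cont by (simp add: isCont_def filterlim_at_split)
    show "\<forall>\<^sub>F y in at_left v. 0 \<le> h y"
      using eventually_at_left_real[OF \<open>v > 0\<close>] by eventually_elim (use pos in force)
  qed simp
  ultimately have "h v = 0" by simp
  \<comment> \<open>A positive slope at a zero makes \<open>h\<close> negative just to the left,
    where only positive values are left below the infimum.\<close>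
  then obtain d where "d > 0" "\<And>k. 0 < k \<Longrightarrow> k < d \<Longrightarrow> h (v - k) < h v"
    using DERIV_pos_inc_left[OF deriv[OF \<open>v > 0\<close>] up[OF \<open>v > 0\<close>]] by auto
  moreover define k where "k = min (d/2) (v/2)"
  ultimately have "0 < k" "k < d" "k < v" "h (v - k) < h v" using \<open>v > 0\<close> by (auto simp: min_def)
  then show False using pos[of "v - k"] \<open>h v = 0\<close> by auto
qed

text \<open>All bounds on \<phi> and \<open>D\<close> use only these assumptions. The bound on
  \<open>r\<close> by its limit at w = 0 is supplied later by a correlation inequality, not by the
  differential equation.\<close>

locale riccati =
  fixes P M \<beta> :: real and r :: "real \<Rightarrow> real"
  assumes P: "P > 0" and PM: "P + M > 0" and \<beta>: "\<beta> < 1" "P + \<beta> > 0" "M - \<beta> > 0"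
    and M: "\<beta> \<le> 0 \<or> M > 0"
    and r: "\<And>w. w > 0 \<Longrightarrow> 0 < r w" "\<And>w. w > 0 \<Longrightarrow> r w \<le> (P + \<beta>) / (P + 1)"
    and ode: "\<And>w. w > 0 \<Longrightarrow> (r has_real_derivative
        ((P + \<beta> + M * r w) * (1 + w * r w) / (1 + w) - (M + P + 1) * r w) / w) (at w)"
begin

abbreviation "r0 \<equiv> (P + \<beta>) / (P + 1)"

text \<open>\<open>Y\<close> is \<open>1 + w\<close> times the derivative of \<phi> = w r, so its
  sign decides whether \<phi> grows. The grouping separates \<beta> from a product that changes sign
  where \<open>M \<phi> = P\<close>.\<close>

definition "Y w = \<beta> * (1 + w * r w) - (M * (w * r w) - P) * (1 - r w)"

definition "D w = Y w / ((1 + w) * r w)"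

lemma r0: "0 < r0" "r0 < 1"
  using P \<beta> by (simp_all add: field_simps)

lemma r_lt_1: "w > 0 \<Longrightarrow> r w < 1"
  using r(2)[of w] r0 by simp

lemma r_deriv: "w > 0 \<Longrightarrow> (r has_real_derivative r w * (D w - 1) / w) (at w)"
proof -
  assume "w > 0"
  have "r w * D w = Y w / (1 + w)"
    using r(1)[OF \<open>w > 0\<close>] by (simp add: D_def)
  then have "r w * (D w - 1) = Y w / (1 + w) - r w" by (simp add: algebra_simps)
  also have "\<dots> = (P + \<beta> + M * r w) * (1 + w * r w) / (1 + w) - (M + P + 1) * r w"
    using \<open>w > 0\<close> by (simp add: Y_def divide_simps) algebra
  finally show ?thesis using ode[OF \<open>w > 0\<close>] by simp
qed

lemma phi_deriv: "w > 0 \<Longrightarrow> ((\<lambda>w. w * r w) has_real_derivative r w * D w) (at w)"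
  by (auto intro!: derivative_eq_intros r_deriv simp: field_simps)

text \<open>The derivative is only needed in a form where the value \<open>- X\<close> of \<open>D\<close> has been used to
  eliminate the quadratic terms: a barrier argument looks at it only when \<open>D\<close> meets the barrier.\<close>

lemma D_deriv:
  assumes w: "w > 0" and D: "D w = - X"
  shows "(D has_real_derivative
    (X * ((P + \<beta>) / r w - (P + 1)) - (M * (w * r w) - P) * (1 + X)) / ((1 + w) * w)) (at w)"
proof -
  define R where "R = r w"
  have R: "R > 0" using r(1)[OF w] by (simp add: R_def)
  define Y' where "Y' = \<beta> * (R * D w) - M * (R * D w) * (1 - R) + (M * (w * R) - P) * (R * (D w - 1) / w)"
  have "(Y has_real_derivative Y') (at w)"
    unfolding Y_def[abs_def] Y'_def R_def
    by (rule derivative_eq_intros phi_deriv[OF w] r_deriv[OF w] refl)+ (simp add: algebra_simps)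
  moreover have "((\<lambda>w. (1 + w) * r w) has_real_derivative R + (1 + w) * (R * (D w - 1) / w)) (at w)"
    unfolding R_def by (rule derivative_eq_intros r_deriv[OF w] refl)+ (simp add: algebra_simps)
  ultimately have *: "(D has_real_derivative
      (Y' * ((1 + w) * R) - Y w * (R + (1 + w) * (R * (D w - 1) / w))) / (((1 + w) * R) * ((1 + w) * R))) (at w)"
    unfolding D_def[abs_def] R_def using w r(1)[OF w]
    by (intro DERIV_divide[THEN DERIV_cong]) auto
  have Yw: "Y w = - X * ((1 + w) * R)"
    using D w R by (simp add: D_def divide_eq_eq R_def)
  have eq: "(M * (w * R) - P) * (1 - R) = \<beta> * (1 + w * R) + X * ((1 + w) * R)"
    using Yw by (simp add: Y_def R_def)
  have "(Y' * ((1 + w) * R) - Y w * (R + (1 + w) * (R * (D w - 1) / w))) / (((1 + w) * R) * ((1 + w) * R))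
      = (X * ((P + \<beta>) / R - (P + 1)) - (M * (w * R) - P) * (1 + X)) / ((1 + w) * w)"
  proof -
    have "w * (Y' + X * (R + (1 + w) * (R * (- X - 1) / w))) = R * (X * ((P + \<beta>) / R - (P + 1)) - (M * (w * R) - P) * (1 + X))"
      unfolding Y'_def D using w R eq by (simp add: field_simps) algebra
    then show ?thesis unfolding Yw D using w R by (simp add: divide_simps) algebra
  qed
  then show ?thesis using * by (simp add: R_def)
qed

text \<open>Strictness is what later makes the barrier inequalities strict. Where \<open>r\<close>
  touches \<open>r0\<close> the equation gives it a negative slope, so slightly to the left it would
  exceed \<open>r0\<close>, against the assumed bound.\<close>

lemma r_lt_r0:
  assumes w: "w > 0"
  shows "r w < r0"
proof (rule ccontr)
  assume "\<not> r w < r0"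
  then have eq: "r w = r0" using r(2)[OF w] by simp
  \<comment> \<open>This factor carries the sign of the slope: at \<open>r w = r0\<close> the terms
    without \<open>w\<close> cancel because \<open>(P + 1) r0 = P + \<beta>\<close>.\<close>
  have "M * (1 - r0) + 1 - \<beta> > 0"
  proof (cases "\<beta> \<le> 0")
    case True
    have "M * (1 - s) + 1 - \<beta> = (M - \<beta>) * (1 - s) - \<beta> * s + 1" for s by algebra
    moreover have "(M - \<beta>) * (1 - r0) > 0" "\<beta> * r0 \<le> 0"
      using \<beta> r0 True by (auto intro!: mult_pos_pos mult_nonpos_nonneg simp del: times_divide_eq_right)
    ultimately show ?thesis by (smt (verit))
  next
    case False
    then have "M * (1 - r0) > 0" using M r0 by (auto intro!: mult_pos_pos)
    then show ?thesis using \<beta> by linarith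
  qed
  then have pos: "w * r0 * (M * (1 - r0) + 1 - \<beta>) > 0"
    using w r0 by (intro mult_pos_pos) auto
  have eq1: "(P + 1) * r0 = P + \<beta>" using P by simp
  have "(1 + w) * (r w * (D w - 1)) = Y w - (1 + w) * r w"
  proof -
    have "r w * D w = Y w / (1 + w)" using r(1)[OF w] by (simp add: D_def)
    then have "(1 + w) * (r w * D w) = Y w" using w by simp
    then show ?thesis by (simp add: algebra_simps)
  qed
  also have "\<dots> = (P + \<beta>) - (P + 1) * r0 - w * r0 * (M * (1 - r0) + 1 - \<beta>)"
    unfolding Y_def eq by algebra
  also have "\<dots> < 0" using pos eq1 by linarith
  finally have "r w * (D w - 1) < 0" using w by (simp add: mult_less_0_iff)
  then have "r w * (D w - 1) / w < 0" using w by (simp add: divide_neg_pos)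
  from DERIV_neg_dec_left[OF r_deriv[OF w] this]
  obtain d where d: "d > 0" "\<And>k. 0 < k \<Longrightarrow> k < d \<Longrightarrow> r w < r (w - k)" by auto
  have "r w < r (w - min (d/2) (w/2))" using d(1) w by (intro d(2)) (auto simp: min_def)
  also have "\<dots> \<le> r0" using w d(1) by (intro r(2)) (auto simp: min_def)
  finally show False using eq by simp
qed

lemma phi_le_w: "w > 0 \<Longrightarrow> 0 < w * r w \<and> w * r w < w"
  using r(1)[of w] r_lt_1[of w] by simp

text \<open>The start of the barrier argument comes from \<open>r < 1\<close>: then \<phi> < w, so
  \<phi> is below \<open>C\<close> for all w < C. At a crossing the slope of \<phi> has the sign of
  \<open>Y\<close>.\<close>

lemma phi_lt_barrier:
  assumes "C > 0" and C: "\<And>w. w > 0 \<Longrightarrow> w * r w = C \<Longrightarrow> Y w < 0" and w: "w > 0"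
  shows "w * r w < C"
proof -
  have "C - w * r w > 0"
  proof (rule barrier_positive[where h = "\<lambda>w. C - w * r w" and h' = "\<lambda>w. - (r w * D w)" and \<epsilon> = C])
    show "((\<lambda>w. C - w * r w) has_real_derivative - (r w * D w)) (at w)" if "w > 0" for w
      by (rule derivative_eq_intros phi_deriv[OF that] refl)+ simp
    show "C - w * r w > 0" if "0 < w" "w < C" for w
      using less_trans[OF conjunct2[OF phi_le_w[OF that(1)]] that(2)] by simp
    show "- (r w * D w) > 0" if "w > 0" "C - w * r w = 0" for w
      using C[of w] that r(1)[of w] by (simp add: D_def divide_neg_pos)
  qed (use assms in auto)
  then show ?thesis by simp
qed

text \<open>The last hypothesis is the positivity of the numerator in \<open>D_deriv\<close> at a
  crossing; near w = 0 even \<open>D > 0\<close> holds.\<close>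

lemma D_gt_barrier:
  assumes "X > 0" and w: "w > 0"
    and X: "\<And>w. w > 0 \<Longrightarrow> D w = - X \<Longrightarrow>
      (M * (w * r w) - P) * (1 + X) < X * ((P + \<beta>) / r w - (P + 1))"
  shows "D w > - X"
proof -
  \<comment> \<open>Up to terms of size \<open>(|M| + |\<beta>|) \<phi>\<close>, \<open>Y\<close> is
    at least \<open>\<beta> + P (1 - r0) = r0\<close>. For w < \<epsilon> these terms stay below
    \<open>r0\<close>, because \<phi> < w.\<close>
  define \<epsilon> where "\<epsilon> = (P + \<beta>) / (\<bar>M\<bar> + \<bar>\<beta>\<bar>) / (P + 1)"
  have ne: "\<bar>M\<bar> + \<bar>\<beta>\<bar> > 0" using \<beta> by (auto simp: abs_if)
  have D_pos: "D w > 0" if "0 < w" "w < \<epsilon>" for w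
  proof -
    define ph where "ph = w * r w"
    have ph: "0 < ph" "ph < \<epsilon>" using phi_le_w[OF that(1)] that(2) unfolding ph_def by linarith+
    have "\<epsilon> = (P + \<beta>) / (P + 1) / (\<bar>M\<bar> + \<bar>\<beta>\<bar>)" by (simp add: \<epsilon>_def mult.commute)
    then have "ph * (\<bar>M\<bar> + \<bar>\<beta>\<bar>) < (P + \<beta>) / (P + 1)"
      using ph(2) ne by (simp only: pos_less_divide_eq)
    moreover have "M * ph * (1 - r w) \<le> \<bar>M\<bar> * ph"
    proof -
      have "M * ph * (1 - r w) \<le> \<bar>M * ph * (1 - r w)\<bar>" by simp
      also have "\<dots> = \<bar>M\<bar> * ph * (1 - r w)" using ph r_lt_1[OF that(1)] by (simp add: abs_mult)
      also have "\<dots> \<le> \<bar>M\<bar> * ph * 1" using ph r(1)[OF that(1)] by (intro mult_left_mono) auto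
      finally show ?thesis by simp
    qed
    moreover have "- \<beta> * ph \<le> \<bar>\<beta>\<bar> * ph" using ph by (intro mult_right_mono) auto
    moreover have "P * (1 - r w) \<ge> P * (1 - r0)"
      using P r(2)[OF that(1)] by (intro mult_left_mono) auto
    moreover have "\<beta> + P * (1 - r0) = (P + \<beta>) / (P + 1)" using P by (simp add: field_simps)
    ultimately have "Y w > 0"
      unfolding Y_def ph_def[symmetric] by (simp add: algebra_simps)
    then show ?thesis using that r(1)[of w] by (simp add: D_def)
  qed
  define h' where "h' w = deriv D w" for w
  have "X + D w > 0"
  proof (rule barrier_positive[where h = "\<lambda>w. X + D w" and h' = h' and \<epsilon> = \<epsilon>])
    show "((\<lambda>w. X + D w) has_real_derivative h' w) (at w)" if "w > 0" for w
    proof -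
      \<comment> \<open>Choosing \<open>X\<close> as \<open>- D w\<close> makes the premise of
        \<open>D_deriv\<close> trivial, which gives differentiability at every point and not only at
        crossings.\<close>
      have "(D has_real_derivative (X * 0 + h' w)) (at w)"
        using D_deriv[OF that, of "- D w"] DERIV_imp_deriv by (fastforce simp: h'_def)
      then show ?thesis by (auto intro!: derivative_eq_intros)
    qed
    show "\<epsilon> > 0" using ne P \<beta> by (simp add: \<epsilon>_def)
    show "X + D w > 0" if "0 < w" "w < \<epsilon>" for w using D_pos[OF that] assms by simp
    show "h' w > 0" if "w > 0" "X + D w = 0" for w
    proof -
      have "D w = - X" using that by simp
      then show ?thesis
        unfolding h'_def DERIV_imp_deriv[OF D_deriv[OF that(1) \<open>D w = - X\<close>]]
        using X[of w] that by (intro divide_pos_pos) auto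
    qed
  qed (use w in auto)
  then show ?thesis by simp
qed

lemma nonpos_case:
  assumes b: "\<beta> \<le> 0" and w: "w > 0"
  shows "w * r w \<le> (P + \<beta>) / (M - \<beta>)" "D w \<ge> 0"
proof -
  have bound: "w * r w \<le> (P + \<beta>) / (M - \<beta>)" if w: "w > 0" for w
  proof (rule field_le_epsilon)
    fix \<epsilon> :: real assume "\<epsilon> > 0"
    \<comment> \<open>The slack \<epsilon> makes the barrier strict: for \<beta> = 0 both summands
      of \<open>Y\<close> below would vanish at the exact bound.\<close>
    define C where "C = (P + \<beta>) / (M - \<beta>) + \<epsilon>"
    have "C > 0" using \<beta> \<open>\<epsilon> > 0\<close> by (simp add: C_def add_pos_pos)
    have "(M - \<beta>) * C = P + \<beta> + (M - \<beta>) * \<epsilon>" 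
      using \<beta>(3) unfolding C_def distrib_left by simp
    then have C': "(M - \<beta>) * C - (P + \<beta>) > 0" using \<beta> \<open>\<epsilon> > 0\<close> by simp
    have "w * r w < C"
    proof (rule phi_lt_barrier[OF \<open>C > 0\<close> _ w])
      fix w :: real assume w: "w > 0" "w * r w = C"
      have "Y w = - (((M - \<beta>) * C - (P + \<beta>)) * (1 - r w)) + \<beta> * r w * (1 + C)"
        unfolding Y_def w(2) by (simp add: algebra_simps)
      moreover have "((M - \<beta>) * C - (P + \<beta>)) * (1 - r w) > 0"
        using C' r_lt_1[OF w(1)] by simp
      moreover have "\<beta> * r w * (1 + C) \<le> 0"
        using b r(1)[OF w(1)] \<open>C > 0\<close> by (intro mult_nonpos_nonneg) auto
      ultimately show "Y w < 0" by linarith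
    qed
    then show "w * r w \<le> (P + \<beta>) / (M - \<beta>) + \<epsilon>" by (simp add: C_def)
  qed
  show "w * r w \<le> (P + \<beta>) / (M - \<beta>)" by (rule bound[OF w])
  have "D w > - X" if "X > 0" for X
  proof (rule D_gt_barrier[OF that w])
    fix w :: real assume w: "w > 0"
    have "(M - \<beta>) * (w * r w) \<le> P + \<beta>" using bound[OF w] \<beta> by (simp add: field_simps)
    then have "M * (w * r w) - P \<le> \<beta> * (1 + w * r w)" by (simp add: algebra_simps)
    also have "\<dots> \<le> 0" using b phi_le_w[OF w] by (intro mult_nonpos_nonneg) auto
    finally have "(M * (w * r w) - P) * (1 + X) \<le> 0" using \<open>X > 0\<close> by (intro mult_nonpos_nonneg) auto
    moreover have "(P + \<beta>) / r w - (P + 1) > 0"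
      using r_lt_r0[OF w] r(1)[OF w] P by (simp add: field_simps)
    ultimately show "(M * (w * r w) - P) * (1 + X) < X * ((P + \<beta>) / r w - (P + 1))"
      using \<open>X > 0\<close> by (smt (verit) mult_pos_pos)
  qed
  then have "- X < D w" if "X > 0" for X using that .
  from this[of "- D w"] show "D w \<ge> 0" by fastforce
qed

lemma pos_case:
  assumes b: "\<beta> > 0" and n': "n' > 0"
    and g: "\<beta>\<^sup>2 * (P + M) + \<beta> * (2 * P * (P + M + 1) + M + n') \<le> P * (M - n')"
    and w: "w > 0"
  shows "w * r w \<le> (P + \<beta>) / (M - \<beta> * (M + P + 1))"
    and "(1 + w * r w) * D w + P - n' * (w * r w) \<ge> 0"
proof -
  have M0: "M > 0" using M b by auto
  \<comment> \<open>\<open>C\<close> is the value of \<phi> at which \<open>Y\<close> would vanish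
    if \<open>r\<close> were frozen at \<open>r0\<close>; as \<open>r < r0\<close>, the true
    \<open>Y\<close> is negative there. \<open>X\<close> is explained by the computation that closes
    the proof.\<close>
  define L where "L = M - \<beta> * (M + P + 1)"
  define C where "C = (P + \<beta>) / L"
  define X where "X = \<beta> * (P + 1 + \<beta>) / (1 - \<beta>)"
  have nn: "0 \<le> \<beta>\<^sup>2 * (P + M)" "0 \<le> \<beta> * (M + n')" using b P M0 n' by simp_all
  then have "P * (2 * \<beta> * (P + M + 1)) \<le> P * (M - n')"
    using g by (simp add: algebra_simps)
  then have "2 * \<beta> * (P + M + 1) \<le> M - n'" using P by simp
  then have half: "2 * (\<beta> * (P + M + 1)) < M" using n' by simp
  then have L0: "L > 0" using M0 by (simp add: L_def algebra_simps)
  have C0: "C > 0" using L0 \<beta> by (simp add: C_def)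
  have X0: "X > 0" using b P \<beta> by (simp add: X_def)
  have Xb: "X * (1 - \<beta>) = \<beta> * (P + 1 + \<beta>)" using \<beta> by (simp add: X_def)
  have CL: "C * L = P + \<beta>" using L0 by (simp add: C_def)
  have r0b: "(1 - r0) * (P + 1) = 1 - \<beta>" using P by (simp add: field_simps)
  have bound: "w * r w < C" if w: "w > 0" for w
  proof (rule phi_lt_barrier[OF C0 _ w])
    fix w :: real assume w: "w > 0" "w * r w = C"
    have "(M * C - P) * (1 - \<beta>) = \<beta> * (1 + C) * (P + 1)"
      using CL unfolding L_def by algebra
    then have "(M * C - P) * ((1 - r0) * (P + 1)) = \<beta> * (1 + C) * (P + 1)" by (simp only: r0b)
    then have "(M * C - P) * (1 - r0) * (P + 1) = \<beta> * (1 + C) * (P + 1)" by (simp only: mult.assoc)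
    then have eq: "(M * C - P) * (1 - r0) = \<beta> * (1 + C)" using P by (simp only: mult_cancel_right) simp
    have "0 < \<beta> * (1 + C)" using b C0 by simp
    then have "0 < M * C - P" using eq r0 by (metis diff_gt_0_iff_gt zero_less_mult_pos2)
    moreover have "Y w = - ((M * C - P) * (r0 - r w))"
      unfolding Y_def w(2) eq[symmetric] by algebra
    ultimately show "Y w < 0" using r_lt_r0[OF w(1)] by simp
  qed
  show "w * r w \<le> (P + \<beta>) / (M - \<beta> * (M + P + 1))"
    using bound[OF w] by (simp add: C_def L_def)
  \<comment> \<open>Discard in \<open>g\<close> the nonnegative terms free of \<open>M\<close> and
    divide by \<open>M\<close>. The result forces \<beta> < 1/2 and P > \<beta>, and together with
    them yields \<open>key\<close>.\<close>
  have T: "P * (1 - 2 * \<beta>) \<ge> \<beta> + \<beta>\<^sup>2"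
  proof -
    have "0 \<le> \<beta>\<^sup>2 * P + \<beta> * (2 * P * (P + 1) + n') + P * n'" using b P n' by simp
    then have "M * (\<beta> + \<beta>\<^sup>2) \<le> M * (P * (1 - 2 * \<beta>))" using g by (simp add: algebra_simps)
    then show ?thesis using M0 by simp
  qed
  have b2: "\<beta> < 1 / 2"
  proof -
    have "0 < P * (1 - 2 * \<beta>)" using T b by (smt (verit) zero_less_power)
    then show ?thesis using P by (simp add: zero_less_mult_iff)
  qed
  \<comment> \<open>Because \<open>(1 + X) (1 - \<beta>) = 1 + \<beta> P + \<beta>\<^sup>2\<close>,
    this says \<open>(1 + X) (P + 1) < (P + 1 + \<beta>)\<^sup>2\<close>, the margin by which the
    barrier for \<open>D\<close> holds.\<close>
  have key: "(P + 1) * (1 + \<beta> * P + \<beta>\<^sup>2) < (P + 1 + \<beta>)\<^sup>2 * (1 - \<beta>)"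
  proof -
    have bb: "\<beta>\<^sup>2 < 1 / 4" using b b2 power_strict_mono[of \<beta> "1/2" 2] by (simp add: power2_eq_square)
    have "P * (1 - 2 * \<beta>) \<le> P" using P b by simp
    then have "P > \<beta>" using T b by (smt (verit) zero_less_power)
    have "P * (1 - 2 * \<beta>\<^sup>2) > \<beta> * (1 / 2)" using \<open>P > \<beta>\<close> bb b by (intro mult_strict_mono) auto
    moreover have "\<beta> * \<beta>\<^sup>2 < \<beta> * (1 / 4)" using b bb by simp
    moreover have "0 \<le> \<beta> * (1 - 2 * \<beta>)" using b b2 by simp
    moreover have "0 \<le> P * (P * (1 - 2 * \<beta>) - (\<beta> + \<beta>\<^sup>2))" using P T by simp
    moreover have "(P + 1 + \<beta>)\<^sup>2 * (1 - \<beta>) - (P + 1) * (1 + \<beta> * P + \<beta>\<^sup>2)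
       = P * (P * (1 - 2 * \<beta>) - (\<beta> + \<beta>\<^sup>2)) + P * (1 - 2 * \<beta>\<^sup>2) + \<beta> * (1 - 2 * \<beta>) - \<beta> * \<beta>\<^sup>2"
      by algebra
    ultimately show ?thesis using b by linarith
  qed
  have "D w > - X"
  proof (rule D_gt_barrier[OF X0 w])
    fix w :: real assume w: "w > 0" and D: "D w = - X"
    define R where "R = r w"
    define \<phi> where "\<phi> = w * R"
    define E where "E = M * \<phi> - P"
    define k where "k = (P + \<beta>) / R - (P + 1)"
    have R: "0 < R" "R < 1" using r(1)[OF w] r_lt_1[OF w] by (simp_all add: R_def)
    have \<phi>: "\<phi> > 0" using w R by (simp add: \<phi>_def)
    have kR: "k * R = P + \<beta> - (P + 1) * R" using R by (simp add: k_def field_simps)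
    have eq: "E * (1 - R) = \<beta> * (1 + \<phi>) + X * ((1 + w) * R)"
    proof -
      have "Y w = - X * ((1 + w) * R)" using D w R by (simp add: D_def divide_eq_eq R_def)
      then show ?thesis by (simp add: Y_def E_def \<phi>_def R_def)
    qed
    have E: "E * (1 - \<beta>) \<le> \<beta> * (1 + \<phi>) * (P + 1)"
    proof -
      have "\<phi> * L \<le> P + \<beta>"
        using bound[OF w] L0 by (simp add: C_def \<phi>_def R_def pos_less_divide_eq)
      then show ?thesis unfolding E_def L_def by (simp add: algebra_simps)
    qed
    \<comment> \<open>Eliminating \<open>E\<close> between the crossing equation \<open>eq\<close>
      and its upper bound gives a lower bound for \<open>k\<close>, the factor of the positive term
      in the derivative of \<open>D\<close>.\<close>
    have *: "(P + 1 + \<beta>) * (1 + w) \<le> (1 + \<phi>) * k"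
    proof -
      have "E * (1 - \<beta>) * (1 - R) \<le> \<beta> * (1 + \<phi>) * (P + 1) * (1 - R)"
        using E R by (intro mult_right_mono) auto
      moreover have "E * (1 - \<beta>) * (1 - R) = \<beta> * (1 + \<phi>) * (1 - \<beta>) + \<beta> * (P + 1 + \<beta>) * ((1 + w) * R)"
        using eq Xb by algebra
      ultimately have "\<beta> * (P + 1 + \<beta>) * ((1 + w) * R)
          \<le> \<beta> * (1 + \<phi>) * (P + 1) * (1 - R) - \<beta> * (1 + \<phi>) * (1 - \<beta>)" by linarith
      also have "\<dots> = \<beta> * (1 + \<phi>) * (k * R)" unfolding kR by algebra
      finally have "(\<beta> * R) * ((P + 1 + \<beta>) * (1 + w)) \<le> (\<beta> * R) * ((1 + \<phi>) * k)"
        by (simp add: mult_ac)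
      then show ?thesis using b R by simp
    qed
    \<comment> \<open>\<open>D\<close> can be this negative only where \<open>w\<close> is large compared with \<open>\<phi>\<close>\<close>
    have w_ge: "(1 + \<phi>)\<^sup>2 \<le> 1 + w"
    proof -
      have "(P + 1) * (1 + w) * R \<le> (P + 1 + \<beta>) * (1 + w) * R"
        using b w R by (intro mult_right_mono) auto
      also have "\<dots> \<le> (1 + \<phi>) * (k * R)" using * R by (simp add: mult.assoc[symmetric])
      also have "\<dots> \<le> (1 + \<phi>) * ((P + 1) * (1 - R))"
        unfolding kR using \<phi> \<beta> by (intro mult_left_mono) (auto simp: algebra_simps)
      finally have "(P + 1) * ((1 + w) * R) \<le> (P + 1) * ((1 + \<phi>) * (1 - R))" by (simp add: mult_ac)
      then have "(1 + w) * R \<le> (1 + \<phi>) * (1 - R)" using P by simp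
      then have "w * ((1 + w) * R) \<le> w * ((1 + \<phi>) * (1 - R))" using w by simp
      then have "(1 + w) * \<phi> \<le> (1 + \<phi>) * (w - \<phi>)" by (simp add: \<phi>_def algebra_simps)
      then show ?thesis by (simp add: algebra_simps power2_eq_square)
    qed
    have X1: "(1 + X) * (1 - \<beta>) = 1 + \<beta> * P + \<beta>\<^sup>2" using Xb by algebra
    have "(1 + X) * (P + 1) * (1 - \<beta>) < (P + 1 + \<beta>)\<^sup>2 * (1 - \<beta>)"
    proof -
      have "(1 + X) * (P + 1) * (1 - \<beta>) = (P + 1) * (1 + \<beta> * P + \<beta>\<^sup>2)" using X1 by algebra
      then show ?thesis using key by linarith
    qed
    then have "(1 + X) * (P + 1) < (P + 1 + \<beta>)\<^sup>2" using \<beta> by simp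
    \<comment> \<open>The lower bound on \<open>k\<close> has \<open>1 + w\<close> in the numerator
      and \<open>1 + \<phi>\<close> in the denominator. Replacing \<open>1 + w\<close> by
      \<open>(1 + \<phi>)\<^sup>2\<close> leaves one factor \<open>1 + \<phi>\<close>, exactly what
      the bound on \<open>E\<close> carries.\<close>
    then have "(1 + X) * (P + 1) * (1 + \<phi>)\<^sup>2 < (P + 1 + \<beta>)\<^sup>2 * (1 + w)"
      using w_ge \<phi> X0 P by (intro mult_less_le_imp_less) auto
    also have "\<dots> \<le> (P + 1 + \<beta>) * ((1 + \<phi>) * k)"
      using * P b by (simp add: power2_eq_square mult.assoc)
    finally have "(1 + \<phi>) * ((1 + X) * (P + 1) * (1 + \<phi>)) < (1 + \<phi>) * ((P + 1 + \<beta>) * k)"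
      by (simp add: power2_eq_square mult_ac)
    then have lt: "(1 + X) * (P + 1) * (1 + \<phi>) < (P + 1 + \<beta>) * k" using \<phi> by simp
    have "E * (1 + X) * (1 - \<beta>) \<le> \<beta> * (1 + \<phi>) * (P + 1) * (1 + X)"
      using mult_right_mono[OF E, of "1 + X"] X0 by (simp add: mult_ac)
    also have "\<dots> < \<beta> * ((P + 1 + \<beta>) * k)" using mult_strict_left_mono[OF lt b] by (simp add: mult_ac)
    also have "\<dots> = X * k * (1 - \<beta>)" using Xb by algebra
    finally show "(M * (w * r w) - P) * (1 + X) < X * ((P + \<beta>) / r w - (P + 1))"
      using \<beta> by (simp add: E_def k_def \<phi>_def R_def)
  qed
  \<comment> \<open>Since \<open>L + P + \<beta> = (1 - \<beta>) (M + P)\<close>, the denominator of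
    \<open>X\<close> cancels. The bracket at \<phi> = C and D = - X, multiplied by \<open>L\<close>,
    is then the right side minus the left side of \<open>g\<close>.\<close>
  have "X * (L + (P + \<beta>)) = \<beta> * (P + 1 + \<beta>) * (M + P)"
    using Xb unfolding L_def by algebra
  then have "0 \<le> P * L - n' * (P + \<beta>) - X * (L + (P + \<beta>))"
    using g unfolding L_def by (simp add: algebra_simps power2_eq_square)
  also have "\<dots> = (P - X - (n' + X) * C) * L" using CL by algebra
  finally have "0 \<le> (P - X - (n' + X) * C) * L" .
  then have "0 \<le> P - X - (n' + X) * C" using L0 by (simp add: zero_le_mult_iff)
  moreover have "(n' + X) * (w * r w) \<le> (n' + X) * C"
    using bound[OF w] n' X0 by (intro mult_left_mono) auto
  moreover have "(1 + w * r w) * (- X) \<le> (1 + w * r w) * D w"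
    using \<open>D w > - X\<close> phi_le_w[OF w] by (intro mult_left_mono) auto
  ultimately show "(1 + w * r w) * D w + P - n' * (w * r w) \<ge> 0"
    by (simp add: algebra_simps)
qed

end

section \<open>The hypergeometric weight\<close>

lemma has_real_derivative_integral:
  fixes g g' :: "real \<Rightarrow> 'b \<Rightarrow> real"
  assumes y: "l < y" "y < h"
    and int: "\<And>x. l < x \<Longrightarrow> x < h \<Longrightarrow> integrable M (g x)"
    and deriv: "\<And>x u. l < x \<Longrightarrow> x < h \<Longrightarrow> u \<in> space M \<Longrightarrow> ((\<lambda>x. g x u) has_real_derivative g' x u) (at x)"
    and bound: "\<And>x u. l < x \<Longrightarrow> x < h \<Longrightarrow> u \<in> space M \<Longrightarrow> \<bar>g' x u\<bar> \<le> B u"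
    and B: "integrable M B" and meas: "g' y \<in> borel_measurable M"
  shows "((\<lambda>x. \<integral>u. g x u \<partial>M) has_real_derivative (\<integral>u. g' y u \<partial>M)) (at y)"
proof -
  define d where "d = min (h - y) (y - l)"
  have "d > 0" using y by (simp add: d_def)
  have "((\<lambda>t. ((\<integral>u. g (y + t) u \<partial>M) - (\<integral>u. g y u \<partial>M)) / t) \<longlongrightarrow> (\<integral>u. g' y u \<partial>M)) (at 0)"
    unfolding tendsto_at_iff_sequentially
  proof (intro allI impI, unfold comp_def)
    fix X :: "nat \<Rightarrow> real" assume X0: "\<forall>i. X i \<in> UNIV - {0}" and X: "X \<longlonglongrightarrow> 0"
    from X \<open>d > 0\<close> obtain N where N: "\<And>i. i \<ge> N \<Longrightarrow> \<bar>X i\<bar> < d"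
      by (auto simp: LIMSEQ_def)
    \<comment> \<open>Dropping the first \<open>N\<close> terms keeps every \<open>y + Z i\<close>
      between \<open>l\<close> and \<open>h\<close>, so that \<open>B\<close> dominates all
      difference quotients of the sequence.\<close>
    define Z where "Z i = X (i + N)" for i
    have Z0: "Z i \<noteq> 0" and Zd: "\<bar>Z i\<bar> < d" for i using X0 N[of "i + N"] by (auto simp: Z_def)
    have Zr: "l < y + t" "y + t < h" if "\<bar>t\<bar> \<le> \<bar>Z i\<bar>" for i t using Zd[of i] that by (auto simp: d_def)
    have Z: "Z \<longlonglongrightarrow> 0" unfolding Z_def by (rule LIMSEQ_ignore_initial_segment[OF X])
    have "(\<lambda>i. \<integral>u. (g (y + Z i) u - g y u) / Z i \<partial>M) \<longlonglongrightarrow> (\<integral>u. g' y u \<partial>M)"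
    proof (rule integral_dominated_convergence[where w = B])
      show "AE u in M. (\<lambda>i. (g (y + Z i) u - g y u) / Z i) \<longlonglongrightarrow> g' y u"
      proof (rule AE_I2)
        fix u assume "u \<in> space M"
        from deriv[OF y this] have "((\<lambda>t. (g (y + t) u - g y u) / t) \<longlongrightarrow> g' y u) (at 0)"
          by (simp add: DERIV_def)
        then show "(\<lambda>i. (g (y + Z i) u - g y u) / Z i) \<longlonglongrightarrow> g' y u"
          using Z Z0 unfolding tendsto_at_iff_sequentially comp_def by auto
      qed
      show "AE u in M. norm ((g (y + Z i) u - g y u) / Z i) \<le> B u" for i
      proof (rule AE_I2)
        fix u assume u: "u \<in> space M"
        have "norm (g (y + Z i) u - g y u) \<le> B u * norm (y + Z i - y)"
        proof (rule field_differentiable_bound[where S = "closed_segment y (y + Z i)" and f' = "\<lambda>x. g' x u"])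
          fix x assume "x \<in> closed_segment y (y + Z i)"
          then have "l < x" "x < h" using Zr[of "x - y" i]
            by (auto simp: closed_segment_eq_real_ivl abs_if split: if_splits)
          then show "((\<lambda>x. g x u) has_field_derivative g' x u) (at x within closed_segment y (y + Z i))"
            and "norm (g' x u) \<le> B u"
            using deriv[OF _ _ u] bound[OF _ _ u] by (auto intro: has_field_derivative_at_within)
        qed auto
        then show "norm ((g (y + Z i) u - g y u) / Z i) \<le> B u"
          using Z0[of i] by (simp add: divide_le_eq abs_divide)
      qed
      show "(\<lambda>u. (g (y + Z i) u - g y u) / Z i) \<in> borel_measurable M" for i
        using int[OF Zr(1,2)[of "Z i" i]] int[OF y] by (auto intro!: borel_measurable_divide borel_measurable_diff)
    qed (use B meas in auto)
    then have "(\<lambda>i. ((\<integral>u. g (y + Z i) u \<partial>M) - (\<integral>u. g y u \<partial>M)) / Z i) \<longlonglongrightarrow> (\<integral>u. g' y u \<partial>M)"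
      using int[OF Zr(1,2)[of "Z i" i for i]] int[OF y] by simp
    then show "(\<lambda>i. ((\<integral>u. g (y + X i) u \<partial>M) - (\<integral>u. g y u \<partial>M)) / X i) \<longlonglongrightarrow> (\<integral>u. g' y u \<partial>M)"
      unfolding Z_def by (rule LIMSEQ_offset)
  qed
  then show ?thesis by (simp add: DERIV_def)
qed

text \<open>A bound valid for either sign of \<open>c\<close>, so that the kernel estimates need no
  case distinction on exponents.\<close>

lemma powr_le_sum_ends:
  fixes x :: real
  assumes "0 < l" "l \<le> x" "x \<le> h"
  shows "x powr c \<le> l powr c + h powr c"
proof (cases "c \<ge> 0")
  case True
  then have "x powr c \<le> h powr c" using assms by (intro powr_mono2) auto
  then show ?thesis using powr_ge_zero[of l c] by linarith
next
  case False
  then have "x powr c \<le> l powr c" using assms by (intro powr_mono2') auto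
  then show ?thesis using powr_ge_zero[of h c] by linarith
qed

definition ker :: "real \<Rightarrow> real \<Rightarrow> real \<Rightarrow> real \<Rightarrow> real \<Rightarrow> real" where
  "ker \<alpha> \<mu> \<nu> y u = u powr \<alpha> * (1 + u) powr \<mu> * (1 + y * u) powr - \<nu>"

text \<open>In the variable \<open>u / (1 + u)\<close> this is Euler's integral for Gauss's
  hypergeometric function with argument \<open>1 - y\<close>, up to a Beta factor.\<close>

definition ker_int :: "real \<Rightarrow> real \<Rightarrow> real \<Rightarrow> real \<Rightarrow> real" where
  "ker_int \<alpha> \<mu> \<nu> y = (LINT u:{0<..}|lborel. ker \<alpha> \<mu> \<nu> y u)"

lemma ker_nonneg: "0 \<le> ker \<alpha> \<mu> \<nu> y u"
  by (simp add: ker_def)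

lemma ker_measurable [measurable]: "ker \<alpha> \<mu> \<nu> y \<in> borel_measurable borel"
  unfolding ker_def[abs_def] by measurable

text \<open>The exponents are the orders of \<open>ker\<close> at 0 and at infinity. For u \<ge> 1
  the two bases divided by \<open>u\<close> stay in [1, 2] and in [y, 1 + y].\<close>

lemma ker_bound:
  assumes y: "y > 0"
  obtains C where "C > 0" "\<And>u. 0 < u \<Longrightarrow> u \<le> 1 \<Longrightarrow> ker \<alpha> \<mu> \<nu> y u \<le> C * u powr \<alpha>"
    "\<And>u. 1 \<le> u \<Longrightarrow> ker \<alpha> \<mu> \<nu> y u \<le> C * u powr (\<alpha> + \<mu> - \<nu>)"
proof -
  define C1 where "C1 = (1 powr \<mu> + 2 powr \<mu>) * (1 powr - \<nu> + (1 + y) powr - \<nu>)"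
  define C2 where "C2 = (1 powr \<mu> + 2 powr \<mu>) * (y powr - \<nu> + (1 + y) powr - \<nu>)"
  have "C1 \<ge> 1 + 0"  
    unfolding C1_def by (rule order_trans[OF _ mult_mono[of 1 _ 1]]) auto
  moreover have "C2 \<ge> 0" unfolding C2_def by simp
  moreover have "ker \<alpha> \<mu> \<nu> y u \<le> C1 * u powr \<alpha>" if u: "0 < u" "u \<le> 1" for u
  proof -
    have "(1 + u) powr \<mu> * (1 + y * u) powr - \<nu> \<le> C1"
      unfolding C1_def using u y mult_left_mono[of u 1 y]
      by (intro mult_mono powr_le_sum_ends) auto
    from mult_left_mono[OF this, of "u powr \<alpha>"] show ?thesis by (simp add: ker_def mult_ac)
  qed
  moreover have "ker \<alpha> \<mu> \<nu> y u \<le> C2 * u powr (\<alpha> + \<mu> - \<nu>)" if u: "1 \<le> u" for u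
  proof -
    have "((1 + u) / u) powr \<mu> * ((1 + y * u) / u) powr - \<nu> \<le> C2"
      unfolding C2_def using u y by (intro mult_mono powr_le_sum_ends) (auto simp: field_simps)
    then have "u powr (\<alpha> + \<mu> - \<nu>) * (((1 + u) / u) powr \<mu> * ((1 + y * u) / u) powr - \<nu>) \<le> u powr (\<alpha> + \<mu> - \<nu>) * C2"
      by (intro mult_left_mono) auto
    moreover have "u powr (\<alpha> + \<mu> - \<nu>) * (((1 + u) / u) powr \<mu> * ((1 + y * u) / u) powr - \<nu>) = ker \<alpha> \<mu> \<nu> y u"
      using u y unfolding ker_def by (simp add: powr_divide powr_add powr_diff powr_minus field_simps)
    ultimately show ?thesis by (simp add: mult_ac)
  qed
  ultimately show ?thesis
    by (intro that[of "C1 + C2"]) (auto simp: distrib_right intro: add_increasing add_increasing2)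
qed

lemma set_integrable_powr_0_1:
  fixes c :: real
  assumes "c > -1" shows "set_integrable lborel {0<..1} (\<lambda>u. u powr c)"
proof -
  have "(\<lambda>u. u powr c) absolutely_integrable_on {0..1}"
    using assms by (intro nonnegative_absolutely_integrable_1 integrable_on_powr_from_0) auto
  then have "(\<lambda>u. u powr c) absolutely_integrable_on {0<..1}"
    by (rule set_integrable_subset) auto
  then show ?thesis unfolding set_integrable_def by (subst (asm) integrable_completion) auto
qed

lemma set_integrable_powr_1_inf:
  fixes c :: real
  assumes "c < -1" shows "set_integrable lborel {1<..} (\<lambda>u. u powr c)"
proof -
  have "(\<lambda>u. u powr c) absolutely_integrable_on {1..}"
    using has_integral_powr_to_inf[OF assms, of 1]
    by (intro nonnegative_absolutely_integrable_1) (auto simp: integrable_on_def)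
  then have "(\<lambda>u. u powr c) absolutely_integrable_on {1<..}"
    by (rule set_integrable_subset) auto
  then show ?thesis unfolding set_integrable_def by (subst (asm) integrable_completion) auto
qed

lemma ker_integrable:
  assumes y: "y > 0" and "\<alpha> > -1" "\<alpha> + \<mu> - \<nu> < -1"
  shows "set_integrable lborel {0<..} (ker \<alpha> \<mu> \<nu> y)"
proof -
  obtain C where C: "C > 0" "\<And>u. 0 < u \<Longrightarrow> u \<le> 1 \<Longrightarrow> ker \<alpha> \<mu> \<nu> y u \<le> C * u powr \<alpha>"
    "\<And>u. 1 \<le> u \<Longrightarrow> ker \<alpha> \<mu> \<nu> y u \<le> C * u powr (\<alpha> + \<mu> - \<nu>)"
    using ker_bound[OF y] by blast
  have "set_integrable lborel {0<..1} (ker \<alpha> \<mu> \<nu> y)"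
    by (rule set_integrable_bound[where f = "\<lambda>u. C * u powr \<alpha>"])
      (use set_integrable_powr_0_1[OF assms(2)] C ker_nonneg in \<open>auto simp: set_borel_measurable_def\<close>)
  moreover have "set_integrable lborel {1<..} (ker \<alpha> \<mu> \<nu> y)"
    by (rule set_integrable_bound[where f = "\<lambda>u. C * u powr (\<alpha> + \<mu> - \<nu>)"])
      (use set_integrable_powr_1_inf[OF assms(3)] C ker_nonneg in \<open>auto simp: set_borel_measurable_def\<close>)
  ultimately have "set_integrable lborel ({0<..1} \<union> {1<..}) (ker \<alpha> \<mu> \<nu> y)"
    by (rule set_integrable_Un) auto
  moreover have "{0<..1} \<union> {1<..} = {0::real<..}" by auto
  ultimately show ?thesis by (simp add: ivl_disj_un)
qed

lemma ker_int_pos: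
  assumes y: "y > 0" and "\<alpha> > -1" "\<alpha> + \<mu> - \<nu> < -1"
  shows "ker_int \<alpha> \<mu> \<nu> y > 0"
proof -
  have int: "integrable lborel (\<lambda>u. indicator {0<..} u *\<^sub>R ker \<alpha> \<mu> \<nu> y u)"
    using ker_integrable[OF assms] by (simp add: set_integrable_def)
  have "(LINT u|lborel. indicator {0<..} u *\<^sub>R ker \<alpha> \<mu> \<nu> y u) \<noteq> 0"
  proof
    assume "(LINT u|lborel. indicator {0<..} u *\<^sub>R ker \<alpha> \<mu> \<nu> y u) = 0"
    then have "AE u in lborel. indicator {0<..} u *\<^sub>R ker \<alpha> \<mu> \<nu> y u = 0"
      using int by (subst (asm) integral_nonneg_eq_0_iff_AE) (auto simp: ker_nonneg)
    moreover have "1 + y * u \<noteq> 0" if "u > 0" for u using add_pos_pos[OF zero_less_one mult_pos_pos[OF y that]] by simp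
    ultimately have "AE u in lborel. u \<notin> {0<..<1::real}"
      by (auto simp: ker_def indicator_def elim!: eventually_mono split: if_splits)
    then have "emeasure lborel {0<..<1::real} = 0"
      by (subst (asm) AE_iff_measurable[where N = "{0<..<1}"]) auto
    then show False by simp
  qed
  moreover have "(LINT u|lborel. indicator {0<..} u *\<^sub>R ker \<alpha> \<mu> \<nu> y u) \<ge> 0"
    by (rule Bochner_Integration.integral_nonneg) (auto simp: ker_nonneg)
  ultimately show ?thesis by (simp add: ker_int_def set_lebesgue_integral_def)
qed

text \<open>For parameters between \<open>y / 2\<close> and \<open>2 * y\<close> the last base lies
  between its values at the ends, so the sum of the two end kernels dominates. Raising \<alpha> and
  \<nu> together leaves the decay exponent unchanged.\<close>

lemma ker_int_deriv:
  assumes y: "y > 0" and "\<alpha> > -1" "\<alpha> + \<mu> - \<nu> < -1"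
  shows "(ker_int \<alpha> \<mu> \<nu> has_real_derivative - \<nu> * ker_int (\<alpha> + 1) \<mu> (\<nu> + 1) y) (at y)"
proof -
  define B where "B u = \<bar>\<nu>\<bar> * (ker (\<alpha> + 1) \<mu> (\<nu> + 1) (y/2) u + ker (\<alpha> + 1) \<mu> (\<nu> + 1) (2*y) u)" for u
  have "((\<lambda>x. LINT u|lborel. indicator {0<..} u * ker \<alpha> \<mu> \<nu> x u) has_real_derivative
      (LINT u|lborel. indicator {0<..} u * (- \<nu> * ker (\<alpha> + 1) \<mu> (\<nu> + 1) y u))) (at y)"
  proof (rule has_real_derivative_integral[where l = "y / 2" and h = "2 * y" and B = "\<lambda>u. indicator {0<..} u * B u"])
    show "integrable lborel (\<lambda>u. indicator {0<..} u * ker \<alpha> \<mu> \<nu> x u)" if "y / 2 < x" for x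
      using ker_integrable[of x \<alpha> \<mu> \<nu>] assms that by (simp add: set_integrable_def)
    show "((\<lambda>x. indicator {0<..} u * ker \<alpha> \<mu> \<nu> x u) has_real_derivative
       indicator {0<..} u * (- \<nu> * ker (\<alpha> + 1) \<mu> (\<nu> + 1) x u)) (at x)" if "y / 2 < x" for x u
    proof (cases "u > 0")
      case True
      have "1 + x * u > 0" using True that y by (intro add_pos_pos mult_pos_pos) auto
      then show ?thesis using True unfolding ker_def
        by (auto intro!: derivative_eq_intros simp: powr_add powr_diff powr_minus divide_simps)
    qed (simp add: indicator_def)
    show "\<bar>indicator {0<..} u * (- \<nu> * ker (\<alpha> + 1) \<mu> (\<nu> + 1) x u)\<bar> \<le> indicator {0<..} u * B u"
      if "y / 2 < x" "x < 2 * y" for x u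
    proof (cases "u > 0")
      case True
      have "(1 + x * u) powr - (\<nu> + 1) \<le> (1 + y / 2 * u) powr - (\<nu> + 1) + (1 + 2 * y * u) powr - (\<nu> + 1)"
        using True that y by (intro powr_le_sum_ends) (auto intro!: add_pos_pos)
      then have "ker (\<alpha> + 1) \<mu> (\<nu> + 1) x u \<le> ker (\<alpha> + 1) \<mu> (\<nu> + 1) (y/2) u + ker (\<alpha> + 1) \<mu> (\<nu> + 1) (2*y) u"
        unfolding ker_def distrib_left[symmetric] by (intro mult_left_mono) auto
      then show ?thesis using True ker_nonneg[of "\<alpha> + 1" \<mu> "\<nu> + 1" x u] unfolding B_def
        by (simp add: abs_mult mult_left_mono)
    qed (simp add: indicator_def)
    show "integrable lborel (\<lambda>u. indicator {0<..} u * B u)"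
      using ker_integrable[of "y/2" "\<alpha> + 1" \<mu> "\<nu> + 1"] ker_integrable[of "2*y" "\<alpha> + 1" \<mu> "\<nu> + 1"] assms
      unfolding B_def by (simp add: set_integrable_def distrib_left mult.left_commute[of "indicator _ _"])
  qed (use y in \<open>simp_all\<close>)
  moreover have "(LINT u|lborel. indicator {0<..} u * (- \<nu> * ker (\<alpha> + 1) \<mu> (\<nu> + 1) y u))
      = - \<nu> * ker_int (\<alpha> + 1) \<mu> (\<nu> + 1) y"
    unfolding ker_int_def set_lebesgue_integral_def by (subst mult.left_commute) simp
  ultimately show ?thesis
    by (simp add: ker_int_def[abs_def] set_lebesgue_integral_def)
qed

text \<open>This is the integral of the derivative of
  \<open>ker (\<alpha> + 1) \<mu> \<nu> y\<close>. That function vanishes at both ends because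
  \<open>\<alpha> + 1 > 0\<close> and \<open>\<alpha> + 1 + \<mu> - \<nu> < 0\<close>.\<close>

lemma ker_int_by_parts:
  assumes y: "y > 0" and "\<alpha> > -1" "\<alpha> + \<mu> - \<nu> < -1"
  shows "(\<alpha> + 1) * ker_int \<alpha> \<mu> \<nu> y + \<mu> * ker_int (\<alpha> + 1) (\<mu> - 1) \<nu> y
    - \<nu> * y * ker_int (\<alpha> + 1) \<mu> (\<nu> + 1) y = 0"
proof -
  define F where "F = ker (\<alpha> + 1) \<mu> \<nu> y"
  define F' where "F' u = (\<alpha> + 1) * ker \<alpha> \<mu> \<nu> y u + \<mu> * ker (\<alpha> + 1) (\<mu> - 1) \<nu> y u
    - \<nu> * y * ker (\<alpha> + 1) \<mu> (\<nu> + 1) y u" for u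
  obtain C where C: "C > 0" "\<And>u. 0 < u \<Longrightarrow> u \<le> 1 \<Longrightarrow> F u \<le> C * u powr (\<alpha> + 1)"
    "\<And>u. 1 \<le> u \<Longrightarrow> F u \<le> C * u powr (\<alpha> + 1 + \<mu> - \<nu>)"
    using ker_bound[OF y] unfolding F_def by blast
  note int = ker_integrable[OF assms] ker_integrable[of y "\<alpha> + 1" "\<mu> - 1" \<nu>] ker_integrable[of y "\<alpha> + 1" \<mu> "\<nu> + 1"]
  have F'_int: "set_integrable lborel {0<..} F'"
    unfolding F'_def using int assms by (intro set_integral_add set_integral_diff set_integrable_mult_right) auto
  have "(LBINT u=0..\<infinity>. F' u) = 0 - 0"
  proof (rule interval_integral_FTC_integrable[where F = F])
    show "(F has_vector_derivative F' u) (at u)" if "0 < ereal u" for u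
    proof -
      have minus_one: "- 1 - \<nu> = - \<nu> - 1" by simp
      have "0 < u" "1 + y * u > 0" using that y by (auto intro: add_pos_pos simp: zero_ereal_def)
      then show ?thesis
        unfolding F_def F'_def ker_def has_real_derivative_iff_has_vector_derivative[symmetric]
        by (intro DERIV_mult[OF DERIV_mult, THEN DERIV_cong])
          (auto intro!: has_real_derivative_powr[THEN DERIV_cong] DERIV_fun_powr[THEN DERIV_cong] derivative_eq_intros
            simp: algebra_simps minus_one)
    qed
    show "isCont F' u" if "0 < ereal u" for u
    proof -
      have "0 < u" "1 + y * u > 0" using that y by (auto intro: add_pos_pos simp: zero_ereal_def)
      then show ?thesis unfolding F'_def ker_def by (auto intro!: continuous_intros)
    qed
    have "(F \<longlongrightarrow> 0) (at_right 0)"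
    proof (rule tendsto_sandwich[where f = "\<lambda>_. 0" and h = "\<lambda>u. C * u powr (\<alpha> + 1)"])
      show "((\<lambda>u. C * u powr (\<alpha> + 1)) \<longlongrightarrow> 0) (at_right 0)"
        using assms eventually_mono[OF eventually_at_right_less[of "0::real"] less_imp_le]
        by (auto intro!: tendsto_eq_intros tendsto_ident_at)
      show "\<forall>\<^sub>F u in at_right 0. F u \<le> C * u powr (\<alpha> + 1)"
        using eventually_at_right_real[of 0 1] by (auto elim!: eventually_mono intro: C)
    qed (auto simp: F_def ker_nonneg)
    then show "((F \<circ> real_of_ereal) \<longlongrightarrow> 0) (at_right 0)"
      unfolding zero_ereal_def ereal_tendsto_simps .
    have "(F \<longlongrightarrow> 0) at_top"
    proof (rule tendsto_sandwich[where f = "\<lambda>_. 0" and h = "\<lambda>u. C * u powr (\<alpha> + 1 + \<mu> - \<nu>)"])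
      show "((\<lambda>u. C * u powr (\<alpha> + 1 + \<mu> - \<nu>)) \<longlongrightarrow> 0) at_top"
        using assms by (auto intro!: tendsto_mult_right_zero tendsto_neg_powr filterlim_ident)
      show "\<forall>\<^sub>F u in at_top. F u \<le> C * u powr (\<alpha> + 1 + \<mu> - \<nu>)"
        using eventually_ge_at_top[of 1] by eventually_elim (rule C)
    qed (auto simp: F_def ker_nonneg)
    then show "((F \<circ> real_of_ereal) \<longlongrightarrow> 0) (at_left \<infinity>)"
      unfolding ereal_tendsto_simps .
    show "set_integrable lborel (einterval 0 \<infinity>) F'"
      using F'_int by (simp add: zero_ereal_def)
  qed simp
  then have "(LINT u:{0<..}|lborel. F' u) = 0"
    by (simp add: interval_lebesgue_integral_def zero_ereal_def)
  moreover have "(LINT u:{0<..}|lborel. F' u) = (\<alpha> + 1) * ker_int \<alpha> \<mu> \<nu> y + \<mu> * ker_int (\<alpha> + 1) (\<mu> - 1) \<nu> y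
    - \<nu> * y * ker_int (\<alpha> + 1) \<mu> (\<nu> + 1) y"
    unfolding F'_def ker_int_def using int assms
    by (subst set_integral_diff set_integral_add; auto intro!: set_integral_add set_integrable_mult_right)+
  ultimately show ?thesis by simp
qed

text \<open>Raising the first exponent by one and lowering the second by one multiplies the weight
  by \<open>u / (1 + u)\<close>, so the quotient is the mean of that variable.\<close>

definition ratio :: "real \<Rightarrow> real \<Rightarrow> real \<Rightarrow> real \<Rightarrow> real" where
  "ratio P M \<beta> w = ker_int (P + \<beta>) (M - 1) (M + P + 1) (1 + w) / ker_int (P + \<beta> - 1) M (M + P + 1) (1 + w)"

text \<open>With \<open>\<Lambda> = u / (1 + u)\<close> one has
  \<open>1 + (1 + w) u = (1 + u) (1 + w \<Lambda>)\<close>, so \<open>w\<close> enters only through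
  a decreasing function of \<Lambda>. Under the remaining weight, \<Lambda> has, up to
  normalisation, the Beta law with parameters \<open>P + \<beta>\<close> and
  \<open>1 - \<beta>\<close>, whose mean is the bound.\<close>

lemma ratio_le:
  assumes "P > 0" "P + M > 0" "\<beta> < 1" "P + \<beta> > 0" "w > 0"
  shows "ratio P M \<beta> w \<le> (P + \<beta>) / (P + 1)"
proof -
  define m where "m = M + P + 1"
  define \<kappa> where "\<kappa> = P + \<beta>"
  define \<mu> where "\<mu> u = indicator {0<..} u * (u powr (\<kappa> - 1) * (1 + u) powr (- P - 1))" for u
  define \<Lambda> where "\<Lambda> u = u / (1 + u)" for u :: real
  define h where "h l = (1 + w * l) powr - m" for l
  have J: "indicator {0<..} u * ker (\<kappa> - 1) M m (1 + w) u = h (\<Lambda> u) * \<mu> u"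
    and R: "indicator {0<..} u * ker \<kappa> (M - 1) m (1 + w) u = \<Lambda> u * h (\<Lambda> u) * \<mu> u" for u
  proof -
    have powr: "(1 + u) powr M * (1 + u) powr - m = (1 + u) powr (- P - 1)"
      by (simp add: powr_add[symmetric] m_def)
    have "(1 + (1 + w) * u) = (1 + w * \<Lambda> u) * (1 + u)" if "u > 0"
      using that by (simp add: \<Lambda>_def field_simps)
    moreover have "1 + w * \<Lambda> u > 0" if "u > 0"
      using that assms by (auto simp: \<Lambda>_def intro!: add_pos_nonneg)
    ultimately show "indicator {0<..} u * ker (\<kappa> - 1) M m (1 + w) u = h (\<Lambda> u) * \<mu> u"
      by (cases "u > 0") (simp_all add: ker_def h_def \<mu>_def powr_mult powr[symmetric])
    moreover have "ker \<kappa> (M - 1) m (1 + w) u = \<Lambda> u * ker (\<kappa> - 1) M m (1 + w) u" if "u > 0"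
      using that by (simp add: ker_def \<Lambda>_def powr_diff)
    ultimately show "indicator {0<..} u * ker \<kappa> (M - 1) m (1 + w) u = \<Lambda> u * h (\<Lambda> u) * \<mu> u"
      by (cases "u > 0") (simp_all add: \<mu>_def)
  qed
  have J_int: "integrable lborel (\<lambda>u. h (\<Lambda> u) * \<mu> u)"
    using ker_integrable[of "1 + w" "\<kappa> - 1" M m] assms J by (simp add: set_integrable_def \<kappa>_def m_def)
  have R_int: "integrable lborel (\<lambda>u. \<Lambda> u * h (\<Lambda> u) * \<mu> u)"
    using ker_integrable[of "1 + w" \<kappa> "M - 1" m] assms R by (simp add: set_integrable_def \<kappa>_def m_def)
  have \<mu>: "\<mu> u = indicator {0<..} u * ker (\<kappa> - 1) 0 (P + 1) 1 u" for u
    by (cases "u > 0") (simp_all add: \<mu>_def ker_def)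
  have \<mu>_int: "integrable lborel \<mu>"
    using ker_integrable[of 1 "\<kappa> - 1" 0 "P + 1"] assms unfolding \<mu>[abs_def]
    by (simp add: set_integrable_def \<kappa>_def)
  have \<Lambda>\<mu>: "\<Lambda> u * \<mu> u = indicator {0<..} u * ker \<kappa> 0 (P + 2) 1 u" for u
  proof (cases "u > 0")
    case True
    have "(1 + u) powr (- P - 1) / (1 + u) = (1 + u) powr (- P - 1 - 1)" "u * u powr (\<kappa> - 1) = u powr \<kappa>"
      using True powr_diff[of "1 + u" "- P - 1" 1] powr_mult_base[of u "\<kappa> - 1"] by simp_all
    moreover have "- P - 1 - 1 = - (P + 2)" by simp
    ultimately show ?thesis using True
      by (simp add: \<Lambda>_def \<mu>_def ker_def) (metis mult.commute mult.left_commute times_divide_eq_right)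
  qed (simp add: \<mu>_def)
  have \<Lambda>\<mu>_int: "integrable lborel (\<lambda>u. \<Lambda> u * \<mu> u)"
    using ker_integrable[of 1 "\<kappa>" 0 "P + 2"] assms unfolding \<Lambda>\<mu>
    by (simp add: set_integrable_def \<kappa>_def)
  \<comment> \<open>Chebyshev's inequality: equality holds at \<open>w = 0\<close>, and \<open>h\<close> is decreasing\<close>
  have zero: "(LINT u|lborel. \<kappa> * \<mu> u - (P + 1) * (\<Lambda> u * \<mu> u)) = 0"
  proof -
    have "ker_int (\<kappa> - 1) 0 (P + 1) 1 = (LINT u|lborel. \<mu> u)"
      unfolding ker_int_def set_lebesgue_integral_def by (simp add: \<mu>)
    moreover have "ker_int \<kappa> 0 (2 + P) 1 = (LINT u|lborel. \<Lambda> u * \<mu> u)"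
      unfolding ker_int_def set_lebesgue_integral_def by (simp add: \<Lambda>\<mu> add.commute)
    ultimately show ?thesis
      using ker_int_by_parts[of 1 "\<kappa> - 1" 0 "P + 1"] \<mu>_int \<Lambda>\<mu>_int assms by (simp add: \<kappa>_def)
  qed
  define l0 where "l0 = \<kappa> / (P + 1)"
  have l0: "l0 > 0" using assms by (simp add: l0_def \<kappa>_def)
  have "0 \<le> (LINT u|lborel. (\<kappa> - (P + 1) * \<Lambda> u) * (h (\<Lambda> u) - h l0) * \<mu> u)"
  proof (rule Bochner_Integration.integral_nonneg)
    fix u :: real
    show "0 \<le> (\<kappa> - (P + 1) * \<Lambda> u) * (h (\<Lambda> u) - h l0) * \<mu> u"
    proof (cases "u > 0")
      case True
      then have \<Lambda>: "\<Lambda> u > 0" by (simp add: \<Lambda>_def)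
      have mono: "h y \<le> h x" if "0 < x" "x \<le> y" for x y
        unfolding h_def using that assms
        by (intro powr_mono2') (auto simp: m_def intro: add_pos_pos)
      have "0 \<le> (\<kappa> - (P + 1) * \<Lambda> u) * (h (\<Lambda> u) - h l0)"
      proof (cases "\<Lambda> u \<le> l0")
        case True
        then show ?thesis using mono[OF \<Lambda> True] assms
          by (intro mult_nonneg_nonneg) (auto simp: l0_def pos_le_divide_eq mult.commute)
      next
        case False
        then show ?thesis using mono[OF l0, of "\<Lambda> u", OF less_imp_le] assms
          by (intro mult_nonpos_nonpos) (auto simp: l0_def pos_divide_less_eq not_le mult.commute)
      qed
      then show ?thesis by (rule mult_nonneg_nonneg) (simp add: \<mu>_def)
    qed (simp add: \<mu>_def)
  qed
  also have "\<dots> = (LINT u|lborel. (\<kappa> * (h (\<Lambda> u) * \<mu> u) - (P + 1) * (\<Lambda> u * h (\<Lambda> u) * \<mu> u))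
      - h l0 * (\<kappa> * \<mu> u - (P + 1) * (\<Lambda> u * \<mu> u)))"
    by (rule Bochner_Integration.integral_cong) (simp_all add: algebra_simps)
  also have "\<dots> = (\<kappa> * (LINT u|lborel. h (\<Lambda> u) * \<mu> u) - (P + 1) * (LINT u|lborel. \<Lambda> u * h (\<Lambda> u) * \<mu> u))
      - h l0 * (LINT u|lborel. \<kappa> * \<mu> u - (P + 1) * (\<Lambda> u * \<mu> u))"
    using J_int R_int \<mu>_int \<Lambda>\<mu>_int
    by (simp only: Bochner_Integration.integral_diff integral_mult_right_zero integrable_mult_right Bochner_Integration.integrable_diff)
  also have "\<dots> = \<kappa> * ker_int (\<kappa> - 1) M m (1 + w) - (P + 1) * ker_int \<kappa> (M - 1) m (1 + w)"
    unfolding zero ker_int_def set_lebesgue_integral_def by (simp add: J R)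
  finally have "(P + 1) * ker_int \<kappa> (M - 1) m (1 + w) \<le> \<kappa> * ker_int (\<kappa> - 1) M m (1 + w)" by simp
  moreover have "ker_int (\<kappa> - 1) M m (1 + w) > 0"
    using assms by (intro ker_int_pos) (auto simp: m_def \<kappa>_def)
  ultimately show ?thesis
    using assms by (simp add: ratio_def m_def \<kappa>_def field_simps)
qed

text \<open>Four integrals close up under differentiation: the y-derivatives of \<open>J\<close> and
  \<open>R\<close> are \<open>- m H\<close> and \<open>- m T\<close>, integration by parts expresses
  \<open>H\<close> through \<open>J\<close> and \<open>R\<close>, and
  \<open>1 + y u = (1 + u) + w u\<close> gives \<open>R = H + w T\<close>. Eliminating
  \<open>H\<close> and \<open>T\<close> leaves an equation for \<open>R / J\<close> alone.\<close>

lemma riccati_ratio: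
  assumes "P > 0" "P + M > 0" "\<beta> < 1" "P + \<beta> > 0" "M - \<beta> > 0" "\<beta> \<le> 0 \<or> M > 0"
  shows "riccati P M \<beta> (ratio P M \<beta>)"
proof
  fix w :: real assume w: "w > 0"
  define m where "m = M + P + 1"
  define \<kappa> where "\<kappa> = P + \<beta>"
  define y where "y = 1 + w"
  define J where "J = ker_int (\<kappa> - 1) M m y"
  define R where "R = ker_int \<kappa> (M - 1) m y"
  define H where "H = ker_int \<kappa> M (m + 1) y"
  define T where "T = ker_int (\<kappa> + 1) (M - 1) (m + 1) y"
  note defs = m_def \<kappa>_def y_def
  have ratio: "ratio P M \<beta> w = R / J" by (simp add: ratio_def R_def J_def defs)
  have J: "J > 0" and R: "R > 0"
    unfolding J_def R_def using w assms by (intro ker_int_pos; simp add: defs)+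
  then show "0 < ratio P M \<beta> w" by (simp add: ratio)
  show "ratio P M \<beta> w \<le> (P + \<beta>) / (P + 1)"
    using assms w by (intro ratio_le) auto
  have "(\<lambda>u. indicator {0<..} u *\<^sub>R ker \<kappa> (M - 1) m y u)
    = (\<lambda>u. indicator {0<..} u *\<^sub>R (ker \<kappa> M (m + 1) y u + w * ker (\<kappa> + 1) (M - 1) (m + 1) y u))"
  proof
    fix u :: real
    show "indicator {0<..} u *\<^sub>R ker \<kappa> (M - 1) m y u
      = indicator {0<..} u *\<^sub>R (ker \<kappa> M (m + 1) y u + w * ker (\<kappa> + 1) (M - 1) (m + 1) y u)"
    proof (cases "u > 0")
      case True
      define t where "t = 1 + y * u"
      have "t > 0" using True w by (auto simp: t_def y_def intro!: add_pos_pos)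
      have "ker \<kappa> M (m + 1) y u + w * ker (\<kappa> + 1) (M - 1) (m + 1) y u
         = u powr \<kappa> * (1 + u) powr (M - 1) * t powr - (m + 1) * ((1 + u) + w * u)"
      proof -
        have "(1 + u) powr M = (1 + u) powr (M - 1) * (1 + u)" "u powr (\<kappa> + 1) = u powr \<kappa> * u"
          using True by (simp_all add: powr_diff powr_add)
        then show ?thesis unfolding ker_def t_def[symmetric] by (simp add: algebra_simps)
      qed
      also have "(1 + u) + w * u = t" by (simp add: t_def y_def algebra_simps)
      also have "u powr \<kappa> * (1 + u) powr (M - 1) * t powr - (m + 1) * t = ker \<kappa> (M - 1) m y u"
      proof -
        have "t powr - (m + 1) * t = t powr - m" using \<open>t > 0\<close> powr_mult_base[of t "- (m + 1)"] by (simp add: mult.commute)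
        then show ?thesis unfolding ker_def t_def[symmetric] by (simp only: mult.assoc)
      qed
      finally show ?thesis by simp
    qed simp
  qed
  then have RHT: "R = H + w * T"
    unfolding R_def H_def T_def ker_int_def set_lebesgue_integral_def
    using ker_integrable[of y \<kappa> M "m + 1"] ker_integrable[of y "\<kappa> + 1" "M - 1" "m + 1"] assms w
    by (simp add: set_integrable_def defs distrib_left mult.left_commute[of "indicator _ _"])
  have parts: "\<kappa> * J + M * R = m * y * H"
    using ker_int_by_parts[of y "\<kappa> - 1" M m] assms w by (simp add: J_def R_def H_def defs)
  have dJ: "(ker_int (\<kappa> - 1) M m has_real_derivative - m * H) (at y)"
    using ker_int_deriv[of y "\<kappa> - 1" M m] assms w by (simp add: H_def defs)
  have dR: "(ker_int \<kappa> (M - 1) m has_real_derivative - m * T) (at y)"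
    using ker_int_deriv[of y \<kappa> "M - 1" m] assms w by (simp add: T_def defs)
  have "((\<lambda>y. ker_int \<kappa> (M - 1) m y / ker_int (\<kappa> - 1) M m y) has_real_derivative
      ((- m * T) * J - R * (- m * H)) / (J * J)) (at y)"
    using DERIV_divide[OF dR dJ] J by (simp add: J_def R_def)
  then have "((\<lambda>w. ker_int \<kappa> (M - 1) m (1 + w) / ker_int (\<kappa> - 1) M m (1 + w)) has_real_derivative
      ((- m * T) * J - R * (- m * H)) / (J * J)) (at w)"
    by (simp only: y_def add.commute[of 1] DERIV_shift)
  moreover have "((- m * T) * J - R * (- m * H)) / (J * J) =
    ((\<kappa> + M * (R / J)) * (1 + w * (R / J)) / (1 + w) - m * (R / J)) / w"
  proof -
    have H: "m * H = (\<kappa> * J + M * R) / y" using parts w by (simp add: field_simps y_def)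
    have T: "w * (m * T) = m * R - m * H" using RHT by (simp add: algebra_simps)
    have "((- m * T) * J - R * (- m * H)) / (J * J) = (w * (m * H) * R - w * (m * T) * J) / (w * (J * J))"
      using J w by (simp add: field_simps)
    also have "\<dots> = ((m * H) * (J + w * R) - m * R * J) / (w * (J * J))"
      unfolding T by (simp add: algebra_simps)
    also have "\<dots> = ((\<kappa> + M * (R / J)) * (1 + w * (R / J)) / (1 + w) - m * (R / J)) / w"
    proof -
      define \<rho> where "\<rho> = R / J"
      have R_eq: "R = \<rho> * J" using J by (simp add: \<rho>_def)
      have "m * H * (J + w * R) - m * R * J = (J * J) * ((\<kappa> + M * \<rho>) * (1 + w * \<rho>) / (1 + w) - m * \<rho>)"
        unfolding H R_eq y_def using w by (simp add: field_simps)
      then show ?thesis using J by (simp add: \<rho>_def[symmetric])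
    qed
    finally show ?thesis .
  qed
  ultimately show "(ratio P M \<beta> has_real_derivative
        ((P + \<beta> + M * ratio P M \<beta> w) * (1 + w * ratio P M \<beta> w) / (1 + w) - (M + P + 1) * ratio P M \<beta> w) / w) (at w)"
    unfolding ratio unfolding ratio_def[abs_def] by (simp add: defs)
qed (use assms in auto)

section \<open>The generalized Bayes estimator as a shrinkage estimator\<close>

lemma ker_int_scale:
  assumes "y > 0"
  shows "ker_int \<alpha> 0 \<nu> y = y powr (- \<alpha> - 1) * ker_int \<alpha> 0 \<nu> 1"
proof -
  have "(LINT u|lborel. indicator {0<..} u *\<^sub>R ker \<alpha> 0 \<nu> y u)
     = \<bar>1 / y\<bar> *\<^sub>R (LINT u|lborel. indicator {0<..} (0 + (1 / y) * u) *\<^sub>R ker \<alpha> 0 \<nu> y (0 + (1 / y) * u))"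
    using assms by (intro lborel_integral_real_affine) simp
  also have "(\<lambda>u. indicator {0<..} (0 + (1 / y) * u) *\<^sub>R ker \<alpha> 0 \<nu> y (0 + (1 / y) * u))
     = (\<lambda>u. y powr - \<alpha> * (indicator {0<..} u *\<^sub>R ker \<alpha> 0 \<nu> 1 u))"
  proof
    fix u :: real
    show "indicator {0<..} (0 + (1 / y) * u) *\<^sub>R ker \<alpha> 0 \<nu> y (0 + (1 / y) * u)
      = y powr - \<alpha> * (indicator {0<..} u *\<^sub>R ker \<alpha> 0 \<nu> 1 u)"
      using assms by (cases "u > 0") (auto simp: ker_def powr_divide powr_minus field_simps zero_less_divide_iff)
  qed
  finally show ?thesis
    using assms by (simp add: ker_int_def set_lebesgue_integral_def powr_diff powr_minus field_simps)
qed

section \<open>Integrals of powers of a quadratic over a Euclidean space\<close>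

lemma norm_powr_integrable:
  fixes Q :: real
  assumes "2 * Q > real DIM('a)"
  shows "integrable lborel (\<lambda>\<theta>::'a::euclidean_space. ((norm \<theta>)\<^sup>2 + 1) powr - Q)"
proof (rule integrableI_bounded)
  define d where "d = DIM('a)"
  define V where "V = unit_ball_vol (real d)"
  have "Q > 0" using assms by simp
  have "(\<integral>\<^sup>+ \<theta>. ennreal (norm (((norm \<theta>)\<^sup>2 + 1) powr - Q)) \<partial>(lborel::'a measure))
    \<le> (\<integral>\<^sup>+ \<theta>. (\<Sum>k. ennreal (4 powr Q * (4 powr - Q) ^ k) * indicator (ball 0 (2 ^ k)) \<theta>) \<partial>(lborel::'a measure))"
  proof (rule nn_integral_mono)
    fix \<theta> :: 'a
    \<comment> \<open>Dyadic shells: where the norm is about \<open>2 ^ k\<close>, the integrand is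
      of order \<open>(4 powr - Q) ^ k\<close>, against a volume of order
      \<open>(2 ^ d) ^ k\<close>. The resulting geometric series converges because
      \<open>2 * Q > d\<close>.\<close>
    obtain k0 where "norm \<theta> < 2 ^ k0" using real_arch_pow[of 2 "norm \<theta>"] by auto
    define k where "k = (LEAST k. norm \<theta> < 2 ^ k)"
    have k: "norm \<theta> < 2 ^ k" unfolding k_def by (rule LeastI[of _ k0]) fact
    have "((norm \<theta>)\<^sup>2 + 1) powr - Q \<le> 4 powr Q * (4 powr - Q) ^ k"
    proof (cases k)
      case 0
      have "((norm \<theta>)\<^sup>2 + 1) powr - Q \<le> 1 powr - Q" using \<open>Q > 0\<close> by (intro powr_mono2') auto
      also have "\<dots> \<le> 4 powr Q" using \<open>Q > 0\<close> by (simp add: ge_one_powr_ge_zero)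
      finally show ?thesis using 0 by simp
    next
      case (Suc j)
      have "\<not> norm \<theta> < 2 ^ j" using not_less_Least[of j "\<lambda>k. norm \<theta> < 2 ^ k"] Suc by (simp add: k_def)
      then have "(2 ^ j)\<^sup>2 \<le> (norm \<theta>)\<^sup>2" by (intro power_mono) auto
      then have "((norm \<theta>)\<^sup>2 + 1) powr - Q \<le> (4 ^ j) powr - Q"
        using \<open>Q > 0\<close> by (intro powr_mono2') (auto simp: power_mult[symmetric] power2_eq_square power_mult_distrib[symmetric])
      also have "(4 ^ j) powr - Q = (4 powr - Q) ^ j"
        by (simp add: powr_realpow[symmetric] powr_powr mult.commute)
      also have "\<dots> = 4 powr Q * (4 powr - Q) ^ k" using Suc by (simp add: powr_minus)
      finally show ?thesis .
    qed
    then have "ennreal (norm (((norm \<theta>)\<^sup>2 + 1) powr - Q)) \<le> ennreal (4 powr Q * (4 powr - Q) ^ k) * indicator (ball 0 (2 ^ k)) \<theta>"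
      using k by (simp add: ennreal_leI)
    also have "\<dots> \<le> (\<Sum>k. ennreal (4 powr Q * (4 powr - Q) ^ k) * indicator (ball 0 (2 ^ k)) \<theta>)"
    proof -
      define f where "f k = ennreal (4 powr Q * (4 powr - Q) ^ k) * indicator (ball 0 (2 ^ k)) \<theta>" for k
      have "f k \<le> suminf f" using sum_le_suminf[of f "{k}"] by simp
      then show ?thesis by (simp only: f_def[abs_def])
    qed
    finally show "ennreal (norm (((norm \<theta>)\<^sup>2 + 1) powr - Q)) \<le> \<dots>" .
  qed
  also have "(\<integral>\<^sup>+ \<theta>. (\<Sum>k. ennreal (4 powr Q * (4 powr - Q) ^ k) * indicator (ball 0 (2 ^ k)) \<theta>) \<partial>(lborel::'a measure)) = (\<Sum>k. \<integral>\<^sup>+ \<theta>. ennreal (4 powr Q * (4 powr - Q) ^ k) * indicator (ball 0 (2 ^ k)) \<theta> \<partial>(lborel::'a measure))"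
    by (rule nn_integral_suminf) (intro borel_measurable_times_ennreal borel_measurable_indicator borel_measurable_const sets_lborel[THEN equalityD2, THEN subsetD] borel_open open_ball)
  also have "\<dots> = (\<Sum>k. ennreal (4 powr Q * V * (4 powr - Q * 2 ^ d) ^ k))"
  proof (rule suminf_cong)
    fix k :: nat
    have "(\<integral>\<^sup>+ \<theta>. ennreal (4 powr Q * (4 powr - Q) ^ k) * indicator (ball 0 (2 ^ k)) \<theta> \<partial>(lborel::'a measure))
       = ennreal (4 powr Q * (4 powr - Q) ^ k) * ennreal (V * (2 ^ k) ^ d)"
      by (subst nn_integral_cmult_indicator) (simp_all add: emeasure_ball V_def d_def)
    also have "\<dots> = ennreal (4 powr Q * V * (4 powr - Q * 2 ^ d) ^ k)"
      by (subst ennreal_mult[symmetric]) (auto simp: V_def power_mult_distrib power_mult[symmetric] mult_ac)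
    finally show "(\<integral>\<^sup>+ \<theta>. ennreal (4 powr Q * (4 powr - Q) ^ k) * indicator (ball 0 (2 ^ k)) \<theta> \<partial>(lborel::'a measure))
       = ennreal (4 powr Q * V * (4 powr - Q * 2 ^ d) ^ k)" .
  qed
  also have "\<dots> < \<infinity>"
  proof -
    have "4 powr - Q * 2 ^ d = (2::real) powr (d - 2 * Q)"
    proof -
      have "(4::real) powr - Q = 2 powr (2 * - Q)" by (subst powr_powr[symmetric]) simp
      then show ?thesis by (simp add: powr_realpow[symmetric] powr_add[symmetric])
    qed
    also have "\<dots> < 2 powr 0" using assms by (intro powr_less_mono) (auto simp: d_def)
    finally have "summable (\<lambda>k. 4 powr Q * V * (4 powr - Q * 2 ^ d) ^ k)"
      by (intro summable_mult summable_geometric) auto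
    moreover have "V \<ge> 0" by (simp add: V_def)
    ultimately show ?thesis by (simp add: less_top[symmetric] suminf_ennreal2)
  qed
  finally show "(\<integral>\<^sup>+ \<theta>. ennreal (norm (((norm \<theta>)\<^sup>2 + 1) powr - Q)) \<partial>(lborel::'a measure)) < \<infinity>" .
qed measurable

lemma nn_integral_norm_powr:
  fixes \<mu> :: "'a::euclidean_space" and Q c :: real
  assumes Q: "2 * Q > real DIM('a)" and c: "c > 0"
  shows "(\<integral>\<^sup>+ \<theta>. ennreal (((norm (\<theta> - \<mu>))\<^sup>2 + c) powr - Q) \<partial>lborel)
    = ennreal ((LINT \<theta>::'a|lborel. ((norm \<theta>)\<^sup>2 + 1) powr - Q) * c powr (DIM('a) / 2 - Q))"
proof -
  have "(\<integral>\<^sup>+ \<theta>. ennreal (((norm (\<theta> - \<mu>))\<^sup>2 + c) powr - Q) \<partial>lborel)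
    = (\<integral>\<^sup>+ \<theta>. ennreal (((norm (\<theta> - \<mu>))\<^sup>2 + c) powr - Q)
        \<partial>(density (distr lborel borel (\<lambda>\<theta>::'a. \<mu> + sqrt c *\<^sub>R \<theta>)) (\<lambda>_. ennreal (\<bar>sqrt c\<bar> ^ DIM('a)))))"
    by (subst lborel_affine[of "sqrt c" \<mu>]) (use c in auto)
  also have "\<dots> = (\<integral>\<^sup>+ \<theta>. ennreal (\<bar>sqrt c\<bar> ^ DIM('a)) * ennreal (((norm (sqrt c *\<^sub>R \<theta>))\<^sup>2 + c) powr - Q) \<partial>(lborel::'a measure))"
    by (simp add: nn_integral_density nn_integral_distr)
  also have "\<dots> = (\<integral>\<^sup>+ \<theta>. ennreal (c powr (DIM('a) / 2 - Q)) * ennreal (((norm \<theta>)\<^sup>2 + 1) powr - Q) \<partial>(lborel::'a measure))"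
  proof (rule nn_integral_cong)
    fix \<theta> :: 'a
    have *: "(norm (sqrt c *\<^sub>R \<theta>))\<^sup>2 + c = c * ((norm \<theta>)\<^sup>2 + 1)"
      using c by (simp add: power_mult_distrib algebra_simps)
    have **: "\<bar>sqrt c\<bar> ^ DIM('a) = c powr (DIM('a) / 2)"
      using c by (simp add: powr_realpow[symmetric] powr_half_sqrt[symmetric] powr_powr)
    show "ennreal (\<bar>sqrt c\<bar> ^ DIM('a)) * ennreal (((norm (sqrt c *\<^sub>R \<theta>))\<^sup>2 + c) powr - Q)
      = ennreal (c powr (DIM('a) / 2 - Q)) * ennreal (((norm \<theta>)\<^sup>2 + 1) powr - Q)"
    proof -
      have "c powr (DIM('a) / 2) * (c * ((norm \<theta>)\<^sup>2 + 1)) powr - Q = (c powr (DIM('a) / 2) * c powr - Q) * ((norm \<theta>)\<^sup>2 + 1) powr - Q"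
        using c by (subst powr_mult) auto
      also have "c powr (DIM('a) / 2) * c powr - Q = c powr (DIM('a) / 2 - Q)"
        by (simp add: powr_add[symmetric])
      finally show ?thesis by (simp only: * **) (simp add: ennreal_mult[symmetric])
    qed
  qed
  also have "\<dots> = ennreal (c powr (DIM('a) / 2 - Q)) * ennreal (LINT \<theta>::'a|lborel. ((norm \<theta>)\<^sup>2 + 1) powr - Q)"
    by (simp add: nn_integral_cmult nn_integral_eq_integral[OF norm_powr_integrable[OF Q]])
  finally show ?thesis by (simp add: ennreal_mult[symmetric] mult.commute)
qed

lemma
  fixes \<mu> :: "'a::euclidean_space" and Q c :: real
  assumes Q: "2 * Q > real DIM('a)" and c: "c > 0"
  shows integrable_norm_powr: "integrable lborel (\<lambda>\<theta>. ((norm (\<theta> - \<mu>))\<^sup>2 + c) powr - Q)"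
    and integral_norm_powr: "(LINT \<theta>|lborel. ((norm (\<theta> - \<mu>))\<^sup>2 + c) powr - Q)
      = (LINT \<theta>::'a|lborel. ((norm \<theta>)\<^sup>2 + 1) powr - Q) * c powr (DIM('a) / 2 - Q)"
proof -
  note nn = nn_integral_norm_powr[OF Q c, of \<mu>]
  show "integrable lborel (\<lambda>\<theta>. ((norm (\<theta> - \<mu>))\<^sup>2 + c) powr - Q)"
    by (rule integrableI_bounded) (simp_all add: nn)
  show "(LINT \<theta>|lborel. ((norm (\<theta> - \<mu>))\<^sup>2 + c) powr - Q)
      = (LINT \<theta>::'a|lborel. ((norm \<theta>)\<^sup>2 + 1) powr - Q) * c powr (DIM('a) / 2 - Q)"
    by (rule integral_eq_nn_integral[THEN trans]) (simp_all add: nn Bochner_Integration.integral_nonneg)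
qed

lemma norm_powr_integral_pos:
  assumes "2 * Q > real DIM('a)"
  shows "(LINT \<theta>::'a::euclidean_space|lborel. ((norm \<theta>)\<^sup>2 + 1) powr - Q) > 0"
proof -
  have "(LINT \<theta>::'a|lborel. ((norm \<theta>)\<^sup>2 + 1) powr - Q) \<noteq> 0"
  proof
    assume "(LINT \<theta>::'a|lborel. ((norm \<theta>)\<^sup>2 + 1) powr - Q) = 0"
    then have "AE \<theta>::'a in lborel. ((norm \<theta>)\<^sup>2 + 1) powr - Q = 0"
      using norm_powr_integrable[OF assms] by (subst (asm) integral_nonneg_eq_0_iff_AE) auto
    moreover have "((norm \<theta>)\<^sup>2 + 1) \<noteq> 0" for \<theta> :: 'a by (simp add: add_nonneg_eq_0_iff)
    ultimately have "AE \<theta>::'a in lborel. False" by simp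
    then show False by (simp add: eventually_False ae_filter_eq_bot_iff)
  qed
  moreover have "(LINT \<theta>::'a|lborel. ((norm \<theta>)\<^sup>2 + 1) powr - Q) \<ge> 0"
    by (rule Bochner_Integration.integral_nonneg) simp
  ultimately show ?thesis by linarith
qed

text \<open>The value follows by reflection in \<mu>, which preserves the weight and sends \<theta>
  to \<open>2 \<mu> - \<theta>\<close>. For integrability, \<open>norm \<theta>\<close> is at most
  \<open>norm \<mu>\<close> plus the square root of the base; this costs half a power and explains
  the stronger condition on \<open>Q\<close>.\<close>

lemma
  fixes \<mu> :: "'a::euclidean_space" and Q c :: real
  assumes Q: "2 * Q > real DIM('a) + 1" and c: "c > 0"
  shows nn_integral_norm_powr_moment: "(\<integral>\<^sup>+ \<theta>. ennreal (((norm (\<theta> - \<mu>))\<^sup>2 + c) powr - Q * norm \<theta>) \<partial>lborel)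
     \<le> ennreal ((LINT \<theta>::'a|lborel. ((norm \<theta>)\<^sup>2 + 1) powr - Q) * c powr (DIM('a) / 2 - Q) * norm \<mu>
        + (LINT \<theta>::'a|lborel. ((norm \<theta>)\<^sup>2 + 1) powr - (Q - 1/2)) * c powr (DIM('a) / 2 - (Q - 1/2)))"
    and integrable_norm_powr_moment: "integrable lborel (\<lambda>\<theta>. ((norm (\<theta> - \<mu>))\<^sup>2 + c) powr - Q *\<^sub>R \<theta>)"
    and integral_norm_powr_moment: "(LINT \<theta>|lborel. ((norm (\<theta> - \<mu>))\<^sup>2 + c) powr - Q *\<^sub>R \<theta>)
      = ((LINT \<theta>::'a|lborel. ((norm \<theta>)\<^sup>2 + 1) powr - Q) * c powr (DIM('a) / 2 - Q)) *\<^sub>R \<mu>"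
proof -
  have Q': "2 * Q > real DIM('a)" "2 * (Q - 1/2) > real DIM('a)" using Q by auto
  have "(\<integral>\<^sup>+ \<theta>. ennreal (((norm (\<theta> - \<mu>))\<^sup>2 + c) powr - Q * norm \<theta>) \<partial>lborel)
    \<le> (\<integral>\<^sup>+ \<theta>. ennreal (((norm (\<theta> - \<mu>))\<^sup>2 + c) powr - Q) * ennreal (norm \<mu>)
        + ennreal (((norm (\<theta> - \<mu>))\<^sup>2 + c) powr - (Q - 1/2)) \<partial>lborel)"
  proof (rule nn_integral_mono)
    fix \<theta> :: 'a
    define t where "t = (norm (\<theta> - \<mu>))\<^sup>2 + c"
    have t: "t > 0" using c by (simp add: t_def add_nonneg_pos)
    have "norm \<theta> \<le> norm \<mu> + norm (\<theta> - \<mu>)" using norm_triangle_ineq[of \<mu> "\<theta> - \<mu>"] by simp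
    also have "norm (\<theta> - \<mu>) \<le> sqrt t" using c by (intro real_le_rsqrt) (simp add: t_def)
    finally have "t powr - Q * norm \<theta> \<le> t powr - Q * (norm \<mu> + sqrt t)"
      by (intro mult_left_mono) auto
    also have "\<dots> = t powr - Q * norm \<mu> + t powr - (Q - 1/2)"
    proof -
      have "t powr - (Q - 1/2) = t powr - Q * t powr (1/2)" by (simp add: powr_add[symmetric])
      then show ?thesis using t by (simp add: powr_half_sqrt distrib_left)
    qed
    finally show "ennreal (((norm (\<theta> - \<mu>))\<^sup>2 + c) powr - Q * norm \<theta>) \<le>
      ennreal (((norm (\<theta> - \<mu>))\<^sup>2 + c) powr - Q) * ennreal (norm \<mu>)
        + ennreal (((norm (\<theta> - \<mu>))\<^sup>2 + c) powr - (Q - 1/2))"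
      by (simp add: t_def ennreal_mult[symmetric] ennreal_plus[symmetric] ennreal_leI del: ennreal_plus)
  qed
  also have "\<dots> = ennreal ((LINT \<theta>::'a|lborel. ((norm \<theta>)\<^sup>2 + 1) powr - Q) * c powr (DIM('a) / 2 - Q) * norm \<mu>
        + (LINT \<theta>::'a|lborel. ((norm \<theta>)\<^sup>2 + 1) powr - (Q - 1/2)) * c powr (DIM('a) / 2 - (Q - 1/2)))"
  proof -
    define I J where "I = (LINT \<theta>::'a|lborel. ((norm \<theta>)\<^sup>2 + 1) powr - Q) * c powr (DIM('a) / 2 - Q)"
      and "J = (LINT \<theta>::'a|lborel. ((norm \<theta>)\<^sup>2 + 1) powr - (Q - 1/2)) * c powr (DIM('a) / 2 - (Q - 1/2))"
    have pos: "I \<ge> 0" "J \<ge> 0"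
      using norm_powr_integral_pos[OF Q'(1)] norm_powr_integral_pos[OF Q'(2)]
      unfolding I_def J_def by (auto intro!: mult_nonneg_nonneg)
    have "(\<integral>\<^sup>+ \<theta>. ennreal (((norm (\<theta> - \<mu>))\<^sup>2 + c) powr - Q) * ennreal (norm \<mu>)
        + ennreal (((norm (\<theta> - \<mu>))\<^sup>2 + c) powr - (Q - 1/2)) \<partial>lborel) = ennreal I * ennreal (norm \<mu>) + ennreal J"
      unfolding I_def J_def nn_integral_norm_powr[OF Q'(1) c, of \<mu>, symmetric] nn_integral_norm_powr[OF Q'(2) c, of \<mu>, symmetric]
      by (subst nn_integral_add, measurable) (subst nn_integral_multc, measurable)
    also have "\<dots> = ennreal (I * norm \<mu> + J)" using pos by (simp add: ennreal_mult)
    finally show ?thesis unfolding I_def J_def .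
  qed
  finally show bound: "(\<integral>\<^sup>+ \<theta>. ennreal (((norm (\<theta> - \<mu>))\<^sup>2 + c) powr - Q * norm \<theta>) \<partial>lborel)
     \<le> ennreal ((LINT \<theta>::'a|lborel. ((norm \<theta>)\<^sup>2 + 1) powr - Q) * c powr (DIM('a) / 2 - Q) * norm \<mu>
        + (LINT \<theta>::'a|lborel. ((norm \<theta>)\<^sup>2 + 1) powr - (Q - 1/2)) * c powr (DIM('a) / 2 - (Q - 1/2)))" .
  then show int: "integrable lborel (\<lambda>\<theta>. ((norm (\<theta> - \<mu>))\<^sup>2 + c) powr - Q *\<^sub>R \<theta>)"
    by (intro integrableI_bounded) (auto simp del: ennreal_plus elim!: le_less_trans)
  define g where "g \<theta> = ((norm (\<theta> - \<mu>))\<^sup>2 + c) powr - Q" for \<theta>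
  have g: "integrable lborel g" "integrable lborel (\<lambda>\<theta>. g \<theta> *\<^sub>R \<theta>)"
    using int integrable_norm_powr[OF Q'(1) c, of \<mu>] by (simp_all add: g_def[abs_def])
  have "(LINT \<theta>|lborel. g \<theta> *\<^sub>R \<theta>)
     = (LINT \<theta>|(density (distr lborel borel (\<lambda>\<theta>::'a. 2 *\<^sub>R \<mu> + (- 1) *\<^sub>R \<theta>)) (\<lambda>_. ennreal (\<bar>- 1\<bar> ^ DIM('a)))). g \<theta> *\<^sub>R \<theta>)"
    by (subst lborel_affine[of "-1" "2 *\<^sub>R \<mu>"]) auto
  also have "\<dots> = (LINT \<theta>|lborel. g (2 *\<^sub>R \<mu> - \<theta>) *\<^sub>R (2 *\<^sub>R \<mu> - \<theta>))"
    by (simp add: density_1 integral_distr g_def)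
  also have "\<dots> = (LINT \<theta>|lborel. g \<theta> *\<^sub>R (2 *\<^sub>R \<mu>) - g \<theta> *\<^sub>R \<theta>)"
  proof -
    have "2 *\<^sub>R \<mu> - \<theta> - \<mu> = - (\<theta> - \<mu>)" for \<theta> by (simp add: scaleR_2)
    then have "g (2 *\<^sub>R \<mu> - \<theta>) = g \<theta>" for \<theta> unfolding g_def by (simp only: norm_minus_cancel)
    then show ?thesis by (simp add: scaleR_diff_right)
  qed
  also have "\<dots> = (LINT \<theta>|lborel. g \<theta>) *\<^sub>R (2 *\<^sub>R \<mu>) - (LINT \<theta>|lborel. g \<theta> *\<^sub>R \<theta>)"
    using g by simp
  finally have "(LINT \<theta>|lborel. g \<theta> *\<^sub>R \<theta>) + (LINT \<theta>|lborel. g \<theta> *\<^sub>R \<theta>)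
      = (LINT \<theta>|lborel. g \<theta>) *\<^sub>R (2 *\<^sub>R \<mu>)"
    by (simp only: eq_diff_eq)
  then have "2 *\<^sub>R (LINT \<theta>|lborel. g \<theta> *\<^sub>R \<theta>) = 2 *\<^sub>R ((LINT \<theta>|lborel. g \<theta>) *\<^sub>R \<mu>)"
    by (simp only: scaleR_2 scaleR_add_right)
  then have "(LINT \<theta>|lborel. g \<theta> *\<^sub>R \<theta>) = (LINT \<theta>|lborel. g \<theta>) *\<^sub>R \<mu>"
    by (simp only: scaleR_cancel_left) simp
  then show "(LINT \<theta>|lborel. ((norm (\<theta> - \<mu>))\<^sup>2 + c) powr - Q *\<^sub>R \<theta>)
      = ((LINT \<theta>::'a|lborel. ((norm \<theta>)\<^sup>2 + 1) powr - Q) * c powr (DIM('a) / 2 - Q)) *\<^sub>R \<mu>"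
    using integral_norm_powr[OF Q'(1) c, of \<mu>] by (simp add: g_def)
qed

text \<open>Feynman's parametrisation: it merges the likelihood factor and the prior factor of the
  posterior weight into one power of a quadratic polynomial in \<open>\<theta>\<close>, so that the integral
  over \<open>\<theta>\<close> can be carried out by completing the square.\<close>

lemma
  fixes A B \<alpha> Q :: real
  assumes "A > 0" "B > 0" "\<alpha> > -1" "\<alpha> - Q < -1"
  shows integrable_feynman: "integrable lborel (\<lambda>u. indicator {0<..} u * (u powr \<alpha> * (A + u * B) powr - Q))"
    and integral_feynman: "(LINT u|lborel. indicator {0<..} u * (u powr \<alpha> * (A + u * B) powr - Q))
      = ker_int \<alpha> 0 Q 1 * (A powr (\<alpha> + 1 - Q) * B powr (- \<alpha> - 1))"
proof -
  have eq: "indicator {0<..} u * (u powr \<alpha> * (A + u * B) powr - Q)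
      = A powr - Q * (indicator {0<..} u * ker \<alpha> 0 Q (B / A) u)" for u :: real
  proof (cases "u > 0")
    case True
    have "A + u * B = A * (1 + B / A * u)" using assms by (simp add: field_simps)
    moreover have "1 + B / A * u > 0" using assms True by (intro add_pos_pos) auto
    ultimately show ?thesis using assms True by (simp add: ker_def powr_mult)
  qed simp
  show "integrable lborel (\<lambda>u. indicator {0<..} u * (u powr \<alpha> * (A + u * B) powr - Q))"
    unfolding eq using ker_integrable[of "B / A" \<alpha> 0 Q] assms by (simp add: set_integrable_def)
  have "(LINT u|lborel. indicator {0<..} u * (u powr \<alpha> * (A + u * B) powr - Q)) = A powr - Q * ker_int \<alpha> 0 Q (B / A)"
    unfolding eq by (simp add: ker_int_def set_lebesgue_integral_def)
  also have "\<dots> = ker_int \<alpha> 0 Q 1 * (A powr (\<alpha> + 1 - Q) * B powr (- \<alpha> - 1))"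
    using assms by (simp add: ker_int_scale[of "B / A"] powr_divide powr_diff powr_minus powr_add field_simps)
  finally show "(LINT u|lborel. indicator {0<..} u * (u powr \<alpha> * (A + u * B) powr - Q))
      = ker_int \<alpha> 0 Q 1 * (A powr (\<alpha> + 1 - Q) * B powr (- \<alpha> - 1))" .
qed

section \<open>The posterior mean as a mixture over the scale parameter\<close>

locale feynman_mixture =
  fixes x :: "'a::euclidean_space" and s \<alpha> Q d M m y K K' :: real
  assumes s: "s > 0" and \<alpha>: "\<alpha> > -1" "\<alpha> < d / 2 - 1" and Q: "2 * Q > d + 1" "Q > \<alpha> + 1"
    and d_def: "d = real DIM('a)" and M_def: "M = Q - d" and m_def: "m = Q - d / 2"
    and y_def: "y = 1 + (norm x)\<^sup>2 / s"
    and K_def: "K = (LINT \<theta>::'a|lborel. ((norm \<theta>)\<^sup>2 + 1) powr - Q)"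
    and K'_def: "K' = (LINT \<theta>::'a|lborel. ((norm \<theta>)\<^sup>2 + 1) powr - (Q - 1/2))"
begin

definition "mix u \<theta> = indicator {0<..} u * (u powr \<alpha> * (((norm (x - \<theta>))\<^sup>2 + s) + u * (norm \<theta>)\<^sup>2) powr - Q)"

text \<open>The constant left after completing the square about the centre
  \<open>x / (1 + u)\<close>; that centre is the origin of the shrinkage by
  \<open>u / (1 + u)\<close>.\<close>

definition "cu u = s * (1 + y * u) / (1 + u)\<^sup>2"

lemma y: "y > 0"
  using s by (auto simp: y_def intro: add_pos_nonneg)

lemma cu: "u > 0 \<Longrightarrow> cu u > 0"
  using s y by (auto simp: cu_def intro!: divide_pos_pos mult_pos_pos add_pos_pos)

lemma K_pos: "K > 0" "K' > 0"
  using norm_powr_integral_pos[where 'a = 'a, of Q] norm_powr_integral_pos[where 'a = 'a, of "Q - 1/2"] Q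
  by (simp_all add: K_def K'_def d_def)

lemma mix_eq:
  assumes u: "u > 0"
  shows "mix u \<theta> = u powr \<alpha> * (1 + u) powr - Q * ((norm (\<theta> - x /\<^sub>R (1 + u)))\<^sup>2 + cu u) powr - Q"
proof -
  have "((norm (x - \<theta>))\<^sup>2 + s) + u * (norm \<theta>)\<^sup>2 = (1 + u) * ((norm (\<theta> - x /\<^sub>R (1 + u)))\<^sup>2 + cu u)"
  proof -
    define X T I where "X = x \<bullet> x" and "T = \<theta> \<bullet> \<theta>" and "I = x \<bullet> \<theta>"
    have "(norm (x - \<theta>))\<^sup>2 = X - 2 * I + T" "(norm \<theta>)\<^sup>2 = T"
      by (simp_all add: power2_norm_eq_inner X_def T_def I_def inner_diff inner_commute)
    moreover have "(norm (\<theta> - x /\<^sub>R (1 + u)))\<^sup>2 = T - 2 * I / (1 + u) + X / (1 + u)\<^sup>2"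
      unfolding power2_norm_eq_inner
      by (simp add: X_def T_def I_def inner_diff inner_commute power2_eq_square divide_inverse)
    moreover have "cu u = (s + (s + X) * u) / (1 + u)\<^sup>2"
    proof -
      have "s * (1 + y * u) = s + (s + X) * u"
        using s by (simp add: y_def X_def power2_norm_eq_inner field_simps)
      then show ?thesis unfolding cu_def by (simp only:)
    qed
    moreover have "X - 2 * I + T + s + u * T = (1 + u) * (T - 2 * I / (1 + u) + X / (1 + u)\<^sup>2 + (s + (s + X) * u) / (1 + u)\<^sup>2)"
    proof -
      define v where "v = 1 / (1 + u)"
      have "v * (1 + u) = 1" using u by (simp add: v_def)
      then have "X - 2 * I + T + s + u * T = (1 + u) * (T - 2 * I * v + X * v\<^sup>2 + (s + (s + X) * u) * v\<^sup>2)"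
        by algebra
      then show ?thesis by (simp add: v_def power_divide)
    qed
    ultimately show ?thesis by simp
  qed
  moreover have "(norm (\<theta> - x /\<^sub>R (1 + u)))\<^sup>2 + cu u > 0" using cu[OF u] by (simp add: add_nonneg_pos)
  ultimately show ?thesis using u by (simp add: mix_def powr_mult)
qed

lemma mix_nonneg: "mix u \<theta> \<ge> 0"
  by (simp add: mix_def)

lemma mix_nonpos: "\<not> u > 0 \<Longrightarrow> mix u \<theta> = 0"
  by (simp add: mix_def)

lemma mix_measurable [measurable]: "(\<lambda>z. mix (fst z) (snd z)) \<in> borel_measurable (lborel \<Otimes>\<^sub>M lborel)"
  unfolding mix_def by measurable

text \<open>The powers left by the integration over \<theta> recombine into a kernel in
  \<open>u\<close>. The second identity, with half a power less, serves to dominate the first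
  moment.\<close>

lemma cu_powr:
  assumes u: "u > 0"
  shows "u powr \<alpha> * (1 + u) powr - Q * cu u powr (d / 2 - Q) = s powr - m * ker \<alpha> M m y u"
    and "u powr \<alpha> * (1 + u) powr - Q * cu u powr (d / 2 - (Q - 1/2)) = s powr - (m - 1/2) * ker \<alpha> (M - 1) (m - 1/2) y u"
proof -
  have p: "1 + y * u > 0" using y u by (intro add_pos_pos) auto
  have sq: "((1 + u)\<^sup>2) powr k = (1 + u) powr (2 * k)" for k
  proof -
    have "(1 + u)\<^sup>2 = (1 + u) powr 2" using u by simp
    then show ?thesis by (simp only: powr_powr)
  qed
  have *: "u powr \<alpha> * (1 + u) powr - Q * cu u powr k = s powr k * (u powr \<alpha> * (1 + u) powr (- Q - 2 * k) * (1 + y * u) powr k)" for k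
  proof -
    have "cu u powr k = s powr k * (1 + y * u) powr k / (1 + u) powr (2 * k)"
      unfolding cu_def using s p u by (simp add: powr_divide powr_mult sq)
    moreover have "(1 + u) powr (- Q - 2 * k) = (1 + u) powr - Q / (1 + u) powr (2 * k)" by (rule powr_diff)
    ultimately show ?thesis by simp
  qed
  show "u powr \<alpha> * (1 + u) powr - Q * cu u powr (d / 2 - Q) = s powr - m * ker \<alpha> M m y u"
    unfolding * by (simp add: ker_def m_def M_def algebra_simps)
  show "u powr \<alpha> * (1 + u) powr - Q * cu u powr (d / 2 - (Q - 1/2)) = s powr - (m - 1/2) * ker \<alpha> (M - 1) (m - 1/2) y u"
    unfolding * by (simp add: ker_def m_def M_def algebra_simps)
qed

lemma mix_integral:
  "integrable lborel (mix u)" 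
  "(LINT \<theta>|lborel. mix u \<theta>) = indicator {0<..} u * (K * s powr - m * ker \<alpha> M m y u)"
  "integrable lborel (\<lambda>\<theta>. mix u \<theta> *\<^sub>R \<theta>)"
  "(LINT \<theta>|lborel. mix u \<theta> *\<^sub>R \<theta>) = (indicator {0<..} u * (K * s powr - m * ker \<alpha> (M - 1) m y u)) *\<^sub>R x"
  "(\<integral>\<^sup>+ \<theta>. ennreal (norm (mix u \<theta>)) \<partial>lborel) \<le> ennreal (indicator {0<..} u * (K * s powr - m * ker \<alpha> M m y u))"
  "(\<integral>\<^sup>+ \<theta>. ennreal (norm (mix u \<theta> *\<^sub>R \<theta>)) \<partial>lborel)
    \<le> ennreal (indicator {0<..} u * (K * s powr - m * norm x * ker \<alpha> (M - 1) m y u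
        + K' * s powr - (m - 1/2) * ker \<alpha> (M - 1) (m - 1/2) y u))"
proof -
  define t where "t = u powr \<alpha> * (1 + u) powr - Q"
  define \<mu> where "\<mu> = x /\<^sub>R (1 + u)"
  have Q': "2 * Q > real DIM('a)" "2 * Q > real DIM('a) + 1" using Q by (simp_all add: d_def)
  have mix: "mix u = (\<lambda>\<theta>. t * ((norm (\<theta> - \<mu>))\<^sup>2 + cu u) powr - Q)" if "u > 0"
    using mix_eq[OF that] by (simp add: t_def \<mu>_def fun_eq_iff)
  have t0: "t \<ge> 0" by (simp add: t_def)
  have z: "mix u = (\<lambda>\<theta>. 0)" if "\<not> u > 0"
    using mix_nonpos[OF that] by (simp add: fun_eq_iff)
  have k: "(1 + u) powr (M - 1) = (1 + u) powr M / (1 + u)" if "u > 0"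
    using that by (simp add: powr_diff)
  have k': "ker \<alpha> (M - 1) m y u = ker \<alpha> M m y u / (1 + u)" if "u > 0"
    using k[OF that] by (simp add: ker_def)
  show i: "integrable lborel (mix u)"
  proof (cases "u > 0")
    case True
    then show ?thesis using integrable_norm_powr[OF Q'(1) cu[OF True], of \<mu>] by (simp add: mix)
  qed (simp add: z)
  show e: "(LINT \<theta>|lborel. mix u \<theta>) = indicator {0<..} u * (K * s powr - m * ker \<alpha> M m y u)"
  proof (cases "u > 0")
    case True
    then have "(LINT \<theta>|lborel. mix u \<theta>) = K * (t * cu u powr (d / 2 - Q))"
      using integral_norm_powr[OF Q'(1) cu[OF True], of \<mu>] by (simp add: mix K_def d_def)
    then show ?thesis using True cu_powr(1)[OF True] by (simp add: t_def)
  qed (simp add: z)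
  show "integrable lborel (\<lambda>\<theta>. mix u \<theta> *\<^sub>R \<theta>)"
  proof (cases "u > 0")
    case True
    then show ?thesis using integrable_norm_powr_moment[OF Q'(2) cu[OF True], of \<mu>]
      by (simp add: mix flip: scaleR_scaleR)
  qed (simp add: z)
  show "(LINT \<theta>|lborel. mix u \<theta> *\<^sub>R \<theta>) = (indicator {0<..} u * (K * s powr - m * ker \<alpha> (M - 1) m y u)) *\<^sub>R x"
  proof (cases "u > 0")
    case True
    then have "(LINT \<theta>|lborel. mix u \<theta> *\<^sub>R \<theta>) = (K * (t * cu u powr (d / 2 - Q))) *\<^sub>R \<mu>"
      using integral_norm_powr_moment[OF Q'(2) cu[OF True], of \<mu>]
      by (simp add: mix K_def d_def mult_ac flip: scaleR_scaleR)
    also have "t * cu u powr (d / 2 - Q) = s powr - m * ker \<alpha> M m y u"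
      unfolding t_def by (rule cu_powr(1)[OF True])
    finally show ?thesis using True by (simp add: k'[OF True] \<mu>_def divide_inverse)
  qed (simp add: z)
  show "(\<integral>\<^sup>+ \<theta>. ennreal (norm (mix u \<theta>)) \<partial>lborel) \<le> ennreal (indicator {0<..} u * (K * s powr - m * ker \<alpha> M m y u))"
    using nn_integral_eq_integral[OF i] mix_nonneg by (simp add: e)
  show "(\<integral>\<^sup>+ \<theta>. ennreal (norm (mix u \<theta> *\<^sub>R \<theta>)) \<partial>lborel)
    \<le> ennreal (indicator {0<..} u * (K * s powr - m * norm x * ker \<alpha> (M - 1) m y u
        + K' * s powr - (m - 1/2) * ker \<alpha> (M - 1) (m - 1/2) y u))"
  proof (cases "u > 0")
    case True
    have "(\<integral>\<^sup>+ \<theta>. ennreal (norm (mix u \<theta> *\<^sub>R \<theta>)) \<partial>lborel)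
      = (\<integral>\<^sup>+ \<theta>. ennreal t * ennreal (((norm (\<theta> - \<mu>))\<^sup>2 + cu u) powr - Q * norm \<theta>) \<partial>lborel)"
      using True t0 by (intro nn_integral_cong) (simp add: mix ennreal_mult[symmetric] mult.assoc)
    also have "\<dots> = ennreal t * (\<integral>\<^sup>+ \<theta>. ennreal (((norm (\<theta> - \<mu>))\<^sup>2 + cu u) powr - Q * norm \<theta>) \<partial>lborel)"
      by (rule nn_integral_cmult) measurable
    also have "\<dots> \<le> ennreal t * ennreal (K * cu u powr (d / 2 - Q) * norm \<mu> + K' * cu u powr (d / 2 - (Q - 1/2)))"
      unfolding K_def K'_def d_def by (intro mult_left_mono nn_integral_norm_powr_moment Q' cu True) simp
    also have "\<dots> = ennreal (K * (t * cu u powr (d / 2 - Q)) * norm \<mu> + K' * (t * cu u powr (d / 2 - (Q - 1/2))))"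
      using t0 K_pos by (subst ennreal_mult[symmetric]) (auto simp: algebra_simps)
    also have "\<dots> = ennreal (K * s powr - m * norm x * ker \<alpha> (M - 1) m y u + K' * s powr - (m - 1/2) * ker \<alpha> (M - 1) (m - 1/2) y u)"
    proof -
      have "t * cu u powr (d / 2 - Q) = s powr - m * ker \<alpha> M m y u"
        "t * cu u powr (d / 2 - (Q - 1/2)) = s powr - (m - 1/2) * ker \<alpha> (M - 1) (m - 1/2) y u"
        unfolding t_def by (rule cu_powr[OF True])+
      moreover have "norm \<mu> = norm x / (1 + u)" using True by (simp add: \<mu>_def divide_inverse mult.commute)
      ultimately show ?thesis by (simp only: k'[OF True]) (simp add: mult_ac)
    qed
    finally show ?thesis using True by simp
  qed (simp add: z)
qed

text \<open>The licence for Fubini. Decay in \<open>u\<close> is governed by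
  \<open>\<alpha> + M - m = \<alpha> - d / 2\<close>, which lies below -1 by the upper bound on
  \<alpha>; the kernels in the moment bound decay faster still.\<close>

lemma mix_pair_integrable:
  "integrable (lborel \<Otimes>\<^sub>M lborel) (\<lambda>(u, \<theta>). mix u \<theta>)"
  "integrable (lborel \<Otimes>\<^sub>M lborel) (\<lambda>(u, \<theta>). mix u \<theta> *\<^sub>R \<theta>)"
proof -
  have ex: "\<alpha> + M - m < -1" "\<alpha> + (M - 1) - m < -1" "\<alpha> + (M - 1) - (m - 1/2) < -1"
    unfolding M_def m_def using \<alpha>(2) by auto
  have fin: "(\<integral>\<^sup>+ u. ennreal (h u) \<partial>lborel) < \<infinity>" if "integrable lborel h" for h :: "real \<Rightarrow> real"
  proof -
    have "(\<integral>\<^sup>+ u. ennreal (h u) \<partial>lborel) \<le> (\<integral>\<^sup>+ u. ennreal (norm (h u)) \<partial>lborel)"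
      by (intro nn_integral_mono ennreal_leI) simp
    also have "\<dots> < \<infinity>" using that by (simp add: integrable_iff_bounded)
    finally show ?thesis .
  qed
  have ki: "integrable lborel (\<lambda>u. indicator {0<..} u * (c * ker \<alpha> a b y u))" if "\<alpha> + a - b < -1" for a b c
    using ker_integrable[OF y \<alpha>(1) that] by (simp add: set_integrable_def mult.left_commute[of "indicator _ _"])
  show "integrable (lborel \<Otimes>\<^sub>M lborel) (\<lambda>(u, \<theta>). mix u \<theta>)"
  proof (rule integrableI_bounded)
    have "(\<integral>\<^sup>+ z. ennreal (norm (case z of (u, \<theta>) \<Rightarrow> mix u \<theta>)) \<partial>(lborel \<Otimes>\<^sub>M lborel))
      = (\<integral>\<^sup>+ u. (\<integral>\<^sup>+ \<theta>. ennreal (norm (mix u \<theta>)) \<partial>lborel) \<partial>lborel)"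
      by (subst lborel.nn_integral_fst[symmetric]) (simp_all add: case_prod_beta)
    also have "\<dots> \<le> (\<integral>\<^sup>+ u. ennreal (indicator {0<..} u * (K * s powr - m * ker \<alpha> M m y u)) \<partial>lborel)"
      by (intro nn_integral_mono mix_integral)
    also have "\<dots> < \<infinity>"
      by (intro fin ki ex)
    finally show "(\<integral>\<^sup>+ z. ennreal (norm (case z of (u, \<theta>) \<Rightarrow> mix u \<theta>)) \<partial>(lborel \<Otimes>\<^sub>M lborel)) < \<infinity>" .
  qed (simp add: case_prod_beta)
  show "integrable (lborel \<Otimes>\<^sub>M lborel) (\<lambda>(u, \<theta>). mix u \<theta> *\<^sub>R \<theta>)"
  proof (rule integrableI_bounded)
    have "(\<integral>\<^sup>+ z. ennreal (norm (case z of (u, \<theta>) \<Rightarrow> mix u \<theta> *\<^sub>R \<theta>)) \<partial>(lborel \<Otimes>\<^sub>M lborel))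
      = (\<integral>\<^sup>+ u. (\<integral>\<^sup>+ \<theta>. ennreal (norm (mix u \<theta> *\<^sub>R \<theta>)) \<partial>lborel) \<partial>lborel)"
      by (subst lborel.nn_integral_fst[symmetric]) (simp_all add: case_prod_beta)
    also have "\<dots> \<le> (\<integral>\<^sup>+ u. ennreal (indicator {0<..} u * (K * s powr - m * norm x * ker \<alpha> (M - 1) m y u
        + K' * s powr - (m - 1/2) * ker \<alpha> (M - 1) (m - 1/2) y u)) \<partial>lborel)"
      by (intro nn_integral_mono mix_integral)
    also have "\<dots> < \<infinity>"
      unfolding distrib_left by (intro fin Bochner_Integration.integrable_add ki ex)
    finally show "(\<integral>\<^sup>+ z. ennreal (norm (case z of (u, \<theta>) \<Rightarrow> mix u \<theta> *\<^sub>R \<theta>)) \<partial>(lborel \<Otimes>\<^sub>M lborel)) < \<infinity>" .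
  qed (simp add: case_prod_beta)
qed

text \<open>Numerator and denominator share the Beta constant \<open>F\<close> of Feynman's formula
  and the factor \<open>K * s powr - m\<close>. After cancellation they differ only by
  \<open>1 / (1 + u)\<close> under the integral, from the centre \<open>x / (1 + u)\<close>. The
  formula needs \<theta> \<noteq> 0, which holds almost everywhere.\<close>

lemma posterior_mean_mixture:
  fixes wt :: "'a \<Rightarrow> real"
  defines "wt \<equiv> \<lambda>\<theta>. ((norm (x - \<theta>))\<^sup>2 + s) powr (\<alpha> + 1 - Q) * norm \<theta> powr (- 2 * (\<alpha> + 1))"
  shows "inverse (LINT \<theta>|lborel. wt \<theta>) *\<^sub>R (LINT \<theta>|lborel. wt \<theta> *\<^sub>R \<theta>)
    = (ker_int \<alpha> (M - 1) m y / ker_int \<alpha> M m y) *\<^sub>R x"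
proof -
  define F where "F = ker_int \<alpha> 0 Q 1"
  have F: "F > 0" unfolding F_def using \<alpha> Q by (intro ker_int_pos) auto
  have u: "integrable lborel (\<lambda>u. mix u \<theta>)" "(LINT u|lborel. mix u \<theta>) = F * wt \<theta>" if "\<theta> \<noteq> 0" for \<theta>
  proof -
    have "((norm \<theta>)\<^sup>2) powr (- \<alpha> - 1) = norm \<theta> powr (- 2 * (\<alpha> + 1))"
    proof -
      have "(norm \<theta>)\<^sup>2 = norm \<theta> powr 2" using that by simp
      then have "((norm \<theta>)\<^sup>2) powr (- \<alpha> - 1) = norm \<theta> powr (2 * (- \<alpha> - 1))" by (simp only: powr_powr)
      also have "2 * (- \<alpha> - 1) = - 2 * (\<alpha> + 1)" by simp
      finally show ?thesis .
    qed
    then show "integrable lborel (\<lambda>u. mix u \<theta>)" "(LINT u|lborel. mix u \<theta>) = F * wt \<theta>"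
      using integrable_feynman[of "(norm (x - \<theta>))\<^sup>2 + s" "(norm \<theta>)\<^sup>2" \<alpha> Q]
        integral_feynman[of "(norm (x - \<theta>))\<^sup>2 + s" "(norm \<theta>)\<^sup>2" \<alpha> Q] that \<alpha> Q s
      by (simp_all add: mix_def F_def wt_def add_nonneg_pos)
  qed
  have ne: "AE \<theta>::'a in lborel. \<theta> \<noteq> 0" using AE_lborel_singleton[of 0] by simp
  have [measurable]: "(\<lambda>\<theta>. LINT u|lborel. mix u \<theta>) \<in> borel_measurable borel"
    using lborel.borel_measurable_lebesgue_integral[of "\<lambda>\<theta> u. mix u \<theta>" lborel] by (simp add: mix_def)
  have [measurable]: "(\<lambda>\<theta>. LINT u|lborel. mix u \<theta> *\<^sub>R \<theta>) \<in> borel_measurable borel"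
    using lborel.borel_measurable_lebesgue_integral[of "\<lambda>\<theta> u. mix u \<theta> *\<^sub>R \<theta>" lborel] by (simp add: mix_def)
  have "F * (LINT \<theta>|lborel. wt \<theta>) = (LINT \<theta>|lborel. (LINT u|lborel. mix u \<theta>))"
    unfolding integral_mult_right_zero[symmetric]
    by (rule integral_cong_AE) (use ne u(2) in \<open>auto simp: wt_def elim!: eventually_mono\<close>)
  also have "\<dots> = (LINT u|lborel. (LINT \<theta>|lborel. mix u \<theta>))"
    by (rule lborel_pair.Fubini_integral) (rule mix_pair_integrable)
  also have "\<dots> = K * s powr - m * ker_int \<alpha> M m y"
    by (simp add: mix_integral ker_int_def set_lebesgue_integral_def mult.left_commute[of "indicator _ _"])
  finally have den: "F * (LINT \<theta>|lborel. wt \<theta>) = K * s powr - m * ker_int \<alpha> M m y" .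
  have "F *\<^sub>R (LINT \<theta>|lborel. wt \<theta> *\<^sub>R \<theta>) = (LINT \<theta>|lborel. (LINT u|lborel. mix u \<theta> *\<^sub>R \<theta>))"
    unfolding integral_scaleR_right[symmetric]
    by (rule integral_cong_AE) (use ne u in \<open>auto simp: wt_def elim!: eventually_mono\<close>)
  also have "\<dots> = (LINT u|lborel. (LINT \<theta>|lborel. mix u \<theta> *\<^sub>R \<theta>))"
    by (rule lborel_pair.Fubini_integral) (rule mix_pair_integrable)
  also have "\<dots> = (K * s powr - m * ker_int \<alpha> (M - 1) m y) *\<^sub>R x"
  proof -
    have "integrable lborel (\<lambda>u. indicator {0<..} u * (K * s powr - m * ker \<alpha> (M - 1) m y u))"
      using ker_integrable[OF y \<alpha>(1), of "M - 1" m] \<alpha>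
      by (simp add: set_integrable_def mult.left_commute[of "indicator _ _"] M_def m_def)
    then show ?thesis
      by (simp add: mix_integral ker_int_def set_lebesgue_integral_def mult.left_commute[of "indicator _ _"])
  qed
  finally have num: "F *\<^sub>R (LINT \<theta>|lborel. wt \<theta> *\<^sub>R \<theta>) = (K * s powr - m * ker_int \<alpha> (M - 1) m y) *\<^sub>R x" .
  have "ker_int \<alpha> M m y > 0" using y \<alpha> by (intro ker_int_pos) (auto simp: M_def m_def)
  have "inverse (LINT \<theta>|lborel. wt \<theta>) *\<^sub>R (LINT \<theta>|lborel. wt \<theta> *\<^sub>R \<theta>)
    = inverse (F * (LINT \<theta>|lborel. wt \<theta>)) *\<^sub>R (F *\<^sub>R (LINT \<theta>|lborel. wt \<theta> *\<^sub>R \<theta>))"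
    using F by simp
  also have "\<dots> = (ker_int \<alpha> (M - 1) m y / ker_int \<alpha> M m y) *\<^sub>R x"
    unfolding den num using K_pos s by (simp add: field_simps)
  finally show ?thesis .
qed

end

text \<open>\<open>\<alpha>\<close> and \<open>Q\<close> are read off from the weight:
  \<open>- 2 * (\<alpha> + 1)\<close> is the exponent of the prior factor and
  \<open>\<alpha> + 1 - Q\<close> that of the other factor. The bound \<open>a < -1\<close> is the
  condition \<open>\<alpha> < d / 2 - 1\<close> of the mixture.\<close>

lemma gb_est_eq_ratio:
  fixes x :: "real^'p"
  assumes s: "s > 0" and a: "a > - P - 2" "a < -1" and e: "e > - P - n/2 - 2"
    and n: "n \<ge> 0" and p: "real CARD('p) = 2 * P + 2"
  shows "gb_est n a e x s = (1 - ratio P (n/2 + e + 2) (a + 2) ((norm x)\<^sup>2 / s)) *\<^sub>R x"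
proof -
  define Q where "Q = n/2 + e + 2 + (2 * P + 2)"
  define \<alpha> where "\<alpha> = P + a + 1"
  define M where "M = n/2 + e + 2"
  define y where "y = 1 + (norm x)\<^sup>2 / s"
  have y: "y > 0" using s by (auto simp: y_def intro: add_pos_nonneg)
  have wt: "gb_weight n a e x s \<theta> = ((norm (x - \<theta>))\<^sup>2 + s) powr (\<alpha> + 1 - Q) * norm \<theta> powr (- 2 * (\<alpha> + 1))" for \<theta> :: "real^'p"
  proof -
    have "- (n + (2 * P + 2)) / 2 + a - e - 1 = \<alpha> + 1 - Q" "- 2 * ((2 * P + 2) / 2 + a + 1) = - 2 * (\<alpha> + 1)"
      by (simp_all add: \<alpha>_def Q_def field_simps)
    then show ?thesis unfolding gb_weight_def Let_def p by (simp only:)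
  qed
  have "gb_est n a e x s = (ker_int \<alpha> (Q - (2 * P + 2) - 1) (Q - (2 * P + 2) / 2) y / ker_int \<alpha> (Q - (2 * P + 2)) (Q - (2 * P + 2) / 2) y) *\<^sub>R x"
    unfolding gb_est_def wt y_def
    using s a e n p by (intro feynman_mixture.posterior_mean_mixture[OF feynman_mixture.intro[OF _ _ _ _ _ _ refl refl refl refl refl]])
      (simp_all add: \<alpha>_def Q_def)
  also have "Q - (2 * P + 2) = M" by (simp add: Q_def M_def)
  also have "Q - (2 * P + 2) / 2 = M + P + 1" by (simp add: Q_def M_def field_simps)
  also have "ker_int \<alpha> (M - 1) (M + P + 1) y / ker_int \<alpha> M (M + P + 1) y = 1 - ratio P M (a + 2) ((norm x)\<^sup>2 / s)"
  proof -
    \<comment> \<open>The identity \<open>1 = 1 / (1 + u) + u / (1 + u)\<close> at the level of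
      kernels; it turns the multiplier of \<open>x\<close> into one minus the shrinkage.\<close>
    have *: "indicator {0<..} u * ker \<alpha> M (M + P + 1) y u
      = indicator {0<..} u * ker \<alpha> (M - 1) (M + P + 1) y u + indicator {0<..} u * ker (\<alpha> + 1) (M - 1) (M + P + 1) y u" for u
    proof (cases "u > 0")
      case True
      then have "(1 + u) powr M = (1 + u) powr (M - 1) * (1 + u)" "u powr (\<alpha> + 1) = u powr \<alpha> * u"
        by (simp_all add: powr_diff powr_add)
      then show ?thesis unfolding ker_def by (simp add: algebra_simps)
    qed simp
    have "ker_int \<alpha> M (M + P + 1) y = ker_int \<alpha> (M - 1) (M + P + 1) y + ker_int (\<alpha> + 1) (M - 1) (M + P + 1) y"
    proof -
      have "\<alpha> > -1" "\<alpha> + 1 > -1" "\<alpha> + (M - 1) - (M + P + 1) < -1" "\<alpha> + 1 + (M - 1) - (M + P + 1) < -1"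
        using a by (simp_all add: \<alpha>_def)
      then show ?thesis
        using ker_integrable[OF y, of \<alpha> "M - 1" "M + P + 1"] ker_integrable[OF y, of "\<alpha> + 1" "M - 1" "M + P + 1"]
        by (simp add: ker_int_def set_lebesgue_integral_def set_integrable_def *)
    qed
    moreover have "ker_int \<alpha> M (M + P + 1) y > 0" using y a by (intro ker_int_pos) (auto simp: \<alpha>_def)
    ultimately show ?thesis by (simp add: ratio_def y_def[symmetric] \<alpha>_def field_simps)
  qed
  finally show ?thesis by (simp add: M_def)
qed

section \<open>Stein's identity for spherically symmetric densities\<close>

lemma nn_integral_translate:
  fixes f :: "'a::euclidean_space \<Rightarrow> ennreal"
  assumes [measurable]: "f \<in> borel_measurable borel"
  shows "(\<integral>\<^sup>+ u. f (a + u) \<partial>lborel) = (\<integral>\<^sup>+ u. f u \<partial>lborel)"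
  by (subst lborel_distr_plus[of a, symmetric], subst nn_integral_distr) auto

text \<open>Averaging over the unit slab replaces the integral over the whole space by integrals over
  the lines in direction \<open>v\<close>, using only translation invariance and no choice of coordinates.\<close>

lemma nn_integral_lines:
  fixes f :: "'a::euclidean_space \<Rightarrow> ennreal"
  assumes f [measurable]: "f \<in> borel_measurable borel" and v: "v \<bullet> v = 1"
  shows "(\<integral>\<^sup>+ u. f u \<partial>lborel) = (\<integral>\<^sup>+ u. indicator {0..1} (u \<bullet> v) * (\<integral>\<^sup>+ t. f (u + t *\<^sub>R v) \<partial>lborel) \<partial>lborel)"
proof -
  have "(\<integral>\<^sup>+ u. f u \<partial>lborel) = (\<integral>\<^sup>+ u. (\<integral>\<^sup>+ t. f u * indicator {u \<bullet> v - 1 .. u \<bullet> v} t \<partial>lborel) \<partial>lborel)"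
    by (simp add: nn_integral_cmult_indicator)
  also have "\<dots> = (\<integral>\<^sup>+ u. (\<integral>\<^sup>+ t. f u * indicator {0..1} (u \<bullet> v - t) \<partial>lborel) \<partial>lborel)"
    by (intro nn_integral_cong) (auto split: split_indicator)
  also have "\<dots> = (\<integral>\<^sup>+ t. (\<integral>\<^sup>+ u. f u * indicator {0..1} (u \<bullet> v - t) \<partial>lborel) \<partial>lborel)"
    by (rule lborel_pair.Fubini'[symmetric]) measurable
  also have "\<dots> = (\<integral>\<^sup>+ t. (\<integral>\<^sup>+ u. f (t *\<^sub>R v + u) * indicator {0..1} ((t *\<^sub>R v + u) \<bullet> v - t) \<partial>lborel) \<partial>lborel)"
    by (intro nn_integral_cong nn_integral_translate[symmetric]) measurable
  also have "\<dots> = (\<integral>\<^sup>+ t. (\<integral>\<^sup>+ u. f (u + t *\<^sub>R v) * indicator {0..1} (u \<bullet> v) \<partial>lborel) \<partial>lborel)"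
    using v by (simp add: inner_add_left add.commute)
  also have "\<dots> = (\<integral>\<^sup>+ u. (\<integral>\<^sup>+ t. f (u + t *\<^sub>R v) * indicator {0..1} (u \<bullet> v) \<partial>lborel) \<partial>lborel)"
    by (rule lborel_pair.Fubini') measurable
  also have "\<dots> = (\<integral>\<^sup>+ u. indicator {0..1} (u \<bullet> v) * (\<integral>\<^sup>+ t. f (u + t *\<^sub>R v) \<partial>lborel) \<partial>lborel)"
    by (simp add: nn_integral_multc mult.commute)
  finally show ?thesis .
qed

text \<open>Extended values are used because \<open>f\<close> may fail to be integrable near 0, in
  which case the tail at 0 is infinite.\<close>

definition tail :: "(real \<Rightarrow> real) \<Rightarrow> real \<Rightarrow> ennreal" where
  "tail f q = (\<integral>\<^sup>+ \<tau>. ennreal (f \<tau> / 2) * indicator {q..} \<tau> \<partial>lborel)"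

lemma tail_antimono: "p \<le> q \<Longrightarrow> tail f q \<le> tail f p"
  unfolding tail_def by (intro nn_integral_mono) (auto split: split_indicator)

lemma tail_measurable [measurable]:
  assumes [measurable]: "f \<in> borel_measurable borel"
  shows "tail f \<in> borel_measurable borel"
proof -
  have eq: "tail f = (\<lambda>q. \<integral>\<^sup>+ \<tau>. ennreal (f \<tau> / 2) * (if q \<le> \<tau> then 1 else 0) \<partial>lborel)"
    by (intro ext) (auto simp: tail_def intro!: nn_integral_cong split: split_indicator)
  show ?thesis unfolding eq by measurable
qed

text \<open>Substitute \<open>\<tau> = t\<^sup>2 + c\<close> on each of the two half-lines; each
  contributes one half of the tail.\<close>

lemma tail_square:
  fixes f :: "real \<Rightarrow> real"
  assumes [measurable]: "f \<in> borel_measurable borel" and f: "\<And>t. f t \<ge> 0"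
  shows "(\<integral>\<^sup>+ t. ennreal (\<bar>t\<bar> / 2 * f (t\<^sup>2 + c)) * indicator {\<bar>v\<bar>..} \<bar>t\<bar> \<partial>lborel) = tail f (v\<^sup>2 + c)"
proof -
  define a where "a = \<bar>v\<bar>"
  have a: "a \<ge> 0" "a\<^sup>2 = v\<^sup>2" by (auto simp: a_def)
  define M1 where "M1 = density lborel (\<lambda>\<tau>. ennreal (f \<tau> / 2))"
  define M2 where "M2 = density lborel (\<lambda>t. ennreal (t * f (t\<^sup>2 + c)))"
  have pos: "(\<integral>\<^sup>+ t. ennreal (t * f (t\<^sup>2 + c)) * indicator {a..} t \<partial>lborel) = tail f (a\<^sup>2 + c)"
  proof -
    \<comment> \<open>The substitution is made on compact intervals, stated as an equality of
      measures so that continuity from below carries it to the half-line.\<close>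
    have eq: "emeasure M1 {a\<^sup>2 + c .. (a + real k)\<^sup>2 + c} = emeasure M2 {a .. a + real k}" for k
    proof -
      have "(\<integral>\<^sup>+ \<tau>. ennreal (f \<tau> / 2) * indicator {a\<^sup>2 + c .. (a + real k)\<^sup>2 + c} \<tau> \<partial>lborel)
        = (\<integral>\<^sup>+ t. ennreal (f (t\<^sup>2 + c) / 2) * ennreal (2 * t) * indicator {a .. a + real k} t \<partial>lborel)"
      proof -
        have "(\<integral>\<^sup>+ \<tau>. ennreal (f \<tau> / 2 * indicator {a\<^sup>2 + c .. (a + real k)\<^sup>2 + c} \<tau>) \<partial>lborel)
          = (\<integral>\<^sup>+ t. ennreal (f (t\<^sup>2 + c) / 2 * (2 * t) * indicator {a .. a + real k} t) \<partial>lborel)"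
          using a by (intro nn_integral_substitution[where f = "\<lambda>\<tau>. f \<tau> / 2" and g = "\<lambda>t. t\<^sup>2 + c" and g' = "\<lambda>t. 2 * t"])
            (auto intro!: derivative_eq_intros continuous_intros simp: set_borel_measurable_def)
        moreover have "ennreal (f \<tau> / 2 * indicator A \<tau>) = ennreal (f \<tau> / 2) * indicator A \<tau>" for A \<tau>
          by (simp split: split_indicator)
        moreover have "ennreal (f (t\<^sup>2 + c) / 2 * (2 * t) * indicator {a .. a + real k} t)
          = ennreal (f (t\<^sup>2 + c) / 2) * ennreal (2 * t) * indicator {a .. a + real k} t" for t
          using a(1) f[of "t\<^sup>2 + c"] by (auto simp: ennreal_mult[symmetric] split: split_indicator)
        ultimately show ?thesis by (simp only:)
      qed
      also have "\<dots> = (\<integral>\<^sup>+ t. ennreal (t * f (t\<^sup>2 + c)) * indicator {a .. a + real k} t \<partial>lborel)"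
        using a f by (intro nn_integral_cong) (auto simp: ennreal_mult[symmetric] mult.commute split: split_indicator)
      finally show ?thesis unfolding M1_def M2_def by (subst (1 2) emeasure_density) auto
    qed
    have "emeasure M1 (\<Union>k. {a\<^sup>2 + c .. (a + real k)\<^sup>2 + c}) = (SUP k. emeasure M1 {a\<^sup>2 + c .. (a + real k)\<^sup>2 + c})"
      using a by (intro SUP_emeasure_incseq[symmetric])
        (auto simp: M1_def incseq_def intro: order_trans power_mono)
    also have "\<dots> = (SUP k. emeasure M2 {a .. a + real k})" by (simp add: eq)
    also have "\<dots> = emeasure M2 (\<Union>k. {a .. a + real k})"
      by (intro SUP_emeasure_incseq) (auto simp: M2_def incseq_def)
    also have "(\<Union>k. {a .. a + real k}) = {a..}"
      by (auto; metis add.commute diff_le_eq real_arch_simple)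
    also have "(\<Union>k. {a\<^sup>2 + c .. (a + real k)\<^sup>2 + c}) = {a\<^sup>2 + c..}"
    proof -
      have "\<exists>k. \<tau> \<le> (a + real k)\<^sup>2 + c" for \<tau>
      proof -
        obtain k where k: "max 1 (\<tau> - c) \<le> real k" using real_arch_simple by blast
        then have "real k \<le> real k * real k" by simp
        also have "\<dots> \<le> (a + real k)\<^sup>2" unfolding power2_eq_square using a by (intro mult_mono) auto
        finally show ?thesis using k by (intro exI[of _ k]) simp
      qed
      then show ?thesis by auto
    qed
    finally show ?thesis unfolding tail_def M1_def M2_def by (subst (asm) (1 2) emeasure_density) auto
  qed
  have neg: "(\<integral>\<^sup>+ t. ennreal (- t * f (t\<^sup>2 + c)) * indicator {a..} (- t) \<partial>lborel) = tail f (a\<^sup>2 + c)"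
    using nn_integral_real_affine[of "\<lambda>t. ennreal (t * f (t\<^sup>2 + c)) * indicator {a..} t" "-1" 0] pos by simp
  have "AE t::real in lborel. t \<noteq> 0" using AE_lborel_singleton[of 0] by simp
  then have "(\<integral>\<^sup>+ t. ennreal (\<bar>t\<bar> / 2 * f (t\<^sup>2 + c)) * indicator {\<bar>v\<bar>..} \<bar>t\<bar> \<partial>lborel)
    = (\<integral>\<^sup>+ t. (ennreal (t * f (t\<^sup>2 + c)) * indicator {a..} t + ennreal (- t * f (t\<^sup>2 + c)) * indicator {a..} (- t)) * ennreal (1/2) \<partial>lborel)"
  proof (intro nn_integral_cong_AE, eventually_elim)
    fix t :: real assume "t \<noteq> 0"
    then show "ennreal (\<bar>t\<bar> / 2 * f (t\<^sup>2 + c)) * indicator {\<bar>v\<bar>..} \<bar>t\<bar>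
      = (ennreal (t * f (t\<^sup>2 + c)) * indicator {a..} t + ennreal (- t * f (t\<^sup>2 + c)) * indicator {a..} (- t)) * ennreal (1/2)"
      using a f[of "t\<^sup>2 + c"] unfolding a_def[symmetric]
      by (cases "t > 0") (auto simp: ennreal_mult[symmetric] mult_le_0_iff split: split_indicator simp del: ennreal_half)
  qed
  also have "\<dots> = (tail f (a\<^sup>2 + c) + tail f (a\<^sup>2 + c)) * ennreal (1/2)"
    by (subst nn_integral_multc, measurable) (subst nn_integral_add, measurable, simp only: pos neg)
  also have "\<dots> = tail f (a\<^sup>2 + c)"
  proof -
    have "(z + z) * ennreal (1/2) = z" for z :: ennreal
      by (cases z) (auto simp: ennreal_mult[symmetric] ennreal_plus[symmetric] ennreal_top_mult simp del: ennreal_plus ennreal_half)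
    then show ?thesis .
  qed
  finally show ?thesis using a by simp
qed

text \<open>The case \<open>h t = t\<close>, with \<open>t\<^sup>2\<close> written as the integral
  of \<open>|t| / 2\<close> over the interval from \<open>- |t|\<close> to \<open>|t|\<close>. Being
  about nonnegative integrals, it can establish finiteness instead of presupposing it.\<close>

lemma stein_line_nn:
  fixes f :: "real \<Rightarrow> real"
  assumes [measurable]: "f \<in> borel_measurable borel" and f: "\<And>t. f t \<ge> 0"
  shows "(\<integral>\<^sup>+ t. ennreal (t\<^sup>2 * f (t\<^sup>2 + c)) \<partial>lborel) = (\<integral>\<^sup>+ v. tail f (v\<^sup>2 + c) \<partial>lborel)"
proof -
  have "(\<integral>\<^sup>+ t. ennreal (t\<^sup>2 * f (t\<^sup>2 + c)) \<partial>lborel)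
    = (\<integral>\<^sup>+ t. (\<integral>\<^sup>+ v. ennreal (\<bar>t\<bar> / 2 * f (t\<^sup>2 + c)) * indicator {- \<bar>t\<bar>..\<bar>t\<bar>} v \<partial>lborel) \<partial>lborel)"
  proof (rule nn_integral_cong)
    fix t :: real
    have "(\<integral>\<^sup>+ v. ennreal (\<bar>t\<bar> / 2 * f (t\<^sup>2 + c)) * indicator {- \<bar>t\<bar>..\<bar>t\<bar>} v \<partial>lborel)
      = ennreal (\<bar>t\<bar> / 2 * f (t\<^sup>2 + c)) * ennreal (2 * \<bar>t\<bar>)"
      by (subst nn_integral_cmult_indicator) auto
    also have "\<dots> = ennreal (\<bar>t\<bar> / 2 * f (t\<^sup>2 + c) * (2 * \<bar>t\<bar>))"
      using f by (intro ennreal_mult[symmetric]) auto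
    also have "\<bar>t\<bar> / 2 * f (t\<^sup>2 + c) * (2 * \<bar>t\<bar>) = t\<^sup>2 * f (t\<^sup>2 + c)"
      by (simp add: power2_eq_square abs_if)
    finally show "ennreal (t\<^sup>2 * f (t\<^sup>2 + c))
      = (\<integral>\<^sup>+ v. ennreal (\<bar>t\<bar> / 2 * f (t\<^sup>2 + c)) * indicator {- \<bar>t\<bar>..\<bar>t\<bar>} v \<partial>lborel)" by simp
  qed
  also have "\<dots> = (\<integral>\<^sup>+ t. (\<integral>\<^sup>+ v. ennreal (\<bar>t\<bar> / 2 * f (t\<^sup>2 + c)) * indicator {\<bar>v\<bar>..} \<bar>t\<bar> \<partial>lborel) \<partial>lborel)"
    by (intro nn_integral_cong) (auto split: split_indicator)
  also have "\<dots> = (\<integral>\<^sup>+ v. (\<integral>\<^sup>+ t. ennreal (\<bar>t\<bar> / 2 * f (t\<^sup>2 + c)) * indicator {\<bar>v\<bar>..} \<bar>t\<bar> \<partial>lborel) \<partial>lborel)"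
    by (rule lborel_pair.Fubini'[symmetric]) (simp add: indicator_def, measurable)
  also have "\<dots> = (\<integral>\<^sup>+ v. tail f (v\<^sup>2 + c) \<partial>lborel)"
    by (simp only: tail_square[OF assms(1) f])
  finally show ?thesis .
qed

text \<open>Symmetrisation avoids boundary terms: under the even weight, \<open>t h(t)\<close> may
  be replaced by \<open>t (h(t) - h(- t)) / 2\<close>, and the difference is the integral of
  \<open>h'\<close> from \<open>- t\<close> to \<open>t\<close>. Fubini then performs the integral
  over \<open>t\<close> first, which produces the tail. The finite set \<open>S\<close> allows for
  the point where a field is not differentiable.\<close>

lemma stein_line:
  fixes f h h' :: "real \<Rightarrow> real"
  assumes [measurable]: "f \<in> borel_measurable borel" and f: "\<And>t. f t \<ge> 0" and c: "c \<ge> 0"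
    and fin: "\<And>q. q > 0 \<Longrightarrow> tail f q < \<infinity>"
    and h: "continuous_on UNIV h" and S: "finite S"
      "\<And>t. t \<notin> S \<Longrightarrow> (h has_real_derivative h' t) (at t)"
    and h' [measurable]: "h' \<in> borel_measurable borel" and bound: "\<And>t. \<bar>h' t\<bar> \<le> C"
    and int: "integrable lborel (\<lambda>t. t * h t * f (t\<^sup>2 + c))"
      "integrable lborel (\<lambda>t. h' t * enn2real (tail f (t\<^sup>2 + c)))"
  shows "(LINT t|lborel. t * h t * f (t\<^sup>2 + c)) = (LINT t|lborel. h' t * enn2real (tail f (t\<^sup>2 + c)))"
proof -
  define G where "G t v = \<bar>t\<bar> / 2 * f (t\<^sup>2 + c) * indicator {\<bar>v\<bar>..} \<bar>t\<bar> * h' v" for t v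
  have [measurable]: "(\<lambda>z. G (fst z) (snd z)) \<in> borel_measurable (lborel \<Otimes>\<^sub>M lborel)"
    unfolding G_def indicator_def by simp measurable
  \<comment> \<open>The point \<open>v = 0\<close> is left out because for \<open>c = 0\<close> the
    tail may be infinite there; it is a null set.\<close>
  have tail_fin: "tail f (v\<^sup>2 + c) = ennreal (enn2real (tail f (v\<^sup>2 + c)))" if "v \<noteq> 0" for v
    using fin[of "v\<^sup>2 + c"] that c by (simp add: add_pos_nonneg)
  have Gt: "integrable lborel (\<lambda>t. G t v)" "(LINT t|lborel. G t v) = h' v * enn2real (tail f (v\<^sup>2 + c))"
     "(\<integral>\<^sup>+ t. ennreal (norm (G t v)) \<partial>lborel) = ennreal (norm (h' v * enn2real (tail f (v\<^sup>2 + c))))"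
    if "v \<noteq> 0" for v
  proof -
    define k where "k t = \<bar>t\<bar> / 2 * f (t\<^sup>2 + c) * indicator {\<bar>v\<bar>..} \<bar>t\<bar>" for t
    have [measurable]: "k \<in> borel_measurable borel" unfolding k_def[abs_def] indicator_def by simp measurable
    have k0: "k t \<ge> 0" for t using f by (simp add: k_def)
    have nn: "(\<integral>\<^sup>+ t. ennreal (k t) \<partial>lborel) = ennreal (enn2real (tail f (v\<^sup>2 + c)))"
    proof -
      have "ennreal (k t) = ennreal (\<bar>t\<bar> / 2 * f (t\<^sup>2 + c)) * indicator {\<bar>v\<bar>..} \<bar>t\<bar>" for t
        by (simp add: k_def split: split_indicator)
      then show ?thesis using tail_square[of f c v] f tail_fin[OF that] by (simp only:) simp
    qed
    have ki: "integrable lborel k"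
      using nn k0 by (intro integrableI_bounded) auto
    have G: "G t v = h' v * k t" for t by (simp add: G_def k_def mult_ac)
    show "integrable lborel (\<lambda>t. G t v)" using ki by (simp add: G)
    show "(LINT t|lborel. G t v) = h' v * enn2real (tail f (v\<^sup>2 + c))"
      using nn k0 by (simp add: G integral_eq_nn_integral)
    show "(\<integral>\<^sup>+ t. ennreal (norm (G t v)) \<partial>lborel) = ennreal (norm (h' v * enn2real (tail f (v\<^sup>2 + c))))"
      using nn k0 by (simp add: G abs_mult ennreal_mult nn_integral_cmult)
  qed
  have ne: "AE v::real in lborel. v \<noteq> 0" using AE_lborel_singleton[of 0] by simp
  have G_int: "integrable (lborel \<Otimes>\<^sub>M lborel) (\<lambda>(t, v). G t v)"
  proof (rule integrableI_bounded)
    have "(\<integral>\<^sup>+ z. ennreal (norm (case z of (t, v) \<Rightarrow> G t v)) \<partial>(lborel \<Otimes>\<^sub>M lborel))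
      = (\<integral>\<^sup>+ v. (\<integral>\<^sup>+ t. ennreal (norm (G t v)) \<partial>lborel) \<partial>lborel)"
      by (subst lborel_pair.nn_integral_snd[symmetric]) (simp_all add: case_prod_beta)
    also have "\<dots> = (\<integral>\<^sup>+ v. ennreal (norm (h' v * enn2real (tail f (v\<^sup>2 + c)))) \<partial>lborel)"
      by (rule nn_integral_cong_AE) (use ne Gt(3) in \<open>auto elim!: eventually_mono\<close>)
    also have "\<dots> < \<infinity>" using int(2) by (simp only: integrable_iff_bounded)
    finally show "(\<integral>\<^sup>+ z. ennreal (norm (case z of (t, v) \<Rightarrow> G t v)) \<partial>(lborel \<Otimes>\<^sub>M lborel)) < \<infinity>" .
  qed (simp add: case_prod_beta)
  have Gv: "(LINT v|lborel. G t v) = t / 2 * f (t\<^sup>2 + c) * (h t - h (- t))" for t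
  proof -
    define b where "b = \<bar>t\<bar>"
    have b: "b \<ge> 0" by (simp add: b_def)
    have "(h' has_integral (h b - h (- b))) {- b..b}"
      using S b by (intro fundamental_theorem_of_calculus_strong[OF S(1)])
        (auto simp: has_real_derivative_iff_has_vector_derivative intro: continuous_on_subset[OF h])
    moreover have si: "set_integrable lborel {- b..b} h'"
      unfolding set_integrable_def
    proof (rule integrableI_bounded_set_indicator[where B = C, unfolded scaleR_scaleR])
      show "AE x\<in>{- b..b} in lborel. norm (h' x) \<le> C" using bound by simp
    qed (use b in auto)
    ultimately have "(LINT v:{- b..b}|lborel. h' v) = h b - h (- b)"
      using set_borel_integral_eq_integral(2)[OF si] by (simp add: integral_unique)
    moreover have "G t v = b / 2 * f (t\<^sup>2 + c) * (indicator {- b..b} v *\<^sub>R h' v)" for v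
      by (auto simp: G_def b_def split: split_indicator)
    ultimately have "(LINT v|lborel. G t v) = b / 2 * f (t\<^sup>2 + c) * (h b - h (- b))"
      by (simp only: set_lebesgue_integral_def integral_mult_right_zero)
    also have "b * (h b - h (- b)) = t * (h t - h (- t))"
      by (simp add: b_def abs_if algebra_simps)
    then have "b / 2 * f (t\<^sup>2 + c) * (h b - h (- b)) = t / 2 * f (t\<^sup>2 + c) * (h t - h (- t))"
      by (simp add: mult_ac)
    finally show ?thesis .
  qed
  have refl: "integrable lborel (\<lambda>t. (- t) * h (- t) * f (t\<^sup>2 + c))"
      "(LINT t|lborel. (- t) * h (- t) * f (t\<^sup>2 + c)) = (LINT t|lborel. t * h t * f (t\<^sup>2 + c))"
    using lborel_integrable_real_affine[OF int(1), of "-1" 0]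
      lborel_integral_real_affine[of "-1" "\<lambda>t. t * h t * f (t\<^sup>2 + c)" 0] by simp_all
  have "(LINT t|lborel. t * h t * f (t\<^sup>2 + c))
     = (LINT t|lborel. (1/2) * (t * h t * f (t\<^sup>2 + c)) + (1/2) * ((- t) * h (- t) * f (t\<^sup>2 + c)))"
    using int(1) refl by (subst Bochner_Integration.integral_add) simp_all
  also have "\<dots> = (LINT t|lborel. (LINT v|lborel. G t v))"
    by (intro Bochner_Integration.integral_cong) (simp_all add: Gv algebra_simps)
  also have "\<dots> = (LINT v|lborel. (LINT t|lborel. G t v))"
    by (rule lborel_pair.Fubini_integral[OF G_int, symmetric])
  also have "\<dots> = (LINT v|lborel. h' v * enn2real (tail f (v\<^sup>2 + c)))"
  proof (rule integral_cong_AE)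
    show "(\<lambda>v. LINT t|lborel. G t v) \<in> borel_measurable lborel"
      by (rule lborel.borel_measurable_lebesgue_integral) (simp add: G_def indicator_def case_prod_beta)
    show "AE v in lborel. (LINT t|lborel. G t v) = h' v * enn2real (tail f (v\<^sup>2 + c))"
      using ne by eventually_elim (rule Gt(2))
  qed measurable
  finally show ?thesis .
qed

lemma line_decomposition:
  fixes u \<theta> v :: "'a::euclidean_space"
  assumes v: "v \<bullet> v = 1"
  defines "b \<equiv> (u - \<theta>) \<bullet> v"
  shows "(u + (t - b) *\<^sub>R v - \<theta>) \<bullet> v = t"
    and "(norm (u + (t - b) *\<^sub>R v - \<theta>))\<^sup>2 = t\<^sup>2 + (norm (u - \<theta> - b *\<^sub>R v))\<^sup>2"
proof -
  define z where "z = u - \<theta> - b *\<^sub>R v"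
  have z: "z \<bullet> v = 0" using v by (simp add: z_def b_def inner_diff_left)
  have eq: "u + (t - b) *\<^sub>R v - \<theta> = z + t *\<^sub>R v" by (simp add: z_def algebra_simps)
  show "(u + (t - b) *\<^sub>R v - \<theta>) \<bullet> v = t" unfolding eq using z v by (simp add: inner_add_left)
  show "(norm (u + (t - b) *\<^sub>R v - \<theta>))\<^sup>2 = t\<^sup>2 + (norm (u - \<theta> - b *\<^sub>R v))\<^sup>2"
    unfolding eq z_def[symmetric] power2_norm_eq_inner using z v
    by (simp add: inner_add_left inner_add_right inner_commute power2_eq_square)
qed

text \<open>The right-hand side is the same for every unit vector \<open>v\<close>, so all
  coordinates share one second moment. This ties the risk of \<open>X\<close> to the total integral
  of the tail.\<close>

lemma stein_nn:
  fixes f :: "real \<Rightarrow> real" and \<theta> v :: "'a::euclidean_space"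
  assumes [measurable]: "f \<in> borel_measurable borel" and f: "\<And>t. f t \<ge> 0" and v: "v \<bullet> v = 1"
  shows "(\<integral>\<^sup>+ y. ennreal (((y - \<theta>) \<bullet> v)\<^sup>2 * f ((norm (y - \<theta>))\<^sup>2)) \<partial>lborel)
    = (\<integral>\<^sup>+ y. tail f ((norm (y - \<theta>))\<^sup>2) \<partial>lborel)"
proof -
  have "(\<integral>\<^sup>+ t. ennreal (((u + t *\<^sub>R v - \<theta>) \<bullet> v)\<^sup>2 * f ((norm (u + t *\<^sub>R v - \<theta>))\<^sup>2)) \<partial>lborel)
    = (\<integral>\<^sup>+ t. tail f ((norm (u + t *\<^sub>R v - \<theta>))\<^sup>2) \<partial>lborel)" for u
  proof -
    define b where "b = (u - \<theta>) \<bullet> v"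
    have shift: "(\<integral>\<^sup>+ t. g t \<partial>lborel) = (\<integral>\<^sup>+ t. g (t - b) \<partial>lborel)"
      if "g \<in> borel_measurable borel" for g :: "real \<Rightarrow> ennreal"
      using nn_integral_real_affine[OF that, of 1 "- b"] by simp
    show ?thesis
      by (subst (1 2) shift) (simp_all add: line_decomposition[OF v] b_def stein_line_nn f)
  qed
  then show ?thesis by (subst (1 2) nn_integral_lines[OF _ v]) simp_all
qed

lemma stein:
  fixes f :: "real \<Rightarrow> real" and \<theta> v :: "'a::euclidean_space" and k k' :: "'a \<Rightarrow> real"
  assumes [measurable]: "f \<in> borel_measurable borel" and f: "\<And>t. f t \<ge> 0" and v: "v \<bullet> v = 1"
    and fin: "\<And>q. q > 0 \<Longrightarrow> tail f q < \<infinity>"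
    and [measurable]: "k \<in> borel_measurable borel" "k' \<in> borel_measurable borel"
    and bound: "\<And>y. \<bar>k' y\<bar> \<le> C"
    and lines: "AE u in lborel. continuous_on UNIV (\<lambda>t. k (u + t *\<^sub>R v)) \<and>
      (\<exists>S. finite S \<and> (\<forall>t. t \<notin> S \<longrightarrow> ((\<lambda>t. k (u + t *\<^sub>R v)) has_real_derivative k' (u + t *\<^sub>R v)) (at t)))"
    and int: "integrable lborel (\<lambda>y. ((y - \<theta>) \<bullet> v) * k y * f ((norm (y - \<theta>))\<^sup>2))"
      "integrable lborel (\<lambda>y. k' y * enn2real (tail f ((norm (y - \<theta>))\<^sup>2)))"
  shows "(LINT y|lborel. ((y - \<theta>) \<bullet> v) * k y * f ((norm (y - \<theta>))\<^sup>2))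
    = (LINT y|lborel. k' y * enn2real (tail f ((norm (y - \<theta>))\<^sup>2)))"
proof -
  define A where "A y = ((y - \<theta>) \<bullet> v) * k y * f ((norm (y - \<theta>))\<^sup>2)" for y
  define B where "B y = k' y * enn2real (tail f ((norm (y - \<theta>))\<^sup>2))" for y
  have [measurable]: "A \<in> borel_measurable borel" "B \<in> borel_measurable borel"
    unfolding A_def[abs_def] B_def[abs_def] by measurable
  have iA: "integrable lborel A" and iB: "integrable lborel B"
    using int by (simp_all add: A_def[abs_def] B_def[abs_def])
  have line_int: "AE u in lborel. u \<bullet> v \<in> {0..1} \<longrightarrow> integrable lborel (\<lambda>t. g (u + t *\<^sub>R v))"
    if g: "integrable lborel g" for g :: "'a \<Rightarrow> real"
  proof -
    have [measurable]: "g \<in> borel_measurable borel" using borel_measurable_integrable[OF g] by simp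
    have "(\<integral>\<^sup>+ u. indicator {0..1} (u \<bullet> v) * (\<integral>\<^sup>+ t. ennreal (norm (g (u + t *\<^sub>R v))) \<partial>lborel) \<partial>lborel) < \<infinity>"
      using g by (subst nn_integral_lines[OF _ v, symmetric]) (auto simp: integrable_iff_bounded)
    then have "AE u in lborel. indicator {0..1} (u \<bullet> v) * (\<integral>\<^sup>+ t. ennreal (norm (g (u + t *\<^sub>R v))) \<partial>lborel) \<noteq> \<infinity>"
      by (intro nn_integral_PInf_AE) auto
    then show ?thesis
      by eventually_elim (auto simp: integrable_iff_bounded less_top)
  qed
  \<comment> \<open>The decomposition into lines is stated for nonnegative functions, so equality of
    the two signed integrals on a line is recast as equality of the integrals of the positive and
    negative parts of \<open>A - B\<close>.\<close>
  have "AE u in lborel. indicator {0..1} (u \<bullet> v) * (\<integral>\<^sup>+ t. ennreal (A (u + t *\<^sub>R v) - B (u + t *\<^sub>R v)) \<partial>lborel)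
      = indicator {0..1} (u \<bullet> v) * (\<integral>\<^sup>+ t. ennreal (B (u + t *\<^sub>R v) - A (u + t *\<^sub>R v)) \<partial>lborel)"
    using lines line_int[OF iA] line_int[OF iB]
  proof eventually_elim
    case (elim u)
    show ?case
    proof (cases "u \<bullet> v \<in> {0..1}")
      case True
      define b where "b = (u - \<theta>) \<bullet> v"
      define c where "c = (norm (u - \<theta> - b *\<^sub>R v))\<^sup>2"
      define h where "h t = k (u + (t - b) *\<^sub>R v)" for t
      define h' where "h' t = k' (u + (t - b) *\<^sub>R v)" for t
      have AB: "integrable lborel (\<lambda>t. A (u + t *\<^sub>R v))" "integrable lborel (\<lambda>t. B (u + t *\<^sub>R v))"
        using True elim by auto
      have A_eq: "A (u + (t - b) *\<^sub>R v) = t * h t * f (t\<^sup>2 + c)"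
        and B_eq: "B (u + (t - b) *\<^sub>R v) = h' t * enn2real (tail f (t\<^sup>2 + c))" for t
        unfolding A_def B_def h_def h'_def c_def b_def line_decomposition[OF v] by simp_all
      from elim obtain S where S: "finite S"
        "\<And>t. t \<notin> S \<Longrightarrow> ((\<lambda>t. k (u + t *\<^sub>R v)) has_real_derivative k' (u + t *\<^sub>R v)) (at t)" by auto
      have "(LINT t|lborel. t * h t * f (t\<^sup>2 + c)) = (LINT t|lborel. h' t * enn2real (tail f (t\<^sup>2 + c)))"
      proof (rule stein_line[where S = "(\<lambda>t. t + b) ` S" and C = C])
        have "continuous_on UNIV ((\<lambda>t. k (u + t *\<^sub>R v)) \<circ> (\<lambda>t. t - b))"
          using elim by (intro continuous_on_compose continuous_intros) (auto intro: continuous_on_subset)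
        then show "continuous_on UNIV h" by (simp add: h_def[abs_def] comp_def)
        show "(h has_real_derivative h' t) (at t)" if "t \<notin> (\<lambda>t. t + b) ` S" for t
        proof -
          have "t - b \<notin> S" using that by (metis diff_add_cancel image_eqI)
          have "((\<lambda>t. t - b) has_real_derivative 1) (at t)" by (auto intro!: derivative_eq_intros)
          from DERIV_chain2[where f = "\<lambda>t. k (u + t *\<^sub>R v)" and g = "\<lambda>t. t - b", OF S(2)[OF \<open>t - b \<notin> S\<close>] this]
          show ?thesis by (simp add: h_def[abs_def] h'_def)
        qed
        show "integrable lborel (\<lambda>t. t * h t * f (t\<^sup>2 + c))"
          using lborel_integrable_real_affine[OF AB(1), of 1 "- b"] by (simp flip: A_eq)
        show "integrable lborel (\<lambda>t. h' t * enn2real (tail f (t\<^sup>2 + c)))"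
          using lborel_integrable_real_affine[OF AB(2), of 1 "- b"] by (simp flip: B_eq)
        show "h' \<in> borel_measurable borel" unfolding h'_def[abs_def] by measurable
      qed (use f fin bound S in \<open>auto simp: c_def h'_def\<close>)
      then have "(LINT t|lborel. A (u + t *\<^sub>R v)) = (LINT t|lborel. B (u + t *\<^sub>R v))"
        using lborel_integral_real_affine[of 1 "\<lambda>t. A (u + t *\<^sub>R v)" "- b"]
          lborel_integral_real_affine[of 1 "\<lambda>t. B (u + t *\<^sub>R v)" "- b"] by (simp add: A_eq B_eq)
      then have "(LINT t|lborel. A (u + t *\<^sub>R v) - B (u + t *\<^sub>R v)) = 0" using AB by simp
      moreover define p q where "p = (\<integral>\<^sup>+ t. ennreal (A (u + t *\<^sub>R v) - B (u + t *\<^sub>R v)) \<partial>lborel)"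
        and "q = (\<integral>\<^sup>+ t. ennreal (- (A (u + t *\<^sub>R v) - B (u + t *\<^sub>R v))) \<partial>lborel)"
      ultimately have eq: "enn2real p = enn2real q"
        using AB real_lebesgue_integral_def[of lborel "\<lambda>t. A (u + t *\<^sub>R v) - B (u + t *\<^sub>R v)"] by simp
      have "integrable lborel (\<lambda>t. A (u + t *\<^sub>R v) - B (u + t *\<^sub>R v))" using AB by simp
      then have "p \<noteq> \<infinity>" "q \<noteq> \<infinity>" unfolding p_def q_def real_integrable_def by auto
      then have "p = ennreal (enn2real p)" "q = ennreal (enn2real q)" by (simp_all add: less_top)
      then have "p = q" using eq by simp
      then show ?thesis by (simp add: p_def q_def)
    qed simp
  qed
  then have "(\<integral>\<^sup>+ u. ennreal (A u - B u) \<partial>lborel) = (\<integral>\<^sup>+ u. ennreal (B u - A u) \<partial>lborel)"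
    by (subst (1 2) nn_integral_lines[OF _ v]) (auto intro!: nn_integral_cong_AE)
  moreover have "(LINT u|lborel. A u - B u)
      = enn2real (\<integral>\<^sup>+ u. ennreal (A u - B u) \<partial>lborel) - enn2real (\<integral>\<^sup>+ u. ennreal (- (A u - B u)) \<partial>lborel)"
    using iA iB by (intro real_lebesgue_integral_def) auto
  ultimately have "(LINT u|lborel. A u - B u) = 0" by simp
  then have "(LINT u|lborel. A u) = (LINT u|lborel. B u)" using iA iB by simp
  then show ?thesis by (simp add: A_def B_def)
qed

section \<open>Risk comparison\<close>

lemma AE_lborel_hyperplane:
  fixes a :: "'a::euclidean_space"
  assumes "a \<noteq> 0"
  shows "AE y in lborel. a \<bullet> y \<noteq> 0"
proof -
  have "{y. a \<bullet> y = 0} \<in> null_sets lebesgue"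
    using negligible_hyperplane[of a 0] assms by (simp add: negligible_iff_null_sets)
  moreover have "{y. a \<bullet> y = 0} \<in> sets lborel" by (simp add: closed_hyperplane borel_closed)
  ultimately have "{y. a \<bullet> y = 0} \<in> null_sets lborel"
    using null_sets_completion_iff by blast
  then show ?thesis by (rule AE_I'[where N = "{y. a \<bullet> y = 0}"]) auto
qed

lemma AE_lborel_pair_nonzero:
  "AE y in (lborel :: ('a::euclidean_space \<times> 'b::euclidean_space) measure). fst y \<noteq> 0 \<and> snd y \<noteq> 0"
proof -
  obtain i :: 'a where "i \<in> Basis" using nonempty_Basis by blast
  moreover obtain j :: 'b where "j \<in> Basis" using nonempty_Basis by blast
  ultimately have "(i, 0::'b) \<noteq> 0" "(0::'a, j) \<noteq> 0" by (auto simp: zero_prod_def)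
  from AE_lborel_hyperplane[OF this(1)] AE_lborel_hyperplane[OF this(2)] show ?thesis
    by eventually_elim (auto simp: inner_prod_def)
qed

text \<open>Nothing is known about \<open>q\<close> at 0 except boundedness. A line can meet the
  origin only at \<open>t = - (x \<bullet> i)\<close>, and there the linear factor vanishes, so the
  product stays continuous.\<close>

lemma radial_field_line:
  fixes x i :: "'a::euclidean_space" and q q' :: "real \<Rightarrow> real"
  assumes i: "i \<bullet> i = 1" and q: "\<And>\<tau>. \<tau> > 0 \<Longrightarrow> (q has_real_derivative q' \<tau>) (at \<tau>)"
    and bound: "\<And>\<tau>. \<bar>q \<tau>\<bar> \<le> C"
  defines "k \<equiv> \<lambda>t. ((x + t *\<^sub>R i) \<bullet> i) * q ((norm (x + t *\<^sub>R i))\<^sup>2)"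
  shows "continuous_on UNIV k"
    and "\<exists>S. finite S \<and> (\<forall>t. t \<notin> S \<longrightarrow> x + t *\<^sub>R i \<noteq> 0 \<and> (k has_real_derivative
      q ((norm (x + t *\<^sub>R i))\<^sup>2) + 2 * ((x + t *\<^sub>R i) \<bullet> i)\<^sup>2 * q' ((norm (x + t *\<^sub>R i))\<^sup>2)) (at t))"
proof -
  define N where "N t = (norm (x + t *\<^sub>R i))\<^sup>2" for t
  define L where "L t = (x + t *\<^sub>R i) \<bullet> i" for t
  have k: "k = (\<lambda>t. L t * q (N t))" by (simp add: k_def N_def L_def)
  have N: "N t = x \<bullet> x + 2 * t * (x \<bullet> i) + t\<^sup>2" for t
    unfolding N_def power2_norm_eq_inner using i
    by (simp add: inner_add_left inner_add_right inner_commute power2_eq_square)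
  have L: "L t = x \<bullet> i + t" for t using i by (simp add: L_def inner_add_left)
  have dL: "(L has_real_derivative 1) (at t)" for t
    unfolding L[abs_def] by (auto intro!: derivative_eq_intros)
  have dN: "(N has_real_derivative 2 * L t) (at t)" for t
    unfolding N[abs_def] L by (auto intro!: derivative_eq_intros)
  have dk: "(k has_real_derivative q (N t) + 2 * (L t)\<^sup>2 * q' (N t)) (at t)" if "x + t *\<^sub>R i \<noteq> 0" for t
  proof -
    have "N t > 0" using that by (simp add: N_def)
    from DERIV_chain2[OF q[OF this] dN]
    have "((\<lambda>t. q (N t)) has_real_derivative q' (N t) * (2 * L t)) (at t)" .
    from DERIV_mult[OF dL this] show ?thesis
      unfolding k by (rule DERIV_cong) (simp add: power2_eq_square)
  qed
  show "continuous_on UNIV k"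
  proof (rule continuous_at_imp_continuous_on, rule ballI)
    fix t :: real
    show "isCont k t"
    proof (cases "x + t *\<^sub>R i = 0")
      case False
      then show ?thesis using dk DERIV_isCont by blast
    next
      case True
      then have L0: "L t = 0" by (simp add: L_def)
      have "(L \<longlongrightarrow> 0) (at t)" using DERIV_isCont[OF dL, of t] L0 by (simp add: isCont_def)
      then have "((\<lambda>t. C * \<bar>L t\<bar>) \<longlongrightarrow> 0) (at t)"
        by (auto intro!: tendsto_eq_intros tendsto_rabs_zero)
      moreover have "\<forall>\<^sub>F s in at t. norm (k s) \<le> C * \<bar>L s\<bar>"
        using mult_right_mono[OF bound, of "\<bar>L s\<bar>" for s] by (simp add: k abs_mult mult.commute)
      ultimately have "(k \<longlongrightarrow> 0) (at t)" by (rule Lim_null_comparison[rotated])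
      then show ?thesis by (simp add: isCont_def k L0)
    qed
  qed
  have "x + t *\<^sub>R i \<noteq> 0" if "t \<notin> {- (x \<bullet> i)}" for t
  proof
    assume "x + t *\<^sub>R i = 0"
    then have "L t = 0" by (simp add: L_def)
    then show False using that by (simp add: L)
  qed
  then show "\<exists>S. finite S \<and> (\<forall>t. t \<notin> S \<longrightarrow> x + t *\<^sub>R i \<noteq> 0 \<and> (k has_real_derivative
      q ((norm (x + t *\<^sub>R i))\<^sup>2) + 2 * ((x + t *\<^sub>R i) \<bullet> i)\<^sup>2 * q' ((norm (x + t *\<^sub>R i))\<^sup>2)) (at t))"
    using dk unfolding N_def L_def by (intro exI[of _ "{- (x \<bullet> i)}"]) auto
qed

text \<open>The tail is decreasing, so an infinite value at \<open>q\<close> would spread over the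
  ball of radius \<open>sqrt q\<close>, which has positive volume.\<close>

lemma tail_finite:
  fixes \<theta> :: "'a::euclidean_space"
  assumes [measurable]: "g \<in> borel_measurable borel"
    and fin: "(\<integral>\<^sup>+ y. tail g ((norm (y - \<theta>))\<^sup>2) \<partial>lborel) < \<infinity>" and q: "q > 0"
  shows "tail g q < \<infinity>"
proof (rule ccontr)
  assume "\<not> tail g q < \<infinity>"
  then have top: "tail g q = \<infinity>" by (simp add: top.not_eq_extremum[symmetric])
  have "AE y in lborel. tail g ((norm (y - \<theta>))\<^sup>2) \<noteq> \<infinity>"
    using fin by (intro nn_integral_PInf_AE) auto
  then have "AE y in lborel. y \<notin> ball \<theta> (sqrt q)"
  proof eventually_elim
    case (elim y)
    show ?case
    proof
      assume "y \<in> ball \<theta> (sqrt q)"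
      then have "norm (y - \<theta>) < sqrt q" by (simp add: dist_norm norm_minus_commute)
      then have "(norm (y - \<theta>))\<^sup>2 \<le> q" using real_less_rsqrt q
        by (metis less_eq_real_def norm_ge_zero power_mono real_sqrt_pow2)
      then show False using tail_antimono[of "(norm (y - \<theta>))\<^sup>2" q g] top elim by (simp add: top_unique)
    qed
  qed
  then have "emeasure lborel (ball \<theta> (sqrt q)) = 0"
    by (subst (asm) AE_iff_measurable[where N = "ball \<theta> (sqrt q)"]) auto
  then show False using q unit_ball_vol_pos[of "real DIM('a)"] by (simp add: emeasure_ball)
qed

text \<open>The two growth bounds match the two sides: a field of linear growth is integrable
  against the second moment of \<open>g\<close>, a bounded derivative against the tail.\<close>

lemma stein_linear_growth:
  fixes g :: "real \<Rightarrow> real" and \<theta> v :: "'a::euclidean_space" and k k' :: "'a \<Rightarrow> real"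
  assumes [measurable]: "g \<in> borel_measurable borel" and g: "\<And>t. g t \<ge> 0" and v: "v \<bullet> v = 1"
    and fin: "(\<integral>\<^sup>+ y. tail g ((norm (y - \<theta>))\<^sup>2) \<partial>lborel) < \<infinity>"
    and mom: "integrable lborel (\<lambda>y. (norm (y - \<theta>))\<^sup>2 * g ((norm (y - \<theta>))\<^sup>2))"
    and [measurable]: "k \<in> borel_measurable borel" "k' \<in> borel_measurable borel"
    and bound: "\<And>y. \<bar>k y\<bar> \<le> C * norm (y - \<theta>)" "\<And>y. \<bar>k' y\<bar> \<le> C'"
    and lines: "AE u in lborel. continuous_on UNIV (\<lambda>t. k (u + t *\<^sub>R v)) \<and>
      (\<exists>S. finite S \<and> (\<forall>t. t \<notin> S \<longrightarrow> ((\<lambda>t. k (u + t *\<^sub>R v)) has_real_derivative k' (u + t *\<^sub>R v)) (at t)))"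
  shows "integrable lborel (\<lambda>y. ((y - \<theta>) \<bullet> v) * k y * g ((norm (y - \<theta>))\<^sup>2))"
    and "integrable lborel (\<lambda>y. k' y * enn2real (tail g ((norm (y - \<theta>))\<^sup>2)))"
    and "(LINT y|lborel. ((y - \<theta>) \<bullet> v) * k y * g ((norm (y - \<theta>))\<^sup>2))
      = (LINT y|lborel. k' y * enn2real (tail g ((norm (y - \<theta>))\<^sup>2)))"
proof -
  have "norm v = 1" using v by (simp add: norm_eq_1)
  show A: "integrable lborel (\<lambda>y. ((y - \<theta>) \<bullet> v) * k y * g ((norm (y - \<theta>))\<^sup>2))"
  proof (rule Bochner_Integration.integrable_bound[where f = "\<lambda>y. C * ((norm (y - \<theta>))\<^sup>2 * g ((norm (y - \<theta>))\<^sup>2))"])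
    show "integrable lborel (\<lambda>y. C * ((norm (y - \<theta>))\<^sup>2 * g ((norm (y - \<theta>))\<^sup>2)))" using mom by simp
    show "AE y in lborel. norm (((y - \<theta>) \<bullet> v) * k y * g ((norm (y - \<theta>))\<^sup>2))
        \<le> norm (C * ((norm (y - \<theta>))\<^sup>2 * g ((norm (y - \<theta>))\<^sup>2)))"
    proof (rule AE_I2)
      fix y
      have "\<bar>(y - \<theta>) \<bullet> v\<bar> \<le> norm (y - \<theta>)"
        using Cauchy_Schwarz_ineq2[of "y - \<theta>" v] \<open>norm v = 1\<close> by simp
      then have "\<bar>(y - \<theta>) \<bullet> v\<bar> * \<bar>k y\<bar> \<le> norm (y - \<theta>) * (C * norm (y - \<theta>))"
        using bound(1) by (intro mult_mono) auto
      then have "\<bar>(y - \<theta>) \<bullet> v\<bar> * \<bar>k y\<bar> * g ((norm (y - \<theta>))\<^sup>2) \<le> C * (norm (y - \<theta>))\<^sup>2 * g ((norm (y - \<theta>))\<^sup>2)"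
        using g by (intro mult_right_mono) (auto simp: power2_eq_square mult_ac)
      also have "\<dots> \<le> \<bar>C * (norm (y - \<theta>))\<^sup>2 * g ((norm (y - \<theta>))\<^sup>2)\<bar>" by simp
      finally show "norm (((y - \<theta>) \<bullet> v) * k y * g ((norm (y - \<theta>))\<^sup>2))
        \<le> norm (C * ((norm (y - \<theta>))\<^sup>2 * g ((norm (y - \<theta>))\<^sup>2)))"
        using g by (simp add: abs_mult mult.assoc)
    qed
  qed measurable
  have "integrable lborel (\<lambda>y. enn2real (tail g ((norm (y - \<theta>))\<^sup>2)))"
  proof (rule integrableI_bounded)
    have "(\<integral>\<^sup>+ y. ennreal (norm (enn2real (tail g ((norm (y - \<theta>))\<^sup>2)))) \<partial>lborel) \<le> (\<integral>\<^sup>+ y. tail g ((norm (y - \<theta>))\<^sup>2) \<partial>lborel)"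
      by (intro nn_integral_mono) (auto simp: ennreal_enn2real_if)
    then show "(\<integral>\<^sup>+ y. ennreal (norm (enn2real (tail g ((norm (y - \<theta>))\<^sup>2)))) \<partial>lborel) < \<infinity>"
      using fin by (rule le_less_trans)
  qed measurable
  then have "integrable lborel (\<lambda>y. C' * enn2real (tail g ((norm (y - \<theta>))\<^sup>2)))"
    using integrable_mult_right[of C' lborel "\<lambda>y. enn2real (tail g ((norm (y - \<theta>))\<^sup>2))"] by metis
  then show B: "integrable lborel (\<lambda>y. k' y * enn2real (tail g ((norm (y - \<theta>))\<^sup>2)))"
  proof (rule Bochner_Integration.integrable_bound)
    show "AE y in lborel. norm (k' y * enn2real (tail g ((norm (y - \<theta>))\<^sup>2)))
        \<le> norm (C' * enn2real (tail g ((norm (y - \<theta>))\<^sup>2)))"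
    proof (rule AE_I2)
      fix y
      have "\<bar>k' y\<bar> \<le> \<bar>C'\<bar>" using bound(2)[of y] by simp
      then show "norm (k' y * enn2real (tail g ((norm (y - \<theta>))\<^sup>2)))
        \<le> norm (C' * enn2real (tail g ((norm (y - \<theta>))\<^sup>2)))"
        unfolding real_norm_def abs_mult by (rule mult_right_mono) simp
    qed
  qed measurable
  show "(LINT y|lborel. ((y - \<theta>) \<bullet> v) * k y * g ((norm (y - \<theta>))\<^sup>2))
      = (LINT y|lborel. k' y * enn2real (tail g ((norm (y - \<theta>))\<^sup>2)))"
    using g v tail_finite[OF assms(1) fin] bound(2) lines A B by (intro stein) auto
qed

text \<open>The field \<open>x r(w)\<close> has x-divergence \<open>p r + 2 w r'\<close>, and
  \<open>z \<psi>(w)\<close> with \<open>\<psi> = w r\<^sup>2\<close> has z-divergence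
  \<open>n \<psi> - 2 w \<psi>'\<close>, where p and n are the two dimensions. \<open>ineq\<close>
  says pointwise that the second is at most twice the first.\<close>

lemma shrinkage_risk_le:
  fixes r r' g :: "real \<Rightarrow> real" and \<theta> :: "'a::euclidean_space" and s :: "'a \<times> 'b::euclidean_space \<Rightarrow> real"
  assumes g_meas [measurable]: "g \<in> borel_measurable borel" and g: "\<And>t. g t \<ge> 0"
    and r: "\<And>w. w > 0 \<Longrightarrow> 0 < r w" "\<And>w. w > 0 \<Longrightarrow> r w < 1"
    and deriv: "\<And>w. w > 0 \<Longrightarrow> (r has_real_derivative r' w) (at w)"
    and C: "C \<ge> 1" "\<And>w. w > 0 \<Longrightarrow> w * r w \<le> C" "\<And>w. w > 0 \<Longrightarrow> \<bar>w * r' w\<bar> \<le> C"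
    and ineq: "\<And>w. w > 0 \<Longrightarrow> (real DIM('b) - 2) * (w * (r w)\<^sup>2) - 4 * (w * r w) * (w * r' w)
      \<le> 2 * (real DIM('a) * r w + 2 * (w * r' w))"
    and s_def: "\<And>y. s y = (if fst y \<noteq> 0 \<and> snd y \<noteq> 0 then r ((norm (fst y))\<^sup>2 / (norm (snd y))\<^sup>2) else 0)"
  shows "(\<integral>\<^sup>+ y. ennreal ((norm (fst y - s y *\<^sub>R fst y - \<theta>))\<^sup>2 * g ((norm (y - (\<theta>, 0)))\<^sup>2)) \<partial>lborel)
    \<le> (\<integral>\<^sup>+ y. ennreal ((norm (fst y - \<theta>))\<^sup>2 * g ((norm (y - (\<theta>, 0)))\<^sup>2)) \<partial>(lborel :: ('a \<times> 'b) measure))"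
    (is "?RD \<le> ?RX")
proof (cases "?RX = \<infinity>")
  case False
  define \<Theta> :: "'a \<times> 'b" where "\<Theta> = (\<theta>, 0)"
  define G where "G y = g ((norm (y - \<Theta>))\<^sup>2)" for y
  define F where "F y = enn2real (tail g ((norm (y - \<Theta>))\<^sup>2))" for y
  have G0: "G y \<ge> 0" for y using g by (simp add: G_def)
  have [measurable]: "G \<in> borel_measurable borel" "F \<in> borel_measurable borel"
    unfolding G_def[abs_def] F_def[abs_def] by measurable
  have unit1: "(i, 0::'b) \<bullet> (i, 0) = 1" if "i \<in> Basis" for i :: 'a using that by (simp add: inner_prod_def)
  have unit2: "(0::'a, j) \<bullet> (0, j) = 1" if "j \<in> Basis" for j :: 'b using that by (simp add: inner_prod_def)
  define T where "T = (\<integral>\<^sup>+ y. tail g ((norm (y - \<Theta>))\<^sup>2) \<partial>lborel)"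
  have sq: "(norm a)\<^sup>2 = (\<Sum>i\<in>Basis. (a \<bullet> i)\<^sup>2)" for a :: "'c::euclidean_space"
    unfolding power2_norm_eq_inner by (subst euclidean_inner) (simp add: power2_eq_square)
  have mom1: "(\<integral>\<^sup>+ y. ennreal ((norm (fst y - \<theta>))\<^sup>2 * G y) \<partial>lborel) = of_nat DIM('a) * T"
  proof -
    have "(\<integral>\<^sup>+ y. ennreal ((norm (fst y - \<theta>))\<^sup>2 * G y) \<partial>lborel)
      = (\<integral>\<^sup>+ y. (\<Sum>i\<in>Basis. ennreal (((y - \<Theta>) \<bullet> (i, 0))\<^sup>2 * G y)) \<partial>lborel)"
      using G0 by (intro nn_integral_cong) (simp add: sq sum_distrib_right \<Theta>_def inner_prod_def)
    also have "\<dots> = (\<Sum>i\<in>(Basis::'a set). (\<integral>\<^sup>+ y. ennreal (((y - \<Theta>) \<bullet> (i, 0))\<^sup>2 * G y) \<partial>lborel))"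
      by (rule nn_integral_sum) measurable
    also have "\<dots> = (\<Sum>i\<in>(Basis::'a set). T)"
      unfolding T_def G_def by (intro sum.cong refl stein_nn g_meas g unit1)
    finally show ?thesis by simp
  qed
  have mom2: "(\<integral>\<^sup>+ y. ennreal ((norm (snd y))\<^sup>2 * G y) \<partial>lborel) = of_nat DIM('b) * T"
  proof -
    have "(\<integral>\<^sup>+ y. ennreal ((norm (snd y))\<^sup>2 * G y) \<partial>lborel)
      = (\<integral>\<^sup>+ y. (\<Sum>j\<in>Basis. ennreal (((y - \<Theta>) \<bullet> (0, j))\<^sup>2 * G y)) \<partial>lborel)"
      using G0 by (intro nn_integral_cong) (simp add: sq sum_distrib_right \<Theta>_def inner_prod_def)
    also have "\<dots> = (\<Sum>j\<in>(Basis::'b set). (\<integral>\<^sup>+ y. ennreal (((y - \<Theta>) \<bullet> (0, j))\<^sup>2 * G y) \<partial>lborel))"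
      by (rule nn_integral_sum) measurable
    also have "\<dots> = (\<Sum>j\<in>(Basis::'b set). T)"
      unfolding T_def G_def by (intro sum.cong refl stein_nn g_meas g unit2)
    finally show ?thesis by simp
  qed
  \<comment> \<open>The finite risk of \<open>X\<close> is a positive multiple of \<open>T\<close>,
    so \<open>T\<close> is finite, and by \<open>mom2\<close> the second moment of the other block
    is finite as well.\<close>
  have "of_nat DIM('a) * T \<noteq> \<infinity>" using False mom1 by (simp add: G_def \<Theta>_def)
  then have T: "T < \<infinity>" by (auto simp: ennreal_mult_eq_top_iff less_top)
  have [measurable]: "fst \<in> borel_measurable (borel :: ('a \<times> 'b) measure)" "snd \<in> borel_measurable (borel :: ('a \<times> 'b) measure)"
    by (intro borel_measurable_continuous_onI continuous_intros)+
  have int1: "integrable lborel (\<lambda>y. (norm (fst y - \<theta>))\<^sup>2 * G y)"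
    using T G0 by (intro integrableI_bounded, measurable) (simp add: mom1 ennreal_mult_less_top of_nat_less_top)
  have int2: "integrable lborel (\<lambda>y. (norm (snd y))\<^sup>2 * G y)"
    using T G0 by (intro integrableI_bounded, measurable) (simp add: mom2 ennreal_mult_less_top of_nat_less_top)
  have norm_y: "(norm (y - \<Theta>))\<^sup>2 = (norm (fst y - \<theta>))\<^sup>2 + (norm (snd y))\<^sup>2" for y
    by (simp add: \<Theta>_def norm_prod_def)
  have mom: "integrable lborel (\<lambda>y. (norm (y - \<Theta>))\<^sup>2 * g ((norm (y - \<Theta>))\<^sup>2))"
    using Bochner_Integration.integrable_add[OF int1 int2] by (simp add: norm_y G_def distrib_right)
  have le_norm: "norm (snd y) \<le> norm (y - \<Theta>)" for y
    by (rule power2_le_imp_le) (simp_all add: norm_y)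

  define W where "W y = (norm (fst y))\<^sup>2 / (norm (snd y))\<^sup>2" for y :: "'a \<times> 'b"
  \<comment> \<open>Extension by 0 to w \<le> 0 gives total Borel functions. The value at 0 also
    covers points where a component vanishes, since \<open>W\<close> is 0 there (for
    \<open>snd y = 0\<close> by division by zero), in agreement with \<open>s\<close>. The function
    \<open>ee\<close> stands for \<open>w r'\<close>, and \<open>chi\<close> for w times the
    derivative of \<open>psi\<close>.\<close>
  define rr where "rr w = (if w > 0 then r w else 0)" for w
  define ee where "ee w = (if w > 0 then w * r' w else 0)" for w
  define psi where "psi w = w * (rr w)\<^sup>2" for w
  define chi where "chi w = w * (rr w)\<^sup>2 + 2 * (w * rr w) * ee w" for w
  have s: "s y = rr (W y)" for y by (auto simp: s_def rr_def W_def)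
  have "continuous_on {0<..} r"
    using deriv by (intro continuous_at_imp_continuous_on ballI DERIV_isCont) auto
  then have rr_meas [measurable]: "rr \<in> borel_measurable borel"
  proof -
    have "rr = (\<lambda>w. indicator {0<..} w *\<^sub>R r w)" by (auto simp: rr_def fun_eq_iff)
    then show ?thesis
      using borel_measurable_continuous_on_indicator[of "{0<..}" r] \<open>continuous_on {0<..} r\<close> by simp
  qed
  \<comment> \<open>A pointwise limit of difference quotients; the increment
    \<open>w / real (Suc n)\<close> has the sign of \<open>w\<close>, so for w \<le> 0 all quotients
    vanish.\<close>
  have ee_meas [measurable]: "ee \<in> borel_measurable borel"
  proof (rule borel_measurable_LIMSEQ_real)
    fix w :: real
    define X where "X n = w / real (Suc n)" for n
    show "(\<lambda>n. w * (rr (w + w / real (Suc n)) - rr w) / (w / real (Suc n))) \<longlonglongrightarrow> ee w"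
    proof (cases "w > 0")
      case True
      have "X \<longlonglongrightarrow> 0" unfolding X_def using LIMSEQ_Suc[OF tendsto_divide_0[OF tendsto_const filterlim_at_top_imp_at_infinity[OF filterlim_real_sequentially]]] .
      moreover have X: "X n > 0" for n using True by (simp add: X_def)
      moreover have "((\<lambda>h. (r (w + h) - r w) / h) \<longlongrightarrow> r' w) (at 0)" using deriv[OF True] by (simp add: DERIV_def)
      ultimately have "(\<lambda>n. (r (w + X n) - r w) / X n) \<longlonglongrightarrow> r' w"
        unfolding tendsto_at_iff_sequentially comp_def by (metis DiffI UNIV_I less_irrefl singletonD)
      from tendsto_mult_left[OF this, of w] show ?thesis
        unfolding X_def[symmetric] using True add_pos_pos[OF True X] by (simp add: rr_def ee_def)
    next
      case False
      then have "w / real (Suc n) \<le> 0" for n by (intro divide_nonpos_pos) auto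
      then have "\<not> w + w / real (Suc n) > 0" for n using False by (smt (verit))
      then show ?thesis using False by (simp only: rr_def ee_def if_False) simp
    qed
  qed measurable
  have [measurable]: "psi \<in> borel_measurable borel" "chi \<in> borel_measurable borel" "W \<in> borel_measurable borel"
    unfolding psi_def[abs_def] chi_def[abs_def] W_def[abs_def] by measurable
  have rr: "0 \<le> rr w" "rr w \<le> 1" for w using r by (auto simp: rr_def intro: less_imp_le)
  have phi: "0 \<le> w * rr w" "w * rr w \<le> C" for w
    using C(1,2) r(1) by (auto simp: rr_def intro: less_imp_le order_trans[of 0 1])
  have ee: "\<bar>ee w\<bar> \<le> C" for w using C by (auto simp: ee_def)
  have psi: "0 \<le> psi w" "psi w \<le> C" for w
  proof -
    have "w * rr w * rr w \<le> C * 1" using phi rr C(1) by (intro mult_mono) auto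
    then show "psi w \<le> C" by (simp add: psi_def power2_eq_square mult.assoc)
    show "0 \<le> psi w" using phi[of w] rr[of w] by (simp add: psi_def power2_eq_square mult.assoc[symmetric])
  qed
  have chi: "\<bar>chi w\<bar> \<le> C + 2 * C * C" for w
  proof -
    have "\<bar>chi w\<bar> \<le> \<bar>psi w\<bar> + 2 * (\<bar>w * rr w\<bar> * \<bar>ee w\<bar>)"
      unfolding chi_def psi_def using abs_triangle_ineq[of "w * (rr w)\<^sup>2" "2 * (w * rr w) * ee w"]
      by (simp add: abs_mult)
    also have "\<bar>w * rr w\<bar> * \<bar>ee w\<bar> \<le> C * C" using phi[of w] ee[of w] C(1) by (intro mult_mono) auto
    finally show ?thesis using psi[of w] by simp
  qed
  have drr: "(rr has_real_derivative r' w) (at w)" if "w > 0" for w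
    by (rule has_field_derivative_transform_within_open[OF deriv[OF that], of "{0<..}"]) (use that in \<open>auto simp: rr_def\<close>)
  have dpsi: "(psi has_real_derivative chi w / w) (at w)" if "w > 0" for w
    unfolding psi_def[abs_def] using that
    by (auto intro!: derivative_eq_intros drr simp: chi_def ee_def power2_eq_square field_simps)

  define kx where "kx i y = (fst y \<bullet> i) * rr (W y)" for i y
  define kx' where "kx' i y = rr (W y) + 2 * ((fst y \<bullet> i)\<^sup>2 / (norm (fst y))\<^sup>2) * ee (W y)" for i y
  define kz where "kz j y = (snd y \<bullet> j) * psi (W y)" for j y
  define kz' where "kz' j y = psi (W y) - 2 * ((snd y \<bullet> j)\<^sup>2 / (norm (snd y))\<^sup>2) * chi (W y)" for j y
  have quot: "0 \<le> (a \<bullet> i)\<^sup>2 / (norm a)\<^sup>2" "(a \<bullet> i)\<^sup>2 / (norm a)\<^sup>2 \<le> 1" if "i \<in> Basis" for a i :: "'c::euclidean_space"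
    using power_mono[OF Basis_le_norm[OF that, of a], of 2] by (auto simp: divide_le_eq)
  note nz = AE_lborel_pair_nonzero[where 'a = 'a and 'b = 'b]
  have X: "integrable lborel (\<lambda>y. ((y - \<Theta>) \<bullet> (i, 0)) * kx i y * G y)"
    "integrable lborel (\<lambda>y. kx' i y * F y)"
    "(LINT y|lborel. ((y - \<Theta>) \<bullet> (i, 0)) * kx i y * G y) = (LINT y|lborel. kx' i y * F y)"
    if i: "i \<in> Basis" for i
  proof -
    \<comment> \<open>\<open>norm (fst y)\<close> is not bounded by a multiple of
      \<open>norm (y - \<Theta>)\<close>, but the factor \<open>rr\<close> trades it for
      \<open>norm (snd y)\<close>, as
      \<open>|x|\<^sup>2 r\<^sup>2 = |z|\<^sup>2 (w r\<^sup>2)\<close>.\<close>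
    have bx: "\<bar>kx i y\<bar> \<le> C * norm (y - \<Theta>)" for y
    proof (cases "fst y = 0 \<or> snd y = 0")
      case True
      then show ?thesis using C(1) by (auto simp: kx_def rr_def W_def)
    next
      case False
      have "(norm (fst y) * rr (W y))\<^sup>2 = (norm (snd y))\<^sup>2 * psi (W y)"
        using False by (simp add: psi_def W_def power_mult_distrib)
      also have "\<dots> \<le> (norm (snd y))\<^sup>2 * (C * C)"
        using psi[of "W y"] C(1) by (intro mult_left_mono order_trans[OF psi(2)]) auto
      finally have "(norm (fst y) * rr (W y))\<^sup>2 \<le> (C * norm (snd y))\<^sup>2" by (simp add: power2_eq_square mult_ac)
      then have "norm (fst y) * rr (W y) \<le> C * norm (snd y)"
        by (rule power2_le_imp_le) (use C(1) in simp)
      moreover have "\<bar>kx i y\<bar> \<le> norm (fst y) * rr (W y)"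
        using rr Basis_le_norm[OF i, of "fst y"] by (simp add: kx_def abs_mult mult_right_mono)
      moreover have "C * norm (snd y) \<le> C * norm (y - \<Theta>)" using le_norm C(1) by (intro mult_left_mono) auto
      ultimately show ?thesis by linarith
    qed
    have bx': "\<bar>kx' i y\<bar> \<le> 1 + 2 * C" for y
    proof -
      have "\<bar>(fst y \<bullet> i)\<^sup>2 / (norm (fst y))\<^sup>2 * ee (W y)\<bar> \<le> 1 * C"
        unfolding abs_mult using quot[OF i, of "fst y"] ee C(1) by (intro mult_mono) auto
      then show ?thesis using rr[of "W y"] unfolding kx'_def by linarith
    qed
    have lines: "AE u in lborel. continuous_on UNIV (\<lambda>t. kx i (u + t *\<^sub>R (i, 0))) \<and>
      (\<exists>S. finite S \<and> (\<forall>t. t \<notin> S \<longrightarrow> ((\<lambda>t. kx i (u + t *\<^sub>R (i, 0))) has_real_derivative kx' i (u + t *\<^sub>R (i, 0))) (at t)))"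
      using nz
    proof eventually_elim
      case (elim u)
      \<comment> \<open>Along this direction \<open>snd\<close> is constant and nonzero, so
        \<open>W\<close> is a fixed multiple of the squared norm of \<open>fst\<close> and the field
        is radial on the line.\<close>
      define c where "c = (norm (snd u))\<^sup>2"
      have c: "c > 0" using elim by (simp add: c_def)
      define q where "q \<tau> = rr (\<tau> / c)" for \<tau>
      have q: "(q has_real_derivative r' (\<tau> / c) / c) (at \<tau>)" if "\<tau> > 0" for \<tau>
      proof -
        have "((\<lambda>\<tau>. \<tau> / c) has_real_derivative 1 / c) (at \<tau>)" using c by (auto intro!: derivative_eq_intros)
        from DERIV_chain2[where f = rr, OF drr this] that c show ?thesis by (simp add: q_def[abs_def])
      qed
      have q1: "\<bar>q \<tau>\<bar> \<le> 1" for \<tau> using rr by (simp add: q_def)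
      have ii: "i \<bullet> i = 1" using i by simp
      have k: "kx i (u + t *\<^sub>R (i, 0)) = ((fst u + t *\<^sub>R i) \<bullet> i) * q ((norm (fst u + t *\<^sub>R i))\<^sup>2)" for t
        by (simp add: kx_def q_def W_def c_def)
      have k': "kx' i (u + t *\<^sub>R (i, 0)) = q ((norm (fst u + t *\<^sub>R i))\<^sup>2) +
          2 * ((fst u + t *\<^sub>R i) \<bullet> i)\<^sup>2 * (r' ((norm (fst u + t *\<^sub>R i))\<^sup>2 / c) / c)" if "fst u + t *\<^sub>R i \<noteq> 0" for t
        using that c by (simp add: kx'_def q_def W_def c_def[symmetric] ee_def)
      note rl = radial_field_line[of i q "\<lambda>\<tau>. r' (\<tau> / c) / c" 1 "fst u", OF ii q q1]
      from rl(2) obtain S where S: "finite S" "\<And>t. t \<notin> S \<Longrightarrow> fst u + t *\<^sub>R i \<noteq> 0"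
        "\<And>t. t \<notin> S \<Longrightarrow> ((\<lambda>t. ((fst u + t *\<^sub>R i) \<bullet> i) * q ((norm (fst u + t *\<^sub>R i))\<^sup>2)) has_real_derivative
          q ((norm (fst u + t *\<^sub>R i))\<^sup>2) + 2 * ((fst u + t *\<^sub>R i) \<bullet> i)\<^sup>2 * (r' ((norm (fst u + t *\<^sub>R i))\<^sup>2 / c) / c)) (at t)"
        by auto
      show ?case unfolding k using rl(1) S k' by (intro conjI exI[of _ S]) auto
    qed
    have [measurable]: "kx i \<in> borel_measurable borel" "kx' i \<in> borel_measurable borel"
      unfolding kx_def[abs_def] kx'_def[abs_def] by measurable
    note st = stein_linear_growth[OF g_meas g unit1[OF i] T[unfolded T_def] mom _ _ bx bx' lines]
    show "integrable lborel (\<lambda>y. ((y - \<Theta>) \<bullet> (i, 0)) * kx i y * G y)"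
      "integrable lborel (\<lambda>y. kx' i y * F y)"
      "(LINT y|lborel. ((y - \<Theta>) \<bullet> (i, 0)) * kx i y * G y) = (LINT y|lborel. kx' i y * F y)"
      unfolding G_def F_def by (rule st; measurable)+
  qed
  have Z: "integrable lborel (\<lambda>y. ((y - \<Theta>) \<bullet> (0, j)) * kz j y * G y)"
    "integrable lborel (\<lambda>y. kz' j y * F y)"
    "(LINT y|lborel. ((y - \<Theta>) \<bullet> (0, j)) * kz j y * G y) = (LINT y|lborel. kz' j y * F y)"
    if j: "j \<in> Basis" for j
  proof -
    have bz: "\<bar>kz j y\<bar> \<le> C * norm (y - \<Theta>)" for y
    proof -
      have "\<bar>kz j y\<bar> = \<bar>snd y \<bullet> j\<bar> * psi (W y)" using psi by (simp add: kz_def abs_mult)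
      also have "\<dots> \<le> norm (y - \<Theta>) * C"
        using psi Basis_le_norm[OF j, of "snd y"] le_norm[of y] by (intro mult_mono) auto
      finally show ?thesis by (simp add: mult.commute)
    qed
    have bz': "\<bar>kz' j y\<bar> \<le> C + 2 * (C + 2 * C * C)" for y
    proof -
      have "\<bar>(snd y \<bullet> j)\<^sup>2 / (norm (snd y))\<^sup>2 * chi (W y)\<bar> \<le> 1 * (C + 2 * C * C)"
        unfolding abs_mult using quot[OF j, of "snd y"] chi C(1) by (intro mult_mono) auto
      then show ?thesis using psi[of "W y"] unfolding kz'_def by linarith
    qed
    have lines: "AE u in lborel. continuous_on UNIV (\<lambda>t. kz j (u + t *\<^sub>R (0, j))) \<and>
      (\<exists>S. finite S \<and> (\<forall>t. t \<notin> S \<longrightarrow> ((\<lambda>t. kz j (u + t *\<^sub>R (0, j))) has_real_derivative kz' j (u + t *\<^sub>R (0, j))) (at t)))"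
      using nz
    proof eventually_elim
      case (elim u)
      define c where "c = (norm (fst u))\<^sup>2"
      have c: "c > 0" using elim by (simp add: c_def)
      define q where "q \<tau> = psi (c / \<tau>)" for \<tau>
      have q: "(q has_real_derivative - (chi (c / \<tau>) / \<tau>)) (at \<tau>)" if "\<tau> > 0" for \<tau>
      proof -
        have "((\<lambda>\<tau>. c / \<tau>) has_real_derivative - (c / \<tau>\<^sup>2)) (at \<tau>)"
          using that by (auto intro!: derivative_eq_intros simp: power2_eq_square)
        from DERIV_chain2[where f = psi, OF dpsi this] that c show ?thesis
          by (simp add: q_def[abs_def] power2_eq_square)
      qed
      have q1: "\<bar>q \<tau>\<bar> \<le> C" for \<tau> using psi by (simp add: q_def)
      have jj: "j \<bullet> j = 1" using j by simp
      have k: "kz j (u + t *\<^sub>R (0, j)) = ((snd u + t *\<^sub>R j) \<bullet> j) * q ((norm (snd u + t *\<^sub>R j))\<^sup>2)" for t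
        by (simp add: kz_def q_def W_def c_def)
      have k': "kz' j (u + t *\<^sub>R (0, j)) = q ((norm (snd u + t *\<^sub>R j))\<^sup>2) +
          2 * ((snd u + t *\<^sub>R j) \<bullet> j)\<^sup>2 * (- (chi (c / (norm (snd u + t *\<^sub>R j))\<^sup>2) / (norm (snd u + t *\<^sub>R j))\<^sup>2))" for t
        by (simp add: kz'_def q_def W_def c_def[symmetric])
      note rl = radial_field_line[of j q "\<lambda>\<tau>. - (chi (c / \<tau>) / \<tau>)" C "snd u", OF jj q q1]
      from rl(2) obtain S where S: "finite S"
        "\<And>t. t \<notin> S \<Longrightarrow> ((\<lambda>t. ((snd u + t *\<^sub>R j) \<bullet> j) * q ((norm (snd u + t *\<^sub>R j))\<^sup>2)) has_real_derivative
          q ((norm (snd u + t *\<^sub>R j))\<^sup>2) + 2 * ((snd u + t *\<^sub>R j) \<bullet> j)\<^sup>2 *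
          (- (chi (c / (norm (snd u + t *\<^sub>R j))\<^sup>2) / (norm (snd u + t *\<^sub>R j))\<^sup>2))) (at t)"
        by auto
      show ?case unfolding k k' using rl(1) S by (intro conjI exI[of _ S]) auto
    qed
    have [measurable]: "kz j \<in> borel_measurable borel" "kz' j \<in> borel_measurable borel"
      unfolding kz_def[abs_def] kz'_def[abs_def] by measurable
    note st = stein_linear_growth[OF g_meas g unit2[OF j] T[unfolded T_def] mom _ _ bz bz' lines]
    show "integrable lborel (\<lambda>y. ((y - \<Theta>) \<bullet> (0, j)) * kz j y * G y)"
      "integrable lborel (\<lambda>y. kz' j y * F y)"
      "(LINT y|lborel. ((y - \<Theta>) \<bullet> (0, j)) * kz j y * G y) = (LINT y|lborel. kz' j y * F y)"
      unfolding G_def F_def by (rule st; measurable)+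
  qed

  \<comment> \<open>Almost everywhere \<open>dif\<close> is the difference of the two risk
    integrands, the second sum being the quadratic term rewritten through
    \<open>snd y\<close>.\<close>
  define dif where "dif y = - 2 * (\<Sum>i\<in>Basis. ((y - \<Theta>) \<bullet> (i, 0)) * kx i y * G y)
      + (\<Sum>j\<in>Basis. ((y - \<Theta>) \<bullet> (0, j)) * kz j y * G y)" for y
  have int_dif: "integrable lborel dif"
    unfolding dif_def using X(1) Z(1) by (intro Bochner_Integration.integrable_add integrable_mult_right Bochner_Integration.integrable_sum) auto
  have int_sums: "integrable lborel (\<lambda>y. \<Sum>i\<in>Basis. kx' i y * F y)" "integrable lborel (\<lambda>y. \<Sum>j\<in>Basis. kz' j y * F y)"
    using X(2) Z(2) by (auto intro: Bochner_Integration.integrable_sum)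
  have "(LINT y|lborel. dif y) = - 2 * (\<Sum>i\<in>Basis. LINT y|lborel. kx' i y * F y) + (\<Sum>j\<in>Basis. LINT y|lborel. kz' j y * F y)"
    unfolding dif_def using X Z by (simp add: integral_sum integrable_sum)
  also have "\<dots> = (LINT y|lborel. (- 2 * (\<Sum>i\<in>Basis. kx' i y) + (\<Sum>j\<in>Basis. kz' j y)) * F y)"
  proof -
    have eq: "(- 2 * (\<Sum>i\<in>Basis. kx' i y) + (\<Sum>j\<in>Basis. kz' j y)) * F y
        = - 2 * (\<Sum>i\<in>Basis. kx' i y * F y) + (\<Sum>j\<in>Basis. kz' j y * F y)" for y
      by (simp only: distrib_right sum_distrib_right mult.assoc)
    have "(LINT y|lborel. (\<Sum>i\<in>Basis. kx' i y * F y)) = (\<Sum>i\<in>Basis. LINT y|lborel. kx' i y * F y)"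
      "(LINT y|lborel. (\<Sum>j\<in>Basis. kz' j y * F y)) = (\<Sum>j\<in>Basis. LINT y|lborel. kz' j y * F y)"
      using X(2) Z(2) by (simp_all add: Bochner_Integration.integral_sum)
    then show ?thesis
      unfolding eq using int_sums by (subst Bochner_Integration.integral_add) simp_all
  qed
  also have "\<dots> \<le> (LINT y|(lborel :: ('a \<times> 'b) measure). (0 :: real))"
  proof (rule integral_mono_AE)
    show "integrable lborel (\<lambda>y. (- 2 * (\<Sum>i\<in>Basis. kx' i y) + (\<Sum>j\<in>Basis. kz' j y)) * F y)"
      using Bochner_Integration.integrable_add[OF integrable_mult_right[OF int_sums(1), of "- 2"] int_sums(2)]
      by (simp only: distrib_right sum_distrib_right mult.assoc)
    show "AE y in lborel. (- 2 * (\<Sum>i\<in>Basis. kx' i y) + (\<Sum>j\<in>Basis. kz' j y)) * F y \<le> 0"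
      using nz
    proof eventually_elim
      case (elim y)
      define w where "w = W y"
      have w: "w > 0" using elim by (simp add: w_def W_def)
      have q1: "(\<Sum>i\<in>Basis. (a \<bullet> i)\<^sup>2 / (norm a)\<^sup>2) = 1" if "a \<noteq> 0" for a :: "'c::euclidean_space"
        using that by (simp add: sum_divide_distrib[symmetric] sq[symmetric])
      have "(\<Sum>i\<in>Basis. kx' i y) = DIM('a) * rr w + 2 * (\<Sum>i\<in>Basis. (fst y \<bullet> i)\<^sup>2 / (norm (fst y))\<^sup>2) * ee w"
        by (simp add: kx'_def w_def sum.distrib sum_distrib_left sum_distrib_right)
      moreover have "(\<Sum>j\<in>Basis. kz' j y) = DIM('b) * psi w - 2 * (\<Sum>j\<in>Basis. (snd y \<bullet> j)\<^sup>2 / (norm (snd y))\<^sup>2) * chi w"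
        by (simp add: kz'_def w_def sum_subtractf sum_distrib_left sum_distrib_right)
      ultimately have "- 2 * (\<Sum>i\<in>Basis. kx' i y) + (\<Sum>j\<in>Basis. kz' j y)
         = - 2 * (DIM('a) * rr w + 2 * ee w) + (DIM('b) * psi w - 2 * chi w)"
        using elim by (simp add: q1)
      also have "\<dots> \<le> 0"
        using ineq[OF w] w by (simp add: rr_def ee_def psi_def chi_def algebra_simps)
      finally show ?case by (intro mult_nonpos_nonneg) (auto simp: F_def)
    qed
  qed simp
  finally have dif_le: "(LINT y|lborel. dif y) \<le> 0" by simp

  have "AE y in lborel. (norm (fst y - s y *\<^sub>R fst y - \<theta>))\<^sup>2 * g ((norm (y - (\<theta>, 0)))\<^sup>2) = (norm (fst y - \<theta>))\<^sup>2 * G y + dif y"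
    using nz
  proof eventually_elim
    case (elim y)
    define w where "w = W y"
    have "(\<Sum>i\<in>Basis. ((y - \<Theta>) \<bullet> (i, 0)) * kx i y * G y) = rr w * ((fst y - \<theta>) \<bullet> fst y) * G y"
      by (subst euclidean_inner[of "fst y - \<theta>"])
        (simp add: kx_def w_def \<Theta>_def inner_prod_def sum_distrib_left sum_distrib_right mult_ac)
    moreover have "(\<Sum>j\<in>Basis. ((y - \<Theta>) \<bullet> (0, j)) * kz j y * G y) = psi w * (norm (snd y))\<^sup>2 * G y"
      unfolding sq[of "snd y"]
      by (simp add: kz_def w_def \<Theta>_def inner_prod_def sum_distrib_left sum_distrib_right power2_eq_square mult_ac)
    moreover have "psi w * (norm (snd y))\<^sup>2 = (rr w)\<^sup>2 * (norm (fst y))\<^sup>2"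
      using elim by (simp add: psi_def w_def W_def)
    moreover have "(norm (fst y - s y *\<^sub>R fst y - \<theta>))\<^sup>2
       = (norm (fst y - \<theta>))\<^sup>2 - 2 * (rr w * ((fst y - \<theta>) \<bullet> fst y)) + (rr w)\<^sup>2 * (norm (fst y))\<^sup>2"
      unfolding power2_norm_eq_inner s w_def
      by (simp add: inner_diff_left inner_diff_right inner_commute power2_eq_square algebra_simps)
    ultimately show ?case
      unfolding dif_def G_def[symmetric] \<Theta>_def[symmetric] by (simp only: G_def[symmetric]) (simp add: algebra_simps)
  qed
  note dif_eq = this
  \<comment> \<open>The sum is again a risk integrand, hence nonnegative; this lets the extended
    integral be computed as a real one, to which \<open>dif_le\<close> applies.\<close>
  have pos: "AE y in lborel. 0 \<le> (norm (fst y - \<theta>))\<^sup>2 * G y + dif y"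
    using dif_eq
  proof eventually_elim
    case (elim y)
    show ?case unfolding elim[symmetric] using g by simp
  qed
  have "?RD = (\<integral>\<^sup>+ y. ennreal ((norm (fst y - \<theta>))\<^sup>2 * G y + dif y) \<partial>lborel)"
    by (rule nn_integral_cong_AE) (use dif_eq in \<open>auto elim!: eventually_mono\<close>)
  also have "\<dots> = ennreal (LINT y|lborel. (norm (fst y - \<theta>))\<^sup>2 * G y + dif y)"
    using int1 int_dif pos by (intro nn_integral_eq_integral) auto
  also have "\<dots> \<le> ennreal (LINT y|lborel. (norm (fst y - \<theta>))\<^sup>2 * G y)"
    using int1 int_dif dif_le by (intro ennreal_leI) simp
  also have "\<dots> = ?RX"
    using int1 G0 unfolding \<Theta>_def[symmetric] G_def[symmetric] by (intro nn_integral_eq_integral[symmetric]) auto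
  finally show ?thesis .
qed simp

text \<open>In the first alternative the condition says that \<open>P - n' \<phi>\<close> is
  nonnegative at the upper bound for \<phi>, which suffices because
  \<open>D \<ge> 0\<close>.\<close>

lemma (in riccati) shrinkage_inequality:
  assumes n': "n' > 0"
    and "(\<beta> \<le> 0 \<and> n' * (P + \<beta>) \<le> P * (M - \<beta>)) \<or>
      (\<beta> > 0 \<and> \<beta>\<^sup>2 * (P + M) + \<beta> * (2 * P * (P + M + 1) + M + n') \<le> P * (M - n'))"
  obtains C where "C \<ge> 0" "\<And>w. w > 0 \<Longrightarrow> w * r w \<le> C"
    "\<And>w. w > 0 \<Longrightarrow> (1 + w * r w) * D w + P - n' * (w * r w) \<ge> 0"
proof -
  have pos: "C \<ge> 0" if "\<And>w. w > 0 \<Longrightarrow> w * r w \<le> C" for C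
    using phi_le_w[of 1] that[of 1] by simp
  show ?thesis
  proof (cases "\<beta> \<le> 0")
    case True
    then have n'b: "n' * (P + \<beta>) \<le> P * (M - \<beta>)" using assms(2) by auto
    have "(1 + w * r w) * D w + P - n' * (w * r w) \<ge> 0" if w: "w > 0" for w
    proof -
      have "n' * (w * r w) \<le> n' * ((P + \<beta>) / (M - \<beta>))"
        using nonpos_case(1)[OF True w] n' by (intro mult_left_mono) auto
      also have "\<dots> \<le> P" using n'b \<beta> by (simp add: pos_divide_le_eq)
      finally have "n' * (w * r w) \<le> P" .
      moreover have "(1 + w * r w) * D w \<ge> 0"
        using nonpos_case(2)[OF True w] phi_le_w[OF w] by (intro mult_nonneg_nonneg) auto
      ultimately show ?thesis by linarith
    qed
    then show ?thesis using that nonpos_case(1)[OF True] pos by blast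
  next
    case False
    then have "\<beta> > 0" and g: "\<beta>\<^sup>2 * (P + M) + \<beta> * (2 * P * (P + M + 1) + M + n') \<le> P * (M - n')"
      using assms(2) by auto
    then show ?thesis using that pos_case[OF \<open>\<beta> > 0\<close> n' g] pos by blast
  qed
qed

section \<open>Minimaxity in terms of the reduced parameters\<close>

lemma minimax_gb_est:
  fixes f :: "real \<Rightarrow> real" and a e P M n' :: real
  assumes p: "real CARD('p::finite) = 2 * P + 2" and n: "real CARD('n::finite) = 4 * n' - 2" and P: "P > 0"
    and M_def: "M = 2 * n' + e + 1" and PM: "P + M > 0" "a + 2 \<le> 0 \<or> M > 0"
    and a: "a < -1" "P + (a + 2) > 0" "M - (a + 2) > 0"
    and f_meas [measurable]: "f \<in> borel_measurable borel" and f: "\<And>t. t \<ge> 0 \<Longrightarrow> f t \<ge> 0"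
    and cond: "(a + 2 \<le> 0 \<and> n' * (P + (a + 2)) \<le> P * (M - (a + 2))) \<or>
      (a + 2 > 0 \<and> (a + 2)\<^sup>2 * (P + M) + (a + 2) * (2 * P * (P + M + 1) + M + n') \<le> P * (M - n'))"
  shows "minimax f (\<lambda>(x::real^'p) (z::real^'n). gb_est (real CARD('n)) a e x (z \<bullet> z))"
  unfolding minimax_def
proof (intro allI impI)
  fix \<theta> :: "real^'p" and \<sigma> :: real assume \<sigma>: "\<sigma> > 0"
  define r where "r = ratio P M (a + 2)"
  have M_eq: "real CARD('n) / 2 + e + 2 = M" unfolding M_def n by (simp add: field_simps)
  have "n' > 0" using n by (simp add: field_simps)
  interpret riccati P M "a + 2" r
    unfolding r_def using P PM a by (intro riccati_ratio) auto
  obtain C where C: "C \<ge> 0" "\<And>w. w > 0 \<Longrightarrow> w * r w \<le> C"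
    "\<And>w. w > 0 \<Longrightarrow> (1 + w * r w) * D w + P - n' * (w * r w) \<ge> 0"
    using shrinkage_inequality[OF \<open>n' > 0\<close> cond] by blast
  define r' where "r' w = r w * (D w - 1) / w" for w
  \<comment> \<open>A common bound for \<phi> and for \<open>w r' = r (D - 1)\<close>; the latter is
    controlled through \<open>|r D| \<le> |Y|\<close>.\<close>
  define K where "K = \<bar>a + 2\<bar> * (1 + C) + (\<bar>M\<bar> * C + P) + 1 + C"
  \<comment> \<open>The scale \<sigma> is absorbed into the radial profile. Taking
    \<open>max 0\<close> makes the profile nonnegative on the whole line, as \<open>f\<close> is
    known to be so only on nonnegative arguments.\<close>
  define g where "g t = (1 / \<sigma>\<^sup>2) powr ((real CARD('p) + real CARD('n)) / 2) / \<sigma>\<^sup>2 * max 0 (f (t / \<sigma>\<^sup>2))" for t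
  have integrand: "t / \<sigma>\<^sup>2 * sph_density f \<theta> \<sigma> y = t * g ((norm (y - (\<theta>, 0)))\<^sup>2)"
    for t and y :: "(real^'p) \<times> (real^'n)"
  proof -
    have "(norm (y - (\<theta>, 0)))\<^sup>2 = (norm (fst y - \<theta>))\<^sup>2 + (norm (snd y))\<^sup>2" by (simp add: norm_prod_def)
    then show ?thesis
      using f[of "((norm (fst y - \<theta>))\<^sup>2 + (norm (snd y))\<^sup>2) / \<sigma>\<^sup>2"] by (simp add: sph_density_def g_def Let_def max_def)
  qed
  define s where "s y = (if fst y \<noteq> 0 \<and> snd y \<noteq> 0 then r ((norm (fst y))\<^sup>2 / (norm (snd y))\<^sup>2) else 0)"
    for y :: "(real^'p) \<times> (real^'n)"
  have gb: "gb_est (real CARD('n)) a e (fst y) (snd y \<bullet> snd y) = fst y - s y *\<^sub>R fst y"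
    if "fst y \<noteq> 0" "snd y \<noteq> 0" for y :: "(real^'p) \<times> (real^'n)"
  proof -
    have "- P - real CARD('n) / 2 - 2 < e" using \<open>P + M > 0\<close> M_eq by linarith
    then have "gb_est (real CARD('n)) a e (fst y) (snd y \<bullet> snd y)
      = (1 - ratio P (real CARD('n) / 2 + e + 2) (a + 2) ((norm (fst y))\<^sup>2 / (snd y \<bullet> snd y))) *\<^sub>R fst y"
      using that a p by (intro gb_est_eq_ratio) auto
    also have "\<dots> = fst y - s y *\<^sub>R fst y"
      unfolding M_eq using that by (simp add: s_def r_def power2_norm_eq_inner[symmetric] scaleR_diff_left)
    finally show ?thesis .
  qed
  have "risk f (\<lambda>(x::real^'p) (z::real^'n). gb_est (real CARD('n)) a e x (z \<bullet> z)) \<theta> \<sigma>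
     = (\<integral>\<^sup>+ y. ennreal ((norm (fst y - s y *\<^sub>R fst y - \<theta>))\<^sup>2 * g ((norm (y - (\<theta>, 0)))\<^sup>2)) \<partial>lborel)"
    unfolding risk_def integrand
  proof (rule nn_integral_cong_AE)
    show "AE y in lborel. ennreal ((norm (gb_est (real CARD('n)) a e (fst y) (snd y \<bullet> snd y) - \<theta>))\<^sup>2 * g ((norm (y - (\<theta>, 0)))\<^sup>2))
      = ennreal ((norm (fst y - s y *\<^sub>R fst y - \<theta>))\<^sup>2 * g ((norm (y - (\<theta>, 0)))\<^sup>2))"
      using AE_lborel_pair_nonzero by eventually_elim (subst gb; simp)
  qed
  also have "\<dots> \<le> (\<integral>\<^sup>+ y. ennreal ((norm (fst y - \<theta>))\<^sup>2 * g ((norm (y - (\<theta>, 0)))\<^sup>2)) \<partial>(lborel :: ((real^'p) \<times> (real^'n)) measure))"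
  proof (rule shrinkage_risk_le[where r = r and r' = r' and C = K])
    show "g \<in> borel_measurable borel" unfolding g_def[abs_def] by measurable
    show "g t \<ge> 0" for t by (simp add: g_def)
    show "K \<ge> 1" using C(1) P by (simp add: K_def)
    fix w :: real assume w: "w > 0"
    show "r w > 0" by (rule r(1)[OF w])
    show "r w < 1" by (rule r_lt_1[OF w])
    show "(r has_real_derivative r' w) (at w)" unfolding r'_def by (rule r_deriv[OF w])
    have nonneg: "0 \<le> \<bar>a + 2\<bar> * (1 + C)" "0 \<le> \<bar>M\<bar> * C" using C(1) by simp_all
    show "w * r w \<le> K" using C(2)[OF w] nonneg P unfolding K_def by linarith
    have wr': "w * r' w = r w * (D w - 1)" using w by (simp add: r'_def)
    show "\<bar>w * r' w\<bar> \<le> K"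
    proof -
      have \<phi>: "0 \<le> w * r w" "w * r w \<le> C" using phi_le_w[OF w] C(2)[OF w] by auto
      have "\<bar>r w * D w\<bar> \<le> \<bar>Y w\<bar>" using r(1)[OF w] w by (simp add: D_def abs_divide divide_le_eq mult_le_cancel_left1)
      moreover have "\<bar>Y w\<bar> \<le> \<bar>a + 2\<bar> * (1 + C) + (\<bar>M\<bar> * C + P) * 1"
      proof -
        have "\<bar>Y w\<bar> \<le> \<bar>(a + 2) * (1 + w * r w)\<bar> + \<bar>(M * (w * r w) - P) * (1 - r w)\<bar>"
          unfolding Y_def by (rule abs_triangle_ineq4)
        also have "\<bar>(a + 2) * (1 + w * r w)\<bar> \<le> \<bar>a + 2\<bar> * (1 + C)"
          unfolding abs_mult using \<phi> by (intro mult_left_mono) auto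
        also have "\<bar>(M * (w * r w) - P) * (1 - r w)\<bar> \<le> (\<bar>M\<bar> * C + P) * 1"
          unfolding abs_mult
        proof (rule mult_mono)
          have "\<bar>M * (w * r w) - P\<bar> \<le> \<bar>M\<bar> * (w * r w) + P"
            using abs_triangle_ineq4[of "M * (w * r w)" P] abs_mult[of M "w * r w"] abs_of_nonneg[OF \<phi>(1)] P
            by simp
          also have "\<dots> \<le> \<bar>M\<bar> * C + P" using \<phi>(2) by (simp add: mult_left_mono)
          finally show "\<bar>M * (w * r w) - P\<bar> \<le> \<bar>M\<bar> * C + P" .
          show "\<bar>1 - r w\<bar> \<le> 1" using r(1)[OF w] r_lt_1[OF w] by simp
        qed (use nonneg P in auto)
        finally show ?thesis by simp
      qed
      moreover have "\<bar>r w * (D w - 1)\<bar> \<le> \<bar>r w * D w\<bar> + r w"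
        using abs_triangle_ineq4[of "r w * D w" "r w"] r(1)[OF w] by (simp add: right_diff_distrib)
      ultimately show ?thesis using r_lt_1[OF w] C(1) unfolding wr' K_def by (smt (verit))
    qed
    \<comment> \<open>Four times this product is the right side minus the left side of the required
      inequality, by \<open>p = 2 P + 2\<close> and \<open>n = 4 n' - 2\<close>.\<close>
    have "r w * ((1 + w * r w) * D w + P - n' * (w * r w)) \<ge> 0"
      using C(3)[OF w] r(1)[OF w] by simp
    then show "(real DIM(real^'n) - 2) * (w * (r w)\<^sup>2) - 4 * (w * r w) * (w * r' w)
      \<le> 2 * (real DIM(real^'p) * r w + 2 * (w * r' w))"
      unfolding wr' by (simp add: n p algebra_simps power2_eq_square)
  qed (simp add: s_def)
  also have "\<dots> = risk f (\<lambda>(x::real^'p) (z::real^'n). x) \<theta> \<sigma>"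
    unfolding risk_def integrand ..
  finally show "risk f (\<lambda>(x::real^'p) (z::real^'n). gb_est (real CARD('n)) a e x (z \<bullet> z)) \<theta> \<sigma>
    \<le> risk f (\<lambda>(x::real^'p) (z::real^'n). x) \<theta> \<sigma>" .
qed

lemma gpoly_quarter:
  assumes "p = 2 * P + 2" "n = 4 * n' - 2" "M = 2 * n' + e + 1"
  shows "gpoly p n e a / 4 = (a + 2)\<^sup>2 * (P + M) + (a + 2) * (2 * P * (P + M + 1) + M + n') - P * (M - n')"
proof -
  have e: "e = M - 2 * n' - 1" using assms(3) by simp
  show ?thesis unfolding gpoly_def assms(1,2) e by (simp add: algebra_simps power2_eq_square)
qed

theorem theorem4p1:
  fixes f :: "real \<Rightarrow> real" and a e :: real
    and tyP :: "'p::finite itself" and tyN :: "'n::finite itself"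
  defines "p \<equiv> real CARD('p)" and "n \<equiv> real CARD('n)"
  assumes p3: "CARD('p) \<ge> 3"
    and f_meas: "f \<in> borel_measurable borel"
    and f_nonneg: "\<forall>t\<ge>0. f t \<ge> 0"
    and f_density: "(\<integral>\<^sup>+ w. ennreal (sph_density f (0::real^'p) 1 (w :: (real^'p) \<times> (real^'n))) \<partial>lborel) = 1"
    and f_int: "(\<integral>\<^sup>+ t. ennreal (indicator {0..} t * t powr ((p + n) / 2 - 1) * f t) \<partial>lborel) < \<infinity>"
    and f_moment: "(\<integral>\<^sup>+ t. ennreal (indicator {0..} t * t powr ((n + p) / 2 - a + e) * f t) \<partial>lborel) < \<infinity>"
  shows
    "((- p/2 - n/2 - 1 < e \<and> e \<le> - n/4 - 3/2 \<and>
       - p/2 - 1 < a \<and> a \<le> (cpn p n * (n/2 + e) - p/2 - 1) / (1 + cpn p n))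
       \<longrightarrow> minimax f (\<lambda>(x::real^'p) (z::real^'n). gb_est n a e x (z \<bullet> z)))
     \<and>
     ((e > - n/4 - 3/2 \<and> CARD('n) \<ge> 2 \<and> - p/2 - 1 < a \<and>
       (\<exists>a_star. gpoly p n e a_star = 0 \<and> (\<forall>r. gpoly p n e r = 0 \<longrightarrow> r \<le> a_star)
                 \<and> a \<le> a_star))
       \<longrightarrow> minimax f (\<lambda>(x::real^'p) (z::real^'n). gb_est n a e x (z \<bullet> z)))"
proof -
  define P where "P = p / 2 - 1"
  define n' where "n' = (n + 2) / 4"
  define M where "M = 2 * n' + e + 1"
  define \<beta> where "\<beta> = a + 2"
  have P: "P > 0" using p3 by (simp add: P_def p_def)
  have n'0: "n' > 1 / 2" using zero_less_card_finite[where 'a = 'n] by (simp add: n'_def n_def)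
  have pP: "p = 2 * P + 2" and nn': "n = 4 * n' - 2" by (simp_all add: P_def n'_def field_simps)
  note main = minimax_gb_est[where 'p = 'p and 'n = 'n, of P n' M e a f,
      OF pP[unfolded p_def] nn'[unfolded n_def] P M_def, folded n_def \<beta>_def]
  have f0: "\<And>t. t \<ge> 0 \<Longrightarrow> f t \<ge> 0" using f_nonneg by simp
  have cM: "n/2 + e = M - 2" by (simp add: M_def nn')
  have cpn: "cpn p n = P / n'" using n'0 by (simp add: cpn_def pP nn' field_simps)
  show ?thesis
  proof (intro conjI impI; elim conjE)
    assume e: "- p/2 - n/2 - 1 < e" "e \<le> - n/4 - 3/2"
      and a: "- p/2 - 1 < a" "a \<le> (cpn p n * (n/2 + e) - p/2 - 1) / (1 + cpn p n)"
    \<comment> \<open>The two ranges of \<open>e\<close> in the theorem are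
      \<open>M \<le> n'\<close> and \<open>M > n'\<close>.\<close>
    have PM: "P + M > 0" and Mn: "M \<le> n'" using e by (simp_all add: M_def pP nn' field_simps)
    have Pb: "P + \<beta> > 0" using a(1) by (simp add: pP \<beta>_def field_simps)
    define c where "c = P / n'"
    have c0: "c > 0" using P n'0 by (simp add: c_def)
    have "a \<le> (c * (M - 2) - (P + 1) - 1) / (1 + c)"
      using a(2) unfolding cpn cM c_def[symmetric] by (simp add: P_def)
    \<comment> \<open>Clearing the denominator turns the bound on \<open>a\<close> into
      \<open>n' (P + \<beta>) \<le> P (M - \<beta>)\<close>, the condition of the case \<beta> \<le>
      0.\<close>
    then have "a * (1 + c) \<le> c * (M - 2) - (P + 1) - 1" using c0 by (simp add: pos_le_divide_eq)
    then have "P + \<beta> \<le> c * (M - \<beta>)" by (simp add: \<beta>_def algebra_simps)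
    then have key: "n' * (P + \<beta>) \<le> P * (M - \<beta>)"
      using n'0 mult_left_mono[of "P + \<beta>" "c * (M - \<beta>)" n'] by (simp add: c_def)
    have "0 < n' * (P + \<beta>)" using n'0 Pb by simp
    then have "0 < P * (M - \<beta>)" using key by linarith
    then have Mb: "M - \<beta> > 0" using P by (simp only: zero_less_mult_pos)
    \<comment> \<open>Because \<open>M \<le> n'\<close>, that condition itself forces \<beta> \<le>
      0, so part (i) never meets the quadratic condition.\<close>
    have "P * M \<le> P * n'" using Mn P by simp
    then have "\<beta> * (n' + P) \<le> 0" using key by (simp add: algebra_simps)
    then have b: "\<beta> \<le> 0" using n'0 P by (simp add: mult_le_0_iff)
    then have "a < -1" by (simp add: \<beta>_def)
    then show "minimax f (\<lambda>(x::real^'p) (z::real^'n). gb_est n a e x (z \<bullet> z))"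
      using PM Pb Mb b key f_meas f0 by (intro main) auto
  next
    assume e: "e > - n/4 - 3/2" and a: "- p/2 - 1 < a"
      and "\<exists>a_star. gpoly p n e a_star = 0 \<and> (\<forall>r. gpoly p n e r = 0 \<longrightarrow> r \<le> a_star) \<and> a \<le> a_star"
    then obtain a_star where as: "gpoly p n e a_star = 0" "a \<le> a_star" by blast
    have Mn: "M > n'" using e by (simp add: M_def nn' field_simps)
    have Pb: "P + \<beta> > 0" using a by (simp add: pP \<beta>_def field_simps)
    have PM: "P + M > 0" using P Mn n'0 by linarith
    show "minimax f (\<lambda>(x::real^'p) (z::real^'n). gb_est n a e x (z \<bullet> z))"
    proof (cases "\<beta> \<le> 0")
      case True
      have "n' * \<beta> \<le> 0" "P * \<beta> \<le> 0" "P * n' \<le> P * M"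
        using True n'0 P Mn by (auto simp: mult_le_0_iff)
      then have key: "n' * (P + \<beta>) \<le> P * (M - \<beta>)" by (simp add: algebra_simps)
      have "M - \<beta> > 0" "a < -1" using True Mn n'0 by (simp_all add: \<beta>_def)
      then show ?thesis using PM Pb True key f_meas f0 by (intro main) auto
    next
      case False
      define B where "B = 2 * P * (P + M + 1) + M + n'"
      define \<gamma> where "\<gamma> = a_star + 2"
      have B: "B > 0" unfolding B_def using P PM Mn n'0 by (intro add_pos_pos mult_pos_pos) auto
      have root: "\<gamma>\<^sup>2 * (P + M) + \<gamma> * B = P * (M - n')"
        using gpoly_quarter[OF pP nn' M_def, of a_star] as by (simp add: \<gamma>_def B_def)
      \<comment> \<open>The quadratic form increases on the positive axis, so its equation at the
        root \<gamma> gives the inequality at \<beta>.\<close>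
      have "\<beta> \<le> \<gamma>" "\<beta> > 0" using as False by (simp_all add: \<beta>_def \<gamma>_def)
      then have "\<beta>\<^sup>2 * (P + M) + \<beta> * B \<le> \<gamma>\<^sup>2 * (P + M) + \<gamma> * B"
        using PM B by (intro add_mono mult_right_mono power_mono) auto
      then have quad: "\<beta>\<^sup>2 * (P + M) + \<beta> * (2 * P * (P + M + 1) + M + n') \<le> P * (M - n')"
        using root by (simp add: B_def)
      \<comment> \<open>A single term of the quadratic condition already confines \<beta> below both
        1 and \<open>M\<close>.\<close>
      have "\<beta> * (2 * P * (P + M + 1)) \<le> P * (M - n')"
      proof -
        have "0 \<le> \<beta>\<^sup>2 * (P + M)" "0 \<le> \<beta> * (M + n')" using PM \<open>\<beta> > 0\<close> Mn n'0 by simp_all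
        then show ?thesis using quad by (simp add: algebra_simps)
      qed
      then have "P * (2 * \<beta> * (P + M + 1)) \<le> P * (M - n')" by (simp add: mult_ac)
      then have "2 * \<beta> * (P + M + 1) \<le> M - n'" using P by simp
      then have lt: "\<beta> * (P + M + 1) < M" using n'0 Mn by simp
      have "\<beta> < 1"
      proof (rule ccontr)
        assume "\<not> \<beta> < 1"
        then have "1 * (P + M + 1) \<le> \<beta> * (P + M + 1)" using PM by (intro mult_right_mono) auto
        from le_less_trans[OF this lt] show False using P by simp
      qed
      moreover have "\<beta> * 1 \<le> \<beta> * (P + M + 1)" using \<open>\<beta> > 0\<close> PM by (intro mult_left_mono) auto
      ultimately have "a < -1" "M - \<beta> > 0" using lt by (simp_all add: \<beta>_def)
      then show ?thesis using PM Pb \<open>\<beta> > 0\<close> Mn n'0 quad f_meas f0 by (intro main) auto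
    qed
  qed
qed

end
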